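(* For any even integer $n\ge2$ there exist finite subgroups $\Gamma$ and $\Gamma'$ of $G=\mathrm{SO}(2n)$ such that $\Gamma\backslash S^{2n-1}$ and $\Gamma'\backslash S^{2n-1}$ are isospectral on $(n-1)$-forms, but $\Gamma$ and $\Gamma'$ are not $\tau_{n-1}$-representation equivalent in $G$.
   Context: $S^{2n-1}=G/K$ with $G=\mathrm{SO}(2n)$, $K=\mathrm{SO}(2n-1)$ embedded in the upper left-hand block, with the round metric of constant curvature one. $\tau_p$ denotes the representation of $K$ on $\bigwedge^p(\mathfrak p_{\mathbb C}^* )$, where $\mathfrak g=\mathfrak k\oplus\mathfrak p$ is the orthogonal decomposition and $K$ acts on $\mathfrak p_{\mathbb C}^*$ by the contragredient of the complexified adjoint action; equivalently, $\tau_p$ is the $p$-th exterior power of the standard representation $\mathbb C^{2n-1}$ of $\mathrm{SO}(2n-1)$. Isospectral on $(n-1)$-forms means that the Hodge–Laplace operator restricted to $\Gamma$-invariant smooth $(n-1)$-forms on $S^{2n-1}$ and the one restricted to $\Gamma'$-invariant ones have the same spectrum with multiplicities. $\Gamma$ and $\Gamma'$ are $\tau$-representation equivalent in $G$ if $n_\Gamma(\pi)=n_{\Gamma'}(\pi)$ for every $\pi\in\widehat G$ with $\mathrm{Hom}_K(V_\tau,V_\pi)\ne0$, where $n_\Gamma(\pi)=\dim\mathrm{Hom}_G(V_\pi,L^2(\Gamma\backslash G))=\dim V_\pi^\Gamma$. *)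

theory Defs
  imports
    "HOL-Analysis.Derivative"
    "HOL-Library.Function_Algebras"
    "Jordan_Normal_Form.Schur_Decomposition"
    "Jordan_Normal_Form.VS_Connect"
begin

no_notation inner (infix "\<bullet>" 70)

text \<open>Throughout, \<open>N\<close> is the dimension of the ambient Euclidean space, so the sphere is
  \<open>S^(N-1) = SO(N)/SO(N-1)\<close>.\<close>

section \<open>The groups and the Lie algebra\<close>

definition SO_group :: "nat \<Rightarrow> real mat monoid" where
  "SO_group N = \<lparr>carrier = {A \<in> carrier_mat N N. A * transpose_mat A = 1\<^sub>m N \<and> det A = 1},
                 mult = (*), one = 1\<^sub>m N\<rparr>"

definition U_group :: "nat \<Rightarrow> complex mat monoid" where
  "U_group m = \<lparr>carrier = {A \<in> carrier_mat m m. A * mat_adjoint A = 1\<^sub>m m},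
                mult = (*), one = 1\<^sub>m m\<rparr>"

definition K_sub :: "nat \<Rightarrow> real mat set" where
  "K_sub N = {four_block_mat B (0\<^sub>m (N - 1) 1) (0\<^sub>m 1 (N - 1)) (1\<^sub>m 1) | B.
                B \<in> carrier (SO_group (N - 1))}"

definition so_alg :: "nat \<Rightarrow> real mat set" where
  "so_alg N = {X \<in> carrier_mat N N. transpose_mat X = - X}"

definition k_alg :: "nat \<Rightarrow> real mat set" where
  "k_alg N = {four_block_mat Y (0\<^sub>m (N - 1) 1) (0\<^sub>m 1 (N - 1)) (0\<^sub>m 1 1) | Y. Y \<in> so_alg (N - 1)}"

text \<open>The orthogonal complement of \<open>k_alg N\<close> for the trace form \<open>tr (X\<^sup>T Y)\<close>, which is a multiple
  of the Killing form.\<close>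

definition p_space :: "nat \<Rightarrow> real mat set" where
  "p_space N = {X \<in> so_alg N. \<forall>Y \<in> k_alg N. (\<Sum>i<N. (transpose_mat X * Y) $$ (i, i)) = 0}"

section \<open>Alternating forms\<close>

text \<open>\<open>alt_forms sc V p\<close> is \<open>\<Lambda>\<^sup>p(V\<^sup>*) \<otimes> \<complex> = \<Lambda>\<^sup>p(V\<^sub>\<complex>\<^sup>*)\<close>: the complex-valued alternating real-multilinear
  functions of \<open>p\<close> arguments in \<open>V\<close>. Arguments are passed as a list, and a form vanishes on lists
  that are not in \<open>V\<^sup>p\<close>, so that distinct functions are distinct forms.\<close>

definition alt_forms ::
    "(real \<Rightarrow> 'a \<Rightarrow> 'a) \<Rightarrow> 'a::plus set \<Rightarrow> nat \<Rightarrow> ('a list \<Rightarrow> complex) set" where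
  "alt_forms sc V p = {f.
     (\<forall>vs. length vs = p \<and> set vs \<subseteq> V \<longrightarrow>
        (\<forall>i<p. \<forall>a\<in>V. \<forall>b\<in>V. f (vs[i := a + b]) = f (vs[i := a]) + f (vs[i := b])) \<and>
        (\<forall>i<p. \<forall>a\<in>V. \<forall>r. f (vs[i := sc r a]) = of_real r * f (vs[i := a])) \<and>
        (\<forall>i<p. \<forall>j<p. i \<noteq> j \<and> vs ! i = vs ! j \<longrightarrow> f vs = 0)) \<and>
     (\<forall>vs. \<not> (length vs = p \<and> set vs \<subseteq> V) \<longrightarrow> f vs = 0)}"

section \<open>Differential forms on the unit sphere\<close>

definition unit_sphere :: "nat \<Rightarrow> real vec set" where
  "unit_sphere N = {x \<in> carrier_vec N. x \<bullet> x = 1}"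

definition tangent :: "nat \<Rightarrow> real vec \<Rightarrow> real vec set" where
  "tangent N x = {v \<in> carrier_vec N. v \<bullet> x = 0}"

definition punctured :: "nat \<Rightarrow> real vec set" where
  "punctured N = carrier_vec N - {0\<^sub>v N}"

definition vnorm :: "real vec \<Rightarrow> real" where
  "vnorm x = sqrt (x \<bullet> x)"

definition dir_deriv :: "(real vec \<Rightarrow> complex) \<Rightarrow> real vec \<Rightarrow> real vec \<Rightarrow> complex" where
  "dir_deriv f y v = vector_derivative (\<lambda>t. f (y + t \<cdot>\<^sub>v v)) (at 0)"

primrec iter_deriv :: "real vec list \<Rightarrow> (real vec \<Rightarrow> complex) \<Rightarrow> real vec \<Rightarrow> complex" where
  "iter_deriv [] f = f"
| "iter_deriv (v # vs) f = (\<lambda>y. dir_deriv (iter_deriv vs f) y v)"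

text \<open>\<open>C\<^sup>\<infinity>\<close> functions on \<open>\<real>\<^sup>N - {0}\<close>: all iterated directional derivatives exist and are
  continuous.\<close>

definition smooth_punctured :: "nat \<Rightarrow> (real vec \<Rightarrow> complex) \<Rightarrow> bool" where
  "smooth_punctured N f \<longleftrightarrow> (\<forall>vs. set vs \<subseteq> carrier_vec N \<longrightarrow>
     (\<forall>y \<in> punctured N.
        (\<forall>\<epsilon>>0. \<exists>\<delta>>0. \<forall>z \<in> punctured N. vnorm (z - y) < \<delta> \<longrightarrow>
            cmod (iter_deriv vs f z - iter_deriv vs f y) < \<epsilon>) \<and>
        (\<forall>v \<in> carrier_vec N. (\<lambda>t. iter_deriv vs f (y + t \<cdot>\<^sub>v v)) differentiable (at 0))))"

text \<open>A form on the sphere is a function \<open>\<omega>\<close> with \<open>\<omega> x [v\<^sub>1, \<dots>, v\<^sub>p]\<close> its value at the point \<open>x\<close>.\<close>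

type_synonym sform = "real vec \<Rightarrow> real vec list \<Rightarrow> complex"

text \<open>The pullback of a form under the retraction \<open>r y = y / |y|\<close> of \<open>\<real>\<^sup>N - {0}\<close> onto the sphere, whose
  differential is \<open>v \<mapsto> (v - (\<langle>v,y\<rangle> / |y|\<^sup>2) y) / |y|\<close>.\<close>

definition radial_pullback :: "sform \<Rightarrow> sform" where
  "radial_pullback \<omega> y vs =
     \<omega> ((1 / vnorm y) \<cdot>\<^sub>v y)
       (map (\<lambda>v. (1 / vnorm y) \<cdot>\<^sub>v (v - ((v \<bullet> y) / (y \<bullet> y)) \<cdot>\<^sub>v y)) vs)"

definition smooth_forms :: "nat \<Rightarrow> nat \<Rightarrow> sform set" where
  "smooth_forms N p = {\<omega>.
     (\<forall>x \<in> unit_sphere N. \<omega> x \<in> alt_forms (\<cdot>\<^sub>v) (tangent N x) p) \<and>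
     (\<forall>x. x \<notin> unit_sphere N \<longrightarrow> \<omega> x = 0) \<and>
     (\<forall>vs. length vs = p \<and> set vs \<subseteq> carrier_vec N \<longrightarrow>
        smooth_punctured N (\<lambda>y. radial_pullback \<omega> y vs))}"

text \<open>Exterior derivative of a \<open>p\<close>-form. With \<open>\<iota>\<close> the inclusion of the sphere, \<open>r \<circ> \<iota> = id\<close> gives
  \<open>d\<omega> = \<iota>\<^sup>* d(r\<^sup>*\<omega>)\<close>, and on the open set \<open>\<real>\<^sup>N - {0}\<close> the derivative is given by the usual formula
  for constant vector fields.\<close>

definition ext_deriv :: "nat \<Rightarrow> nat \<Rightarrow> sform \<Rightarrow> sform" where
  "ext_deriv N p \<omega> x vs =
     (if x \<in> unit_sphere N \<and> length vs = Suc p \<and> set vs \<subseteq> tangent N x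
      then \<Sum>j\<le>p. (- 1) ^ j *
             dir_deriv (\<lambda>y. radial_pullback \<omega> y (take j vs @ drop (Suc j) vs)) x (vs ! j)
      else 0)"

text \<open>Orthogonal projection to the tangent space at \<open>x\<close> of the standard basis vector \<open>e\<^sub>i\<close>.
  For \<open>x\<close> on the sphere, \<open>\<Sum>\<^sub>i tan_unit N x i \<otimes> tan_unit N x i\<close> is the inverse metric at \<open>x\<close>.\<close>

definition tan_unit :: "nat \<Rightarrow> real vec \<Rightarrow> nat \<Rightarrow> real vec" where
  "tan_unit N x i = unit_vec N i - (unit_vec N i \<bullet> x) \<cdot>\<^sub>v x"

text \<open>Hodge star on \<open>p\<close>-forms, in index notation
  \<open>(*\<omega>)\<^sub>b = (1/p!) \<omega>\<^sup>a vol\<^sub>a\<^sub>b\<close> with multi-indices \<open>a\<close>, \<open>b\<close> and the Riemannian volume form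
  \<open>vol (v\<^sub>1, \<dots>, v\<^sub>N\<^sub>-\<^sub>1) = det (x, v\<^sub>1, \<dots>, v\<^sub>N\<^sub>-\<^sub>1)\<close>.\<close>

definition hodge_star :: "nat \<Rightarrow> nat \<Rightarrow> sform \<Rightarrow> sform" where
  "hodge_star N p \<omega> x vs =
     (if x \<in> unit_sphere N \<and> 1 + p + length vs = N \<and> set vs \<subseteq> tangent N x
      then (\<Sum>is \<in> {is. length is = p \<and> set is \<subseteq> {..<N}}.
              \<omega> x (map (tan_unit N x) is) *
              of_real (det (mat_of_cols N (x # map (tan_unit N x) is @ vs)))) / fact p
      else 0)"

text \<open>\<open>\<delta> = (-1)^(m(p+1)+1) * d *\<close> on \<open>p\<close>-forms, where \<open>m = N - 1\<close> is the dimension of the sphere.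
  For \<open>p = 0\<close> this is zero, since \<open>hodge_star N N\<close> is.\<close>

definition codiff :: "nat \<Rightarrow> nat \<Rightarrow> sform \<Rightarrow> sform" where
  "codiff N p \<omega> x vs =
     (- 1) ^ ((N - 1) * (p + 1) + 1) *
     hodge_star N (N - p) (ext_deriv N (N - 1 - p) (hodge_star N p \<omega>)) x vs"

definition hodge_laplace :: "nat \<Rightarrow> nat \<Rightarrow> sform \<Rightarrow> sform" where
  "hodge_laplace N p \<omega> =
     ext_deriv N (p - 1) (codiff N p \<omega>) + codiff N (p + 1) (ext_deriv N p \<omega>)"

section \<open>Isospectrality\<close>

definition invariant_forms :: "nat \<Rightarrow> nat \<Rightarrow> real mat set \<Rightarrow> sform set" where
  "invariant_forms N p \<Gamma> = {\<omega> \<in> smooth_forms N p.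
     \<forall>g \<in> \<Gamma>. \<forall>x \<in> unit_sphere N. \<forall>vs. set vs \<subseteq> tangent N x \<longrightarrow>
       \<omega> (g *\<^sub>v x) (map (\<lambda>v. g *\<^sub>v v) vs) = \<omega> x vs}"

definition sform_scale :: "complex \<Rightarrow> sform \<Rightarrow> sform" where
  "sform_scale c \<omega> = (\<lambda>x vs. c * \<omega> x vs)"

lemma vector_space_sform_scale: "vector_space sform_scale"
  by unfold_locales (auto simp: sform_scale_def fun_eq_iff algebra_simps)

definition eigenforms :: "nat \<Rightarrow> nat \<Rightarrow> real mat set \<Rightarrow> complex \<Rightarrow> sform set" where
  "eigenforms N p \<Gamma> c = {\<omega> \<in> invariant_forms N p \<Gamma>. hodge_laplace N p \<omega> = sform_scale c \<omega>}"

definition form_spectrum :: "nat \<Rightarrow> nat \<Rightarrow> real mat set \<Rightarrow> complex set" where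
  "form_spectrum N p \<Gamma> = {c. \<exists>\<omega> \<in> eigenforms N p \<Gamma> c. \<omega> \<noteq> 0}"

definition isospectral_on_forms :: "nat \<Rightarrow> nat \<Rightarrow> real mat set \<Rightarrow> real mat set \<Rightarrow> bool" where
  "isospectral_on_forms N p \<Gamma> \<Gamma>' \<longleftrightarrow>
     form_spectrum N p \<Gamma> = form_spectrum N p \<Gamma>' \<and>
     (\<forall>c \<in> form_spectrum N p \<Gamma>.
        vector_space.dim sform_scale (eigenforms N p \<Gamma> c) =
        vector_space.dim sform_scale (eigenforms N p \<Gamma>' c))"

section \<open>Representation equivalence\<close>

text \<open>Elements of the unitary dual of \<open>SO(N)\<close>, realised on \<open>\<complex>\<^sup>m\<close>. Irreducible unitary representations of
  a compact group are finite-dimensional, so letting \<open>m\<close> and \<open>\<pi>\<close> vary covers all classes.\<close>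

definition irreducible_unitary_rep :: "nat \<Rightarrow> nat \<Rightarrow> (real mat \<Rightarrow> complex mat) \<Rightarrow> bool" where
  "irreducible_unitary_rep N m \<pi> \<longleftrightarrow>
     m > 0 \<and>
     \<pi> \<in> hom (SO_group N) (U_group m) \<and>
     (\<forall>A \<in> carrier (SO_group N). \<forall>\<epsilon>>0. \<exists>\<delta>>0. \<forall>B \<in> carrier (SO_group N).
        (\<forall>i<N. \<forall>j<N. \<bar>B $$ (i, j) - A $$ (i, j)\<bar> < \<delta>) \<longrightarrow>
        (\<forall>i<m. \<forall>j<m. cmod (\<pi> B $$ (i, j) - \<pi> A $$ (i, j)) < \<epsilon>)) \<and>
     (\<forall>W. VectorSpace.subspace class_ring W (module_vec TYPE(complex) m) \<and>
          (\<forall>A \<in> carrier (SO_group N). \<forall>w \<in> W. \<pi> A *\<^sub>v w \<in> W) \<longrightarrow>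
          W = {0\<^sub>v m} \<or> W = carrier_vec m)"

definition fixed_vectors :: "nat \<Rightarrow> (real mat \<Rightarrow> complex mat) \<Rightarrow> real mat set \<Rightarrow> complex vec set" where
  "fixed_vectors m \<pi> \<Gamma> = {v \<in> carrier_vec m. \<forall>g \<in> \<Gamma>. \<pi> g *\<^sub>v v = v}"

definition n_mult :: "nat \<Rightarrow> (real mat \<Rightarrow> complex mat) \<Rightarrow> real mat set \<Rightarrow> nat" where
  "n_mult m \<pi> \<Gamma> = vectorspace.dim class_ring
     ((module_vec TYPE(complex) m)\<lparr>carrier := fixed_vectors m \<pi> \<Gamma>\<rparr>)"

text \<open>The representation \<open>\<tau>\<^sub>p\<close> of \<open>K\<close> on \<open>\<Lambda>\<^sup>p(\<pp>\<^sub>\<complex>\<^sup>*)\<close>: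
  \<open>(\<tau>\<^sub>p(k) f)(X\<^sub>1, \<dots>, X\<^sub>p) = f (Ad(k\<inverse>) X\<^sub>1, \<dots>, Ad(k\<inverse>) X\<^sub>p)\<close>, where \<open>k\<inverse> = k\<^sup>T\<close>.\<close>

definition tau_space :: "nat \<Rightarrow> nat \<Rightarrow> (real mat list \<Rightarrow> complex) set" where
  "tau_space N p = alt_forms (\<cdot>\<^sub>m) (p_space N) p"

definition tau_act ::
    "nat \<Rightarrow> real mat \<Rightarrow> (real mat list \<Rightarrow> complex) \<Rightarrow> real mat list \<Rightarrow> complex" where
  "tau_act N k f Xs =
     (if set Xs \<subseteq> p_space N then f (map (\<lambda>X. transpose_mat k * X * k) Xs) else 0)"

definition Hom_K :: "nat \<Rightarrow> nat \<Rightarrow> nat \<Rightarrow> (real mat \<Rightarrow> complex mat) \<Rightarrow>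
    ((real mat list \<Rightarrow> complex) \<Rightarrow> complex vec) set" where
  "Hom_K N p m \<pi> = {T.
     (\<forall>f \<in> tau_space N p. T f \<in> carrier_vec m) \<and>
     (\<forall>f \<in> tau_space N p. \<forall>g \<in> tau_space N p. T (f + g) = T f + T g) \<and>
     (\<forall>f \<in> tau_space N p. \<forall>c. T (\<lambda>Xs. c * f Xs) = c \<cdot>\<^sub>v T f) \<and>
     (\<forall>k \<in> K_sub N. \<forall>f \<in> tau_space N p. T (tau_act N k f) = \<pi> k *\<^sub>v T f)}"

definition tau_rep_equivalent :: "nat \<Rightarrow> nat \<Rightarrow> real mat set \<Rightarrow> real mat set \<Rightarrow> bool" where
  "tau_rep_equivalent N p \<Gamma> \<Gamma>' \<longleftrightarrow>
     (\<forall>m \<pi>. irreducible_unitary_rep N m \<pi> \<and>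
        (\<exists>T \<in> Hom_K N p m \<pi>. \<exists>f \<in> tau_space N p. T f \<noteq> 0\<^sub>v m) \<longrightarrow>
        n_mult m \<pi> \<Gamma> = n_mult m \<pi> \<Gamma>')"

end

theory Submission
  imports Defs
begin

text \<open>Let \<open>h\<close> be the reflection swapping the first two coordinates and \<open>\<Gamma>' = h \<Gamma> h\<close>. Pulling forms back along
  the orientation-reversing isometry \<open>h\<close> commutes with \<open>d\<close>, and with \<open>*\<close> up to sign, hence with the
  Hodge Laplacian, so \<open>\<Gamma>\<close> and \<open>\<Gamma>'\<close> are always isospectral. Take for \<open>\<Gamma>\<close> the stabiliser, among the
  integral matrices in \<open>SO(2n)\<close>, of \<open>a = e\<^sub>0 \<and> \<dots> \<and> e\<^sub>n\<^sub>-\<^sub>1 + e\<^sub>n \<and> \<dots> \<and> e\<^sub>2\<^sub>n\<^sub>-\<^sub>1\<close>. Double sign changes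
  inside a block and the swap of the two blocks (which has determinant \<open>(-1)\<^sup>n = 1\<close>) show that \<open>a\<close>
  spans the \<open>\<Gamma>\<close>-invariants of \<open>\<Lambda>\<^sup>n \<complex>\<^sup>2\<^sup>n\<close>, so the span \<open>W\<close> of the \<open>SO(2n)\<close>-orbit of \<open>a\<close> is irreducible
  with exactly one \<open>\<Gamma>\<close>-invariant line. Since \<open>n\<close> is even, \<open>a\<close> is self-dual, hence so is all of \<open>W\<close>, whereas
  the \<open>\<Gamma>'\<close>-invariants of \<open>\<Lambda>\<^sup>n \<complex>\<^sup>2\<^sup>n\<close> are spanned by the anti-self-dual \<open>h a\<close>; so \<open>W\<close> has no
  \<open>\<Gamma>'\<close>-invariants. Finally \<open>f \<mapsto> e\<^sub>2\<^sub>n\<^sub>-\<^sub>1 \<otimes> f\<close> followed by the orthogonal projection to \<open>W\<close> is a nonzero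
  \<open>K\<close>-map from \<open>\<tau>\<^sub>n\<^sub>-\<^sub>1\<close>.\<close>

text \<open>An orientation-reversing reflection exchanges the self-dual and the anti-self-dual half
  of the middle exterior power. Both halves contain \<open>\<tau>\<^sub>n\<^sub>-\<^sub>1\<close>
  and have the same Casimir eigenvalue, so the spectrum sees only the sum of their multiplicities,
  whereas representation equivalence compares them one by one. A finite group whose multiplicities
  in the two halves differ is therefore enough; here they are 1 and 0, and integrality of the
  matrices is what makes the group finite.

  The isospectral half is shaped by \<open>vector_derivative\<close>, which is an arbitrary value
  where no derivative exists. The sign that the star picks up under a reflection has to cross the
  exterior derivative, and this is legitimate only once the stars of \<omega> and of d\<omega> are
  known to be differentiable along lines. In the other half, W is handled through an orthonormal
  basis, because unitary representations are matrix-valued here.\<close>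

no_notation Finite_Cartesian_Product.vec_nth (infixl "$" 90)

section \<open>Multi-indices and multilinear expansion\<close>

text \<open>The index set summed over in \<open>hodge_star\<close>, and later the coefficient domain
  of tensors. With lists, an induction on \<open>p\<close> peels off the head index.\<close>

definition idx :: "nat \<Rightarrow> nat \<Rightarrow> nat list set" where
  "idx N p = {is. length is = p \<and> set is \<subseteq> {..<N}}"

lemma idx_0 [simp]: "idx N 0 = {[]}"
  by (auto simp: idx_def)

lemma finite_idx [simp]: "finite (idx N p)"
  unfolding idx_def using finite_lists_length_eq[of "{..<N}" p] by (simp add: conj_commute)

lemma idx_Suc: "idx N (Suc p) = (\<lambda>(k, ks). k # ks) ` ({..<N} \<times> idx N p)"
  by (auto simp: idx_def length_Suc_conv image_iff)

lemma sum_idx_Suc: "(\<Sum>ks\<in>idx N (Suc p). f ks) = (\<Sum>k<N. \<Sum>ks\<in>idx N p. f (k # ks))"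
proof -
  have "inj_on (\<lambda>(k, ks). k # ks) ({..<N} \<times> idx N p)"
    by (auto simp: inj_on_def)
  then show ?thesis
    by (simp add: idx_Suc sum.reindex sum.cartesian_product case_prod_unfold)
qed

lemma idx_nth: "ks \<in> idx N p \<Longrightarrow> l < p \<Longrightarrow> ks ! l < N"
  by (auto simp: idx_def dest!: subsetD[OF _ nth_mem])

text \<open>The multilinear part of \<open>alt_forms\<close> without its vanishing conditions, so
  that it passes to radial pullbacks and to smaller argument spaces.\<close>

definition multilin :: "(real \<Rightarrow> 'a \<Rightarrow> 'a) \<Rightarrow> 'a::plus set \<Rightarrow> nat \<Rightarrow> ('a list \<Rightarrow> complex) \<Rightarrow> bool" where
  "multilin sc V p F \<longleftrightarrow> (\<forall>vs. length vs = p \<and> set vs \<subseteq> V \<longrightarrow>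
     (\<forall>i<p. \<forall>a\<in>V. \<forall>b\<in>V. F (vs[i := a + b]) = F (vs[i := a]) + F (vs[i := b])) \<and>
     (\<forall>i<p. \<forall>a\<in>V. \<forall>r. F (vs[i := sc r a]) = of_real r * F (vs[i := a])))"

lemma alt_forms_multilin: "f \<in> alt_forms sc V p \<Longrightarrow> multilin sc V p f"
  by (simp add: alt_forms_def multilin_def)

lemma multilin_Cons:
  assumes "multilin sc V (Suc p) F" "v \<in> V"
  shows "multilin sc V p (\<lambda>vs. F (v # vs))"
  unfolding multilin_def
proof (intro allI impI)
  fix vs :: "'a list" assume vs: "length vs = p \<and> set vs \<subseteq> V"
  then have "length (v # vs) = Suc p \<and> set (v # vs) \<subseteq> V" using assms(2) by auto
  note * = assms(1)[unfolded multilin_def, rule_format, OF this]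
  show "(\<forall>i<p. \<forall>a\<in>V. \<forall>b\<in>V. F (v # vs[i := a + b]) = F (v # vs[i := a]) + F (v # vs[i := b])) \<and>
    (\<forall>i<p. \<forall>a\<in>V. \<forall>r. F (v # vs[i := sc r a]) = of_real r * F (v # vs[i := a]))"
  proof (intro conjI allI ballI impI)
    fix i a b assume "i < p" "a \<in> V" "b \<in> V"
    then show "F (v # vs[i := a + b]) = F (v # vs[i := a]) + F (v # vs[i := b])"
      using conjunct1[OF *, rule_format, of "Suc i" a b] by simp
  next
    fix i a r assume "i < p" "a \<in> V"
    then show "F (v # vs[i := sc r a]) = of_real r * F (v # vs[i := a])"
      using conjunct2[OF *, rule_format, of "Suc i" a r] by simp
  qed
qed

lemma multilin_head:
  assumes "multilin sc V (Suc p) F" "length vs = p" "set vs \<subseteq> V"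
  shows "\<forall>a\<in>V. \<forall>b\<in>V. F ((a + b) # vs) = F (a # vs) + F (b # vs)"
    and "\<forall>a\<in>V. \<forall>r. F (sc r a # vs) = of_real r * F (a # vs)"
proof -
  have "length (a # vs) = Suc p \<and> set (a # vs) \<subseteq> V" if "a \<in> V" for a
    using assms(2,3) that by auto
  note * = assms(1)[unfolded multilin_def, rule_format, OF this]
  show "\<forall>a\<in>V. \<forall>b\<in>V. F ((a + b) # vs) = F (a # vs) + F (b # vs)"
    using conjunct1[OF *, rule_format, of _ 0] by fastforce
  show "\<forall>a\<in>V. \<forall>r. F (sc r a # vs) = of_real r * F (a # vs)"
    using conjunct2[OF *, rule_format, of _ 0] by fastforce
qed

text \<open>The one-argument expansion is a hypothesis about all additive homogeneous
  \<open>\<phi>\<close>, so that the same induction on the number of arguments serves ambient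
  vectors with \<open>unit_vec\<close> and matrices of the complement p with
  \<open>pe\<close>.\<close>

lemma multilin_expand:
  assumes single: "\<And>\<phi> v. v \<in> V \<Longrightarrow> (\<forall>a\<in>V. \<forall>b\<in>V. \<phi> (a + b) = \<phi> a + \<phi> b) \<Longrightarrow>
      (\<forall>a\<in>V. \<forall>r. \<phi> (sc r a) = of_real r * \<phi> a) \<Longrightarrow>
      \<phi> v = (\<Sum>k<N. of_real (c v k) * \<phi> (E k) :: complex)"
    and E: "\<And>k. k < N \<Longrightarrow> E k \<in> V"
    and F: "multilin sc V p F" and vs: "length vs = p" "set vs \<subseteq> V"
  shows "F vs = (\<Sum>ks\<in>idx N p. (\<Prod>l<p. of_real (c (vs ! l) (ks ! l))) * F (map E ks))"
  using F vs
proof (induction p arbitrary: F vs)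
  case 0
  then show ?case by simp
next
  case (Suc p)
  then obtain v us where v: "vs = v # us" "v \<in> V" "length us = p" "set us \<subseteq> V"
    by (auto simp: length_Suc_conv)
  have "F vs = (\<Sum>ks\<in>idx N p. (\<Prod>l<p. of_real (c (us ! l) (ks ! l))) * F (v # map E ks))"
    using Suc.IH[OF multilin_Cons[OF Suc.prems(1) v(2)] v(3,4)] v(1) by simp
  also have "\<dots> = (\<Sum>ks\<in>idx N p. (\<Prod>l<p. of_real (c (us ! l) (ks ! l))) *
      (\<Sum>k<N. of_real (c v k) * F (E k # map E ks)))"
  proof (rule sum.cong[OF refl])
    fix ks assume ks: "ks \<in> idx N p"
    then have "set (map E ks) \<subseteq> V" "length (map E ks) = p" using E by (auto simp: idx_def)
    note h = multilin_head[OF Suc.prems(1) this(2,1)]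
    show "(\<Prod>l<p. of_real (c (us ! l) (ks ! l))) * F (v # map E ks) =
        (\<Prod>l<p. of_real (c (us ! l) (ks ! l))) * (\<Sum>k<N. of_real (c v k) * F (E k # map E ks))"
      using single[OF v(2) h] by simp
  qed
  also have "\<dots> = (\<Sum>ks\<in>idx N p. \<Sum>k<N. (\<Prod>l<Suc p. of_real (c (vs ! l) ((k # ks) ! l))) * F (map E (k # ks)))"
    by (simp add: sum_distrib_left v(1) prod.lessThan_Suc_shift del: prod.lessThan_Suc)
       (simp add: mult_ac)
  also have "\<dots> = (\<Sum>ks\<in>idx N (Suc p). (\<Prod>l<Suc p. of_real (c (vs ! l) (ks ! l))) * F (map E ks))"
    unfolding sum_idx_Suc by (rule sum.swap)
  finally show ?case .
qed

lemma linear_expand_vec: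
  assumes v: "v \<in> carrier_vec N"
    and add: "\<forall>a\<in>carrier_vec N. \<forall>b\<in>carrier_vec N. \<phi> (a + b) = \<phi> a + \<phi> b"
    and sc: "\<forall>a\<in>carrier_vec N. \<forall>r. \<phi> (r \<cdot>\<^sub>v a) = of_real r * \<phi> a"
  shows "\<phi> v = (\<Sum>k<N. of_real (v $ k) * \<phi> (unit_vec N k) :: complex)"
proof -
  have "\<phi> (vec N (\<lambda>i. if i < m then v $ i else 0)) =
      (\<Sum>k<m. of_real (v $ k) * \<phi> (unit_vec N k))" if "m \<le> N" for m
    using that
  proof (induction m)
    case 0
    have "vec N (\<lambda>i. if i < 0 then v $ i else 0) = 0 \<cdot>\<^sub>v (0\<^sub>v N :: real vec)"
      by auto
    then show ?case using sc by simp
  next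
    case (Suc m)
    have "vec N (\<lambda>i. if i < Suc m then v $ i else 0) =
        vec N (\<lambda>i. if i < m then v $ i else 0) + (v $ m) \<cdot>\<^sub>v unit_vec N m"
      using Suc.prems by (intro eq_vecI) (auto simp: less_Suc_eq)
    then show ?case
      using Suc add sc by simp
  qed
  from this[of N] have "\<phi> (vec N (\<lambda>i. if i < N then v $ i else 0)) =
      (\<Sum>k<N. of_real (v $ k) * \<phi> (unit_vec N k))" by simp
  moreover have "vec N (\<lambda>i. if i < N then v $ i else 0) = v"
    using v by auto
  ultimately show ?thesis by simp
qed

section \<open>Line differentiability of the Hodge star of a smooth form\<close>

definition rproj :: "real vec \<Rightarrow> real vec \<Rightarrow> real vec" where
  "rproj y v = (1 / vnorm y) \<cdot>\<^sub>v (v - ((v \<bullet> y) / (y \<bullet> y)) \<cdot>\<^sub>v y)"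

lemma radial_pullback_rproj:
  "radial_pullback \<omega> y vs = \<omega> ((1 / vnorm y) \<cdot>\<^sub>v y) (map (rproj y) vs)"
  by (simp add: radial_pullback_def rproj_def[abs_def])

lemma scalar_self_pos:
  fixes y :: "real vec"
  assumes "y \<in> carrier_vec N" "y \<noteq> 0\<^sub>v N"
  shows "y \<bullet> y > 0"
proof -
  have "y \<bullet> y = (\<Sum>i<N. y $ i * y $ i)" using assms by (auto simp: scalar_prod_def lessThan_atLeast0)
  moreover obtain i where "i < N" "y $ i \<noteq> 0"
    using assms eq_vecI[of y "0\<^sub>v N"] by fastforce
  ultimately show ?thesis
    using sum_pos2[of "{..<N}" i "\<lambda>i. y $ i * y $ i"] by (auto simp: zero_less_mult_iff linorder_neq_iff)
qed

lemma vnorm_pos: "y \<in> punctured N \<Longrightarrow> vnorm y > 0"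
  using scalar_self_pos by (auto simp: punctured_def vnorm_def)

lemma vnorm_sq: "y \<in> carrier_vec N \<Longrightarrow> vnorm y * vnorm y = y \<bullet> y"
  by (simp add: vnorm_def scalar_prod_def sum_nonneg)

lemma normalize_sphere: "y \<in> punctured N \<Longrightarrow> (1 / vnorm y) \<cdot>\<^sub>v y \<in> unit_sphere N"
  using vnorm_pos[of y N] vnorm_sq[of y N] by (auto simp: unit_sphere_def punctured_def)

lemma unit_sphere_punctured: "x \<in> unit_sphere N \<Longrightarrow> x \<in> punctured N"
  by (auto simp: unit_sphere_def punctured_def)

lemma rproj_carrier: "y \<in> carrier_vec N \<Longrightarrow> v \<in> carrier_vec N \<Longrightarrow> rproj y v \<in> carrier_vec N"
  by (simp add: rproj_def)

lemma rproj_tangent: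
  assumes "y \<in> punctured N" "v \<in> carrier_vec N"
  shows "rproj y v \<in> tangent N ((1 / vnorm y) \<cdot>\<^sub>v y)"
proof -
  have y: "y \<in> carrier_vec N" "y \<bullet> y \<noteq> 0"
    using assms scalar_self_pos by (fastforce simp: punctured_def)+
  have "rproj y v \<bullet> ((1 / vnorm y) \<cdot>\<^sub>v y) = (1 / vnorm y) * ((1 / vnorm y) * (v \<bullet> y - ((v \<bullet> y) / (y \<bullet> y)) * (y \<bullet> y)))"
    using y assms by (simp add: rproj_def minus_scalar_prod_distrib[of _ N])
  then show ?thesis using y assms by (simp add: tangent_def rproj_carrier)
qed

lemma rproj_add:
  assumes "y \<in> carrier_vec N" "u \<in> carrier_vec N" "v \<in> carrier_vec N"
  shows "rproj y (u + v) = rproj y u + rproj y v"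
  using assms by (intro eq_vecI) (auto simp: rproj_def add_scalar_prod_distrib[of _ N] add_divide_distrib algebra_simps)

lemma rproj_smult:
  assumes "y \<in> carrier_vec N" "u \<in> carrier_vec N"
  shows "rproj y (r \<cdot>\<^sub>v u) = r \<cdot>\<^sub>v rproj y u"
  using assms by (intro eq_vecI) (auto simp: rproj_def algebra_simps)

text \<open>The algebraic part of \<open>smooth_forms\<close>; multilinearity and homogeneity of the
  pullback rest on this part alone.\<close>

definition sphere_forms :: "nat \<Rightarrow> nat \<Rightarrow> sform set" where
  "sphere_forms N p = {\<omega>. (\<forall>x \<in> unit_sphere N. \<omega> x \<in> alt_forms (\<cdot>\<^sub>v) (tangent N x) p) \<and>
     (\<forall>x. x \<notin> unit_sphere N \<longrightarrow> \<omega> x = 0)}"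

lemma radial_pullback_multilin:
  assumes w: "\<omega> \<in> sphere_forms N p" and y: "y \<in> carrier_vec N"
  shows "multilin (\<cdot>\<^sub>v) (carrier_vec N) p (radial_pullback \<omega> y)"
proof (cases "y = 0\<^sub>v N")
  case True
  \<comment> \<open>Division by zero gives 0, so the base point is the zero vector, which is off the
    sphere, where \<omega> vanishes.\<close>
  then have "(1 / vnorm y) \<cdot>\<^sub>v y \<notin> unit_sphere N"
    by (auto simp: unit_sphere_def)
  then have "radial_pullback \<omega> y vs = 0" for vs
    using w by (auto simp: radial_pullback_rproj sphere_forms_def)
  then show ?thesis by (simp add: multilin_def)
next
  case False
  then have yp: "y \<in> punctured N" using y by (simp add: punctured_def)
  let ?x = "(1 / vnorm y) \<cdot>\<^sub>v y"
  have m: "multilin (\<cdot>\<^sub>v) (tangent N ?x) p (\<omega> ?x)"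
    using w normalize_sphere[OF yp] by (auto simp: sphere_forms_def intro: alt_forms_multilin)
  show ?thesis
    unfolding multilin_def
  proof (intro allI impI)
    fix vs :: "real vec list" assume vs: "length vs = p \<and> set vs \<subseteq> carrier_vec N"
    then have "length (map (rproj y) vs) = p \<and> set (map (rproj y) vs) \<subseteq> tangent N ?x"
      using rproj_tangent[OF yp] by auto
    note * = m[unfolded multilin_def, rule_format, OF this]
    show "(\<forall>i<p. \<forall>a\<in>carrier_vec N. \<forall>b\<in>carrier_vec N. radial_pullback \<omega> y (vs[i := a + b]) =
          radial_pullback \<omega> y (vs[i := a]) + radial_pullback \<omega> y (vs[i := b])) \<and>
      (\<forall>i<p. \<forall>a\<in>carrier_vec N. \<forall>r. radial_pullback \<omega> y (vs[i := r \<cdot>\<^sub>v a]) =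
          of_real r * radial_pullback \<omega> y (vs[i := a]))"
      using * rproj_tangent[OF yp] rproj_add[OF y] rproj_smult[OF y]
      by (simp add: radial_pullback_rproj map_update)
  qed
qed

lemma multilin_smult_all:
  assumes "multilin sc V p F" "length vs = p" "set vs \<subseteq> V" "\<And>v. v \<in> V \<Longrightarrow> sc r v \<in> V"
  shows "F (map (sc r) vs) = of_real (r ^ p) * F vs"
  using assms
proof (induction p arbitrary: F vs)
  case 0
  then show ?case by simp
next
  case (Suc p)
  then obtain v us where v: "vs = v # us" "v \<in> V" "length us = p" "set us \<subseteq> V"
    by (auto simp: length_Suc_conv)
  have "F (map (sc r) vs) = of_real (r ^ p) * F (sc r v # us)"
    using Suc.IH[OF multilin_Cons[OF Suc.prems(1), of "sc r v"]] v Suc.prems(4) by simp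
  also have "F (sc r v # us) = of_real r * F (v # us)"
    using multilin_head(2)[OF Suc.prems(1) v(3,4)] v(2) by simp
  finally show ?case using v(1) by simp
qed

lemma vnorm_smult: "y \<in> carrier_vec N \<Longrightarrow> r > 0 \<Longrightarrow> vnorm (r \<cdot>\<^sub>v y) = r * vnorm y"
  by (simp add: vnorm_def real_sqrt_mult)

text \<open>The base point has degree 0 in \<open>y\<close>, and each of the \<open>p\<close>
  projected arguments has degree -1.\<close>

lemma radial_pullback_homogeneous:
  assumes w: "\<omega> \<in> sphere_forms N p" and y: "y \<in> carrier_vec N" and r: "r > 0"
    and vs: "length vs = p" "set vs \<subseteq> carrier_vec N"
  shows "radial_pullback \<omega> (r \<cdot>\<^sub>v y) vs = of_real ((1 / r) ^ p) * radial_pullback \<omega> y vs"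
proof -
  have 1: "(1 / vnorm (r \<cdot>\<^sub>v y)) \<cdot>\<^sub>v (r \<cdot>\<^sub>v y) = (1 / vnorm y) \<cdot>\<^sub>v y"
    using r y by (simp add: vnorm_smult smult_smult_assoc)
  have 2: "rproj (r \<cdot>\<^sub>v y) v = rproj y ((1 / r) \<cdot>\<^sub>v v)" if "v \<in> carrier_vec N" for v
    using that r y by (intro eq_vecI) (auto simp: rproj_def vnorm_smult field_simps)
  have "radial_pullback \<omega> (r \<cdot>\<^sub>v y) vs = radial_pullback \<omega> y (map (\<lambda>v. (1 / r) \<cdot>\<^sub>v v) vs)"
    using vs 2[OF subsetD[OF vs(2)]] by (auto simp: radial_pullback_rproj 1 intro!: arg_cong[of _ _ "\<omega> _"])
  also have "\<dots> = of_real ((1 / r) ^ p) * radial_pullback \<omega> y vs"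
    by (rule multilin_smult_all[OF radial_pullback_multilin[OF w y] vs]) simp
  finally show ?thesis .
qed

section \<open>Differentiability along lines\<close>

lemma differentiable_cong_eventually:
  fixes f g :: "real \<Rightarrow> 'a::real_normed_vector"
  assumes "f differentiable (at x)" "\<forall>\<^sub>F t in nhds x. f t = g t"
  shows "g differentiable (at x)"
proof -
  obtain d where d: "d > 0" "\<And>t. dist t x < d \<Longrightarrow> f t = g t"
    using assms(2) by (auto simp: eventually_nhds_metric)
  obtain f' where "(f has_derivative f') (at x)" using assms(1) by (auto simp: differentiable_def)
  then have "(g has_derivative f') (at x)"
    by (rule has_derivative_transform_within[OF _ d(1)]) (use d(2) in auto)
  then show ?thesis by (auto simp: differentiable_def)
qed

lemma differentiable_prod:
  fixes f :: "'i \<Rightarrow> real \<Rightarrow> 'a::real_normed_field"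
  assumes "\<And>i. i \<in> I \<Longrightarrow> f i differentiable (at x)"
  shows "(\<lambda>t. \<Prod>i\<in>I. f i t) differentiable (at x)"
  using assms by (induction I rule: infinite_finite_induct) auto

lemma differentiable_of_real:
  assumes "f differentiable (at (x::real))"
  shows "(\<lambda>t. of_real (f t) :: complex) differentiable (at x)"
  using differentiable_scaleR[OF assms, of "\<lambda>_. 1::complex"] by (simp add: of_real_def)

lemma differentiable_det:
  fixes A :: "real \<Rightarrow> real mat"
  assumes "\<And>t. A t \<in> carrier_mat n n"
    and "\<And>i j. i < n \<Longrightarrow> j < n \<Longrightarrow> (\<lambda>t. A t $$ (i, j)) differentiable (at x)"
  shows "(\<lambda>t. det (A t)) differentiable (at x)"
proof -
  have "(\<lambda>t. \<Sum>p\<in>{p. p permutes {0..<n}}. signof p * (\<Prod>i = 0..<n. A t $$ (i, p i))) differentiable (at x)"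
  proof (rule differentiable_sum; (intro ballI differentiable_mult differentiable_const differentiable_prod)?)
    show "finite {p. p permutes {0..<n}}" by (simp add: finite_permutations)
    fix p i assume "p \<in> {p. p permutes {0..<n}}" "i \<in> {0..<n}"
    then show "(\<lambda>t. A t $$ (i, p i)) differentiable (at x)"
      using assms(2)[of i "p i"] permutes_in_image[of p "{0..<n}" i] by auto
  qed
  then show ?thesis using det_def'[OF assms(1)] by simp
qed

definition hat :: "real vec \<Rightarrow> real vec" where
  "hat y = (1 / vnorm y) \<cdot>\<^sub>v y"

lemma hat_carrier [simp]: "y \<in> carrier_vec N \<Longrightarrow> hat y \<in> carrier_vec N"
  by (simp add: hat_def)

lemma radial_pullback_hat:
  "radial_pullback \<omega> y vs = \<omega> (hat y) (map (rproj y) vs)"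
  by (simp add: radial_pullback_rproj hat_def)

lemma tangent_smult:
  "x \<in> carrier_vec N \<Longrightarrow> v \<in> tangent N x \<Longrightarrow> r \<cdot>\<^sub>v v \<in> tangent N x"
  by (auto simp: tangent_def)

lemma differentiable_vnorm_line:
  assumes x: "x \<in> punctured N" and v: "v \<in> carrier_vec N"
  shows "(\<lambda>t. vnorm (x + t \<cdot>\<^sub>v v)) differentiable (at 0)"
proof -
  have xc: "x \<in> carrier_vec N" using x by (simp add: punctured_def)
  have eq: "vnorm (x + t \<cdot>\<^sub>v v) = sqrt (x \<bullet> x + t * (2 * (x \<bullet> v)) + t * t * (v \<bullet> v))" for t
    using xc v
    by (simp add: vnorm_def add_scalar_prod_distrib[of _ N] scalar_prod_add_distrib[of _ N]
        comm_scalar_prod[of v N x] algebra_simps)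
  have pos: "x \<bullet> x > 0" using scalar_self_pos x by (auto simp: punctured_def)
  have "\<exists>D. ((\<lambda>t. sqrt (x \<bullet> x + t * (2 * (x \<bullet> v)) + t * t * (v \<bullet> v))) has_real_derivative D) (at 0)"
    using pos by (intro exI) (rule derivative_eq_intros refl | simp)+
  then show ?thesis unfolding eq by (auto simp: real_differentiable_def)
qed

lemma add_zero_smult_vec:
  fixes x v :: "real vec"
  shows "x \<in> carrier_vec N \<Longrightarrow> v \<in> carrier_vec N \<Longrightarrow> x + 0 \<cdot>\<^sub>v v = x"
  by (intro eq_vecI) auto

lemma eventually_punctured:
  assumes x: "x \<in> punctured N" and v: "v \<in> carrier_vec N"
  shows "\<forall>\<^sub>F t in nhds 0. x + t \<cdot>\<^sub>v v \<in> punctured N"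
proof -
  have xc: "x \<in> carrier_vec N" using x by (simp add: punctured_def)
  have "isCont (\<lambda>t. vnorm (x + t \<cdot>\<^sub>v v)) 0"
    using differentiable_imp_continuous_within[OF differentiable_vnorm_line[OF assms]] .
  then have "((\<lambda>t. vnorm (x + t \<cdot>\<^sub>v v)) \<longlongrightarrow> vnorm (x + 0 \<cdot>\<^sub>v v)) (nhds 0)"
    using tendsto_at_iff_tendsto_nhds[of "\<lambda>t. vnorm (x + t \<cdot>\<^sub>v v)" 0] by (simp add: isCont_def)
  moreover have "vnorm (x + 0 \<cdot>\<^sub>v v) > 0"
    using xc v vnorm_pos[OF x] by (simp add: add_zero_smult_vec[OF xc v])
  ultimately have "\<forall>\<^sub>F t in nhds 0. vnorm (x + t \<cdot>\<^sub>v v) > 0"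
    by (rule order_tendstoD)
  then show ?thesis
    by (rule eventually_mono) (use xc v in \<open>auto simp: punctured_def vnorm_def\<close>)
qed

lemma differentiable_hat_line:
  assumes x: "x \<in> punctured N" and v: "v \<in> carrier_vec N" and k: "k < N"
  shows "(\<lambda>t. hat (x + t \<cdot>\<^sub>v v) $ k) differentiable (at 0)"
proof -
  have xc: "x \<in> carrier_vec N" using x by (simp add: punctured_def)
  have "vnorm (x + 0 \<cdot>\<^sub>v v) \<noteq> 0"
    using xc v vnorm_pos[OF x] by (simp add: add_zero_smult_vec[OF xc v])
  then have "(\<lambda>t. (x $ k + t * v $ k) / vnorm (x + t \<cdot>\<^sub>v v)) differentiable (at 0)"
    by (intro differentiable_divide differentiable_vnorm_line[OF x v] differentiable_add
        differentiable_mult differentiable_const differentiable_ident)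
  then show ?thesis using xc v k by (simp add: hat_def)
qed

lemma tan_unit_index:
  assumes "x \<in> carrier_vec N" "k < N" "i < N"
  shows "tan_unit N x i $ k = (if k = i then 1 else 0) - x $ i * x $ k"
  using assms by (simp add: tan_unit_def)

lemma tan_unit_carrier [simp]: "x \<in> carrier_vec N \<Longrightarrow> tan_unit N x i \<in> carrier_vec N"
  by (simp add: tan_unit_def)

lemma tan_unit_tangent: "x \<in> unit_sphere N \<Longrightarrow> i < N \<Longrightarrow> tan_unit N x i \<in> tangent N x"
  by (auto simp: unit_sphere_def tangent_def tan_unit_def minus_scalar_prod_distrib[of _ N])

lemma differentiable_tan_unit_line:
  assumes x: "x \<in> punctured N" and v: "v \<in> carrier_vec N" and k: "k < N" "i < N"
  shows "(\<lambda>t. tan_unit N (hat (x + t \<cdot>\<^sub>v v)) i $ k) differentiable (at 0)"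
proof -
  have xc: "x \<in> carrier_vec N" using x by (simp add: punctured_def)
  have "(\<lambda>t. (if k = i then 1 else 0) - hat (x + t \<cdot>\<^sub>v v) $ i * hat (x + t \<cdot>\<^sub>v v) $ k) differentiable (at 0)"
    by (intro differentiable_diff differentiable_mult differentiable_hat_line[OF x v] k differentiable_const)
  then show ?thesis using xc v k by (simp add: tan_unit_index)
qed

lemma rproj_index:
  assumes "y \<in> punctured N" "u \<in> carrier_vec N" "k < N"
  shows "rproj y u $ k = (u $ k - (u \<bullet> hat y) * hat y $ k) / vnorm y"
proof -
  have "y \<bullet> y = vnorm y * vnorm y" "vnorm y > 0" "y \<in> carrier_vec N"
    using assms vnorm_sq[of y N] vnorm_pos[of y N] by (auto simp: punctured_def)
  then show ?thesis using assms by (simp add: rproj_def hat_def)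
qed

text \<open>The frame components along a normalised line are exactly the coefficients summed by
  \<open>hodge_star\<close>. Unlike smoothness, their differentiability at \<open>t = 0\<close> can
  be established for d\<omega> from second derivatives of the pullback of \<omega> alone.\<close>

definition line_diff :: "nat \<Rightarrow> nat \<Rightarrow> sform \<Rightarrow> bool" where
  "line_diff N p \<beta> \<longleftrightarrow> (\<forall>x\<in>unit_sphere N. \<forall>v\<in>carrier_vec N. \<forall>is\<in>idx N p.
     (\<lambda>t. \<beta> (hat (x + t \<cdot>\<^sub>v v)) (map (tan_unit N (hat (x + t \<cdot>\<^sub>v v))) is)) differentiable (at 0))"

text \<open>Along the line, the pulled-back star is a finite sum of frame components times
  determinants. The entries of the determinants are algebraic in the coordinates and the norm, which
  stays positive near \<open>t = 0\<close>.\<close>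

lemma differentiable_star_line:
  assumes b: "line_diff N p \<beta>" and x: "x \<in> unit_sphere N" and v: "v \<in> carrier_vec N"
    and us: "set us \<subseteq> carrier_vec N" "1 + p + length us = N"
  shows "(\<lambda>t. radial_pullback (hodge_star N p \<beta>) (x + t \<cdot>\<^sub>v v) us) differentiable (at 0)"
proof -
  let ?y = "\<lambda>t. x + t \<cdot>\<^sub>v v"
  have xp: "x \<in> punctured N" and xc: "x \<in> carrier_vec N"
    using unit_sphere_punctured[OF x] by (auto simp: punctured_def)
  have y0: "vnorm (?y 0) \<noteq> 0" using xc v vnorm_pos[OF xp] by (simp add: add_zero_smult_vec[OF xc v])
  \<comment> \<open>Coordinate form of \<open>rproj (?y t) u\<close>. The agreement is shown off the
    origin, which covers all \<open>t\<close> near 0, while the dimension is \<open>N\<close> for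
    every \<open>t\<close>, as the determinant lemma requires.\<close>
  define r where "r t u = vec N (\<lambda>k. (u $ k - (\<Sum>i<N. u $ i * hat (?y t) $ i) * hat (?y t) $ k) / vnorm (?y t))" for t u
  define A where "A t is = mat_of_cols N (hat (?y t) # map (tan_unit N (hat (?y t))) is @ map (r t) us)" for t "is"
  have dr: "(\<lambda>t. r t u $ k) differentiable (at 0)" if "k < N" for u k
    using that unfolding r_def
    by (simp, intro differentiable_divide differentiable_diff differentiable_mult differentiable_const
        differentiable_sum differentiable_hat_line[OF xp v] differentiable_vnorm_line[OF xp v] y0 ballI) auto
  have "(\<lambda>t. (\<Sum>is\<in>idx N p. \<beta> (hat (?y t)) (map (tan_unit N (hat (?y t))) is) * of_real (det (A t is))) / fact p)
      differentiable (at 0)"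
  proof (intro differentiable_divide differentiable_sum ballI differentiable_mult differentiable_const
      differentiable_of_real)
    fix "is" assume i: "is \<in> idx N p"
    show "(\<lambda>t. \<beta> (hat (?y t)) (map (tan_unit N (hat (?y t))) is)) differentiable (at 0)"
      using b x v i by (auto simp: line_diff_def)
    have li: "length is = p" using i by (simp add: idx_def)
    show "(\<lambda>t. det (A t is)) differentiable (at 0)"
    proof (rule differentiable_det)
      show "A t is \<in> carrier_mat N N" for t
      proof -
        have "length (hat (?y t) # map (tan_unit N (hat (?y t))) is @ map (r t) us) = N"
          using li us(2) by simp
        then show ?thesis unfolding A_def using mat_of_cols_carrier(1) by metis
      qed
      fix k j assume k: "k < N" and j: "j < N"
      consider "j = 0" | l where "j = Suc l" "l < p" | l where "j = Suc (p + l)" "l < length us"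
      proof (cases j)
        case (Suc l)
        then show ?thesis using that(2)[of l] that(3)[of "l - p"] j us(2) by (cases "l < p") auto
      qed (use that in auto)
      then show "(\<lambda>t. A t is $$ (k, j)) differentiable (at 0)"
      proof cases
        case 1
        then show ?thesis using differentiable_hat_line[OF xp v k] k j li us(2)
          by (simp add: A_def mat_of_cols_index)
      next
        case 2
        then show ?thesis using differentiable_tan_unit_line[OF xp v k, of "is ! l"] idx_nth[OF i] k j li us(2)
          by (simp add: A_def mat_of_cols_index nth_append)
      next
        case 3
        then show ?thesis using dr[OF k, of "us ! l"] k j li us(2)
          by (simp add: A_def mat_of_cols_index nth_append)
      qed
    qed
  qed auto
  then show ?thesis
  proof (rule differentiable_cong_eventually)
    show "\<forall>\<^sub>F t in nhds 0. (\<Sum>is\<in>idx N p. \<beta> (hat (?y t)) (map (tan_unit N (hat (?y t))) is) * of_real (det (A t is))) / fact p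
      = radial_pullback (hodge_star N p \<beta>) (?y t) us"
    proof (rule eventually_mono[OF eventually_punctured[OF xp v]])
      fix t assume y: "?y t \<in> punctured N"
      have s: "hat (?y t) \<in> unit_sphere N" using normalize_sphere[OF y] by (simp add: hat_def)
      have "r t u = rproj (?y t) u" if "u \<in> carrier_vec N" for u
      proof (rule eq_vecI)
        have yc: "?y t \<in> carrier_vec N" using xc v by simp
        then have "rproj (?y t) u \<in> carrier_vec N" using that by (rule rproj_carrier)
        then show "dim_vec (r t u) = dim_vec (rproj (?y t) u)" by (simp add: r_def)
        fix k assume "k < dim_vec (rproj (?y t) u)"
        then have k: "k < N" using \<open>rproj (?y t) u \<in> carrier_vec N\<close> by auto
        have "dim_vec (hat (?y t)) = N" using hat_carrier[OF yc] by auto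
        then show "r t u $ k = rproj (?y t) u $ k"
          using k unfolding rproj_index[OF y that k] by (simp add: r_def scalar_prod_def lessThan_atLeast0)
      qed
      then have m: "map (r t) us = map (rproj (?y t)) us" using us(1) by (auto simp: subset_iff)
      have tg: "set (map (rproj (?y t)) us) \<subseteq> tangent N (hat (?y t))"
        using rproj_tangent[OF y] us(1) by (auto simp: hat_def)
      show "(\<Sum>is\<in>idx N p. \<beta> (hat (?y t)) (map (tan_unit N (hat (?y t))) is) * of_real (det (A t is))) / fact p
        = radial_pullback (hodge_star N p \<beta>) (?y t) us"
        using s tg us(2) unfolding radial_pullback_rproj hodge_star_def A_def m idx_def hat_def[symmetric]
        by simp
    qed
  qed
qed

text \<open>The second part is \<open>smooth_punctured\<close> at the list \<open>[e]\<close>; it is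
  what makes the coefficients of d\<omega> differentiable.\<close>

lemma smooth_lineD:
  assumes "smooth_punctured N f" "y \<in> punctured N" "v \<in> carrier_vec N"
  shows "((\<lambda>t. f (y + t \<cdot>\<^sub>v v)) has_vector_derivative dir_deriv f y v) (at 0)"
    and "e \<in> carrier_vec N \<Longrightarrow> (\<lambda>t. dir_deriv f (y + t \<cdot>\<^sub>v v) e) differentiable (at 0)"
proof -
  have "(\<lambda>t. f (y + t \<cdot>\<^sub>v v)) differentiable (at 0)"
    using assms(1)[unfolded smooth_punctured_def, rule_format, of "[]"] assms(2,3) by auto
  then show "((\<lambda>t. f (y + t \<cdot>\<^sub>v v)) has_vector_derivative dir_deriv f y v) (at 0)"
    unfolding dir_deriv_def using vector_derivative_works by blast
  show "(\<lambda>t. dir_deriv f (y + t \<cdot>\<^sub>v v) e) differentiable (at 0)" if "e \<in> carrier_vec N"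
    using assms(1)[unfolded smooth_punctured_def, rule_format, of "[e]"] assms(2,3) that by auto
qed

lemma smooth_sphere_forms: "\<omega> \<in> smooth_forms N p \<Longrightarrow> \<omega> \<in> sphere_forms N p"
  by (simp add: smooth_forms_def sphere_forms_def)

text \<open>Homogeneity of the pullback turns the derivative at \<open>y/|y|\<close> in the moving direction \<open>tan_unit\<close>
  into derivatives at \<open>y\<close> in constant directions.\<close>

lemma radial_pullback_tan_deriv:
  assumes w: "\<omega> \<in> smooth_forms N p" and es: "length es = p" "set es \<subseteq> carrier_vec N"
    and y: "y \<in> punctured N" and i: "i < N"
  shows "((\<lambda>t. radial_pullback \<omega> (hat y + t \<cdot>\<^sub>v tan_unit N (hat y) i) es) has_vector_derivative
    (of_real (vnorm y ^ Suc p) * dir_deriv (\<lambda>z. radial_pullback \<omega> z es) y (unit_vec N i) +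
     of_real (p * hat y $ i * vnorm y ^ p) * radial_pullback \<omega> y es)) (at 0)"
proof -
  let ?g = "\<lambda>z. radial_pullback \<omega> z es"
  let ?r = "vnorm y" and ?c = "hat y $ i" and ?e = "unit_vec N i :: real vec"
  have yc: "y \<in> carrier_vec N" using y by (simp add: punctured_def)
  have r: "?r > 0" using vnorm_pos[OF y] .
  have sm: "smooth_punctured N ?g" using w es by (simp add: smooth_forms_def)
  define \<phi> where "\<phi> t = t * ?r / (1 - t * ?c)" for t
  define \<psi> where "\<psi> t = (?r / (1 - t * ?c)) ^ p" for t
  have d\<phi>: "(\<phi> has_vector_derivative ?r) (at 0)"
    unfolding \<phi>_def has_real_derivative_iff_has_vector_derivative[symmetric]
    by (rule derivative_eq_intros refl | simp)+
  have d\<psi>: "(\<psi> has_field_derivative (p * ?c * ?r ^ p)) (at 0)"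
    unfolding \<psi>_def
    by (rule derivative_eq_intros refl | simp)+ (cases p; simp)
  have "((\<lambda>t. ?g (y + t \<cdot>\<^sub>v ?e)) has_vector_derivative dir_deriv ?g y ?e) (at (\<phi> 0))"
    using smooth_lineD(1)[OF sm y, of ?e] by (simp add: \<phi>_def)
  from vector_diff_chain_at[OF d\<phi> this]
  have "((\<lambda>t. ?g (y + \<phi> t \<cdot>\<^sub>v ?e)) has_vector_derivative ?r *\<^sub>R dir_deriv ?g y ?e) (at 0)"
    by (simp add: o_def)
  from has_vector_derivative_scaleR[OF d\<psi> this]
  have D: "((\<lambda>t. \<psi> t *\<^sub>R ?g (y + \<phi> t \<cdot>\<^sub>v ?e)) has_vector_derivative
     (of_real (?r ^ Suc p) * dir_deriv ?g y ?e + of_real (p * ?c * ?r ^ p) * ?g y)) (at 0)"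
    by (simp add: \<phi>_def \<psi>_def scaleR_conv_of_real mult_ac add_zero_smult_vec[OF yc unit_vec_carrier])
  show ?thesis
  proof (rule has_vector_derivative_transform_within[OF D])
    \<comment> \<open>This radius keeps \<open>1 - t * ?c\<close> positive; homogeneity holds for
      positive factors only.\<close>
    show "0 < 1 / (\<bar>?c\<bar> + 1)" by simp
    fix t :: real assume "dist t 0 < 1 / (\<bar>?c\<bar> + 1)"
    then have "\<bar>t\<bar> * (\<bar>?c\<bar> + 1) < 1" by (simp add: field_simps)
    moreover have "\<bar>t\<bar> * \<bar>?c\<bar> \<le> \<bar>t\<bar> * (\<bar>?c\<bar> + 1)" by (rule mult_left_mono) auto
    ultimately have "\<bar>t * ?c\<bar> < 1" unfolding abs_mult by linarith
    then have q: "1 - t * ?c > 0" by linarith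
    have tc: "tan_unit N (hat y) i \<in> carrier_vec N" using yc by simp
    have "hat y + t \<cdot>\<^sub>v tan_unit N (hat y) i = ((1 - t * ?c) / ?r) \<cdot>\<^sub>v (y + \<phi> t \<cdot>\<^sub>v ?e)"
    proof (rule eq_vecI)
      fix k assume "k < dim_vec (((1 - t * ?c) / ?r) \<cdot>\<^sub>v (y + \<phi> t \<cdot>\<^sub>v ?e))"
      then have k: "k < N" using yc by simp
      have h: "hat y $ k = y $ k / ?r" using yc k by (simp add: hat_def)
      have "((1 - t * ?c) / ?r) * (\<phi> t * s) = t * s" for s
        using q r by (simp add: \<phi>_def)
      then have "(((1 - t * ?c) / ?r) \<cdot>\<^sub>v (y + \<phi> t \<cdot>\<^sub>v ?e)) $ k =
          (1 - t * ?c) * hat y $ k + t * (if k = i then 1 else 0)"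
        using yc k i by (simp add: distrib_left h)
      also have "\<dots> = (hat y + t \<cdot>\<^sub>v tan_unit N (hat y) i) $ k"
        using i k
        by (simp add: index_add_vec(1)[of k "t \<cdot>\<^sub>v tan_unit N (hat y) i"] carrier_vecD[OF tc] yc tan_unit_index
            algebra_simps)
      finally show "(hat y + t \<cdot>\<^sub>v tan_unit N (hat y) i) $ k = (((1 - t * ?c) / ?r) \<cdot>\<^sub>v (y + \<phi> t \<cdot>\<^sub>v ?e)) $ k"
        by simp
    qed (use yc carrier_vecD[OF tc] in auto)
    then have "?g (hat y + t \<cdot>\<^sub>v tan_unit N (hat y) i) = of_real ((1 / ((1 - t * ?c) / ?r)) ^ p) * ?g (y + \<phi> t \<cdot>\<^sub>v ?e)"
      using radial_pullback_homogeneous[OF smooth_sphere_forms[OF w], of "y + \<phi> t \<cdot>\<^sub>v ?e" "(1 - t * ?c) / ?r" es]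
        q r yc es by simp
    then show "\<psi> t *\<^sub>R ?g (y + \<phi> t \<cdot>\<^sub>v ?e) = ?g (hat y + t \<cdot>\<^sub>v tan_unit N (hat y) i)"
      using q r by (simp add: \<psi>_def scaleR_conv_of_real)
  qed auto
qed

lemma radial_pullback_expand:
  assumes w: "\<omega> \<in> sphere_forms N p" and z: "z \<in> carrier_vec N"
    and vs: "length vs = p" "set vs \<subseteq> carrier_vec N"
  shows "radial_pullback \<omega> z vs =
    (\<Sum>ks\<in>idx N p. (\<Prod>l<p. of_real (vs ! l $ (ks ! l))) * radial_pullback \<omega> z (map (unit_vec N) ks))"
  by (rule multilin_expand[OF linear_expand_vec _ radial_pullback_multilin[OF w z] vs]) auto

text \<open>\<open>tan_unit\<close> at \<open>hat y\<close> is \<open>vnorm y\<close> times the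
  projected basis vector. A frame component is therefore \<open>vnorm y ^ p\<close> times a radial
  pullback on constant vectors, and the latter is smooth.\<close>

lemma line_diff_smooth:
  assumes w: "\<omega> \<in> smooth_forms N p"
  shows "line_diff N p \<omega>"
  unfolding line_diff_def
proof (intro ballI)
  fix x v :: "real vec" and "is" assume x: "x \<in> unit_sphere N" and v: "v \<in> carrier_vec N" and i: "is \<in> idx N p"
  let ?y = "\<lambda>t. x + t \<cdot>\<^sub>v v" and ?es = "map (unit_vec N) is :: real vec list"
  have xp: "x \<in> punctured N" and xc: "x \<in> carrier_vec N"
    using unit_sphere_punctured[OF x] by (auto simp: punctured_def)
  have es: "length ?es = p" "set ?es \<subseteq> carrier_vec N" using i by (auto simp: idx_def)
  then have sm: "smooth_punctured N (\<lambda>z. radial_pullback \<omega> z ?es)" using w by (simp add: smooth_forms_def)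
  have "(\<lambda>t. of_real (vnorm (?y t) ^ p) * radial_pullback \<omega> (?y t) ?es) differentiable (at 0)"
    using smooth_lineD(1)[OF sm xp v] differentiable_vnorm_line[OF xp v]
    by (intro differentiable_mult differentiable_of_real differentiable_power)
      (auto intro: differentiableI_vector)
  then show "(\<lambda>t. \<omega> (hat (?y t)) (map (tan_unit N (hat (?y t))) is)) differentiable (at 0)"
  proof (rule differentiable_cong_eventually)
    show "\<forall>\<^sub>F t in nhds 0. of_real (vnorm (?y t) ^ p) * radial_pullback \<omega> (?y t) ?es =
        \<omega> (hat (?y t)) (map (tan_unit N (hat (?y t))) is)"
    proof (rule eventually_mono[OF eventually_punctured[OF xp v]])
      fix t assume y: "?y t \<in> punctured N"
      then have yc: "?y t \<in> carrier_vec N" by (simp add: punctured_def)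
      have m: "multilin (\<cdot>\<^sub>v) (tangent N (hat (?y t))) p (\<omega> (hat (?y t)))"
        using smooth_sphere_forms[OF w] normalize_sphere[OF y]
        by (auto simp: sphere_forms_def hat_def intro: alt_forms_multilin)
      have "vnorm (?y t) \<cdot>\<^sub>v rproj (?y t) (unit_vec N j) = tan_unit N (hat (?y t)) j" if "j < N" for j
      proof (rule eq_vecI)
        have c: "rproj (?y t) (unit_vec N j) \<in> carrier_vec N" "tan_unit N (hat (?y t)) j \<in> carrier_vec N"
          using yc by (auto intro: rproj_carrier simp del: hat_carrier intro!: tan_unit_carrier hat_carrier)
        then show "dim_vec (vnorm (?y t) \<cdot>\<^sub>v rproj (?y t) (unit_vec N j)) = dim_vec (tan_unit N (hat (?y t)) j)"
          by auto
        fix k assume "k < dim_vec (tan_unit N (hat (?y t)) j)"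
        then have k: "k < N" using c by auto
        show "(vnorm (?y t) \<cdot>\<^sub>v rproj (?y t) (unit_vec N j)) $ k = tan_unit N (hat (?y t)) j $ k"
          using vnorm_pos[OF y] hat_carrier[OF yc] that k c
          by (simp add: rproj_index[OF y unit_vec_carrier k] tan_unit_index)
      qed
      then have eq: "map (tan_unit N (hat (?y t))) is = map (\<lambda>v. vnorm (?y t) \<cdot>\<^sub>v v) (map (rproj (?y t)) ?es)"
        using i by (auto simp: idx_def subset_iff)
      have "set (map (rproj (?y t)) ?es) \<subseteq> tangent N (hat (?y t))"
        using rproj_tangent[OF y] by (auto simp: hat_def)
      then show "of_real (vnorm (?y t) ^ p) * radial_pullback \<omega> (?y t) ?es =
        \<omega> (hat (?y t)) (map (tan_unit N (hat (?y t))) is)"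
        unfolding eq radial_pullback_hat
        using multilin_smult_all[OF m, of "map (rproj (?y t)) ?es" "vnorm (?y t)"] es(1)
        by (simp add: tangent_smult hat_carrier[OF yc])
    qed
  qed
qed

lemma remove_nth_idx:
  "is \<in> idx N (Suc p) \<Longrightarrow> j \<le> p \<Longrightarrow> take j is @ drop (Suc j) is \<in> idx N p"
  by (auto simp: idx_def dest: in_set_takeD in_set_dropD)

text \<open>On the left, base point, direction and arguments of the derivative all move with
  \<open>y\<close>. On the right there are only derivatives at \<open>y\<close> in constant
  directions of pullbacks on constant arguments, so smoothness of \<omega> applies, and all other
  factors are explicit.\<close>

lemma ext_deriv_tan:
  assumes w: "\<omega> \<in> smooth_forms N p" and y: "y \<in> punctured N" and i: "is \<in> idx N (Suc p)"
  shows "ext_deriv N p \<omega> (hat y) (map (tan_unit N (hat y)) is) =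
    (\<Sum>j\<le>p. (- 1) ^ j * (\<Sum>ks\<in>idx N p.
       (\<Prod>l<p. of_real (tan_unit N (hat y) ((take j is @ drop (Suc j) is) ! l) $ (ks ! l))) *
       (of_real (vnorm y ^ Suc p) *
          dir_deriv (\<lambda>z. radial_pullback \<omega> z (map (unit_vec N) ks)) y (unit_vec N (is ! j)) +
        of_real (p * hat y $ (is ! j) * vnorm y ^ p) * radial_pullback \<omega> y (map (unit_vec N) ks))))"
proof -
  let ?x = "hat y"
  have yc: "y \<in> carrier_vec N" using y by (simp add: punctured_def)
  have x: "?x \<in> unit_sphere N" using normalize_sphere[OF y] by (simp add: hat_def)
  have "dir_deriv (\<lambda>z. radial_pullback \<omega> z (map (tan_unit N ?x) (take j is @ drop (Suc j) is))) ?x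
      (tan_unit N ?x (is ! j)) = (\<Sum>ks\<in>idx N p.
       (\<Prod>l<p. of_real (tan_unit N ?x ((take j is @ drop (Suc j) is) ! l) $ (ks ! l))) *
       (of_real (vnorm y ^ Suc p) *
          dir_deriv (\<lambda>z. radial_pullback \<omega> z (map (unit_vec N) ks)) y (unit_vec N (is ! j)) +
        of_real (p * ?x $ (is ! j) * vnorm y ^ p) * radial_pullback \<omega> y (map (unit_vec N) ks)))"
    (is "_ = ?R")
    if j: "j \<le> p" for j
  proof -
    let ?js = "take j is @ drop (Suc j) is"
    have js: "?js \<in> idx N p" using remove_nth_idx[OF i j] .
    have ij: "is ! j < N" using idx_nth[OF i] j by simp
    have e: "radial_pullback \<omega> (?x + t \<cdot>\<^sub>v tan_unit N ?x (is ! j)) (map (tan_unit N ?x) ?js) =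
       (\<Sum>ks\<in>idx N p. (\<Prod>l<p. of_real (tan_unit N ?x (?js ! l) $ (ks ! l))) *
         radial_pullback \<omega> (?x + t \<cdot>\<^sub>v tan_unit N ?x (is ! j)) (map (unit_vec N) ks))" for t
    proof -
      have l: "length ?js = p" using js by (simp add: idx_def)
      have "set (map (tan_unit N ?x) ?js) \<subseteq> carrier_vec N" using hat_carrier[OF yc] by auto
      moreover have "length (map (tan_unit N ?x) ?js) = p" using l by simp
      moreover have "?x + t \<cdot>\<^sub>v tan_unit N ?x (is ! j) \<in> carrier_vec N" using yc by simp
      moreover have "map (tan_unit N ?x) ?js ! m = tan_unit N ?x (?js ! m)" if "m < p" for m
        using that l by (intro nth_map) simp
      ultimately show ?thesis
        using radial_pullback_expand[OF smooth_sphere_forms[OF w],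
          of "?x + t \<cdot>\<^sub>v tan_unit N ?x (is ! j)" "map (tan_unit N ?x) ?js"]
        by (simp del: map_append)
    qed
    have "((\<lambda>t. radial_pullback \<omega> (?x + t \<cdot>\<^sub>v tan_unit N ?x (is ! j)) (map (tan_unit N ?x) ?js))
      has_vector_derivative ?R) (at 0)"
      unfolding e
    proof (intro has_vector_derivative_sum has_vector_derivative_mult_right)
      fix ks assume "ks \<in> idx N p"
      then show "((\<lambda>t. radial_pullback \<omega> (?x + t \<cdot>\<^sub>v tan_unit N ?x (is ! j)) (map (unit_vec N) ks)) has_vector_derivative
        of_real (vnorm y ^ Suc p) * dir_deriv (\<lambda>z. radial_pullback \<omega> z (map (unit_vec N) ks)) y (unit_vec N (is ! j)) +
        of_real (p * ?x $ (is ! j) * vnorm y ^ p) * radial_pullback \<omega> y (map (unit_vec N) ks)) (at 0)"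
        by (intro radial_pullback_tan_deriv[OF w _ _ y ij]) (auto simp: idx_def)
    qed
    then show ?thesis unfolding dir_deriv_def by (rule vector_derivative_at)
  qed
  moreover have "set (map (tan_unit N ?x) is) \<subseteq> tangent N ?x" "length is = Suc p"
    using i tan_unit_tangent[OF x] by (auto simp: idx_def)
  ultimately show ?thesis
    using x by (simp add: ext_deriv_def take_map drop_map)
qed

text \<open>The second summand of the Laplacian is the codifferential of d\<omega>, so the star of
  d\<omega> has to be differentiable as well.\<close>

lemma line_diff_ext_deriv:
  assumes w: "\<omega> \<in> smooth_forms N p"
  shows "line_diff N (Suc p) (ext_deriv N p \<omega>)"
  unfolding line_diff_def
proof (intro ballI)
  fix x v :: "real vec" and "is" assume x: "x \<in> unit_sphere N" and v: "v \<in> carrier_vec N" and i: "is \<in> idx N (Suc p)"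
  let ?y = "\<lambda>t. x + t \<cdot>\<^sub>v v"
  have xp: "x \<in> punctured N" using unit_sphere_punctured[OF x] .
  have sm: "smooth_punctured N (\<lambda>z. radial_pullback \<omega> z (map (unit_vec N) ks))" if "ks \<in> idx N p" for ks
  proof -
    have "length (map (unit_vec N) ks :: real vec list) = p" "set (map (unit_vec N) ks) \<subseteq> (carrier_vec N :: real vec set)"
      using that by (auto simp: idx_def)
    then show ?thesis using w by (simp add: smooth_forms_def)
  qed
  have "(\<lambda>t. \<Sum>j\<le>p. (- 1) ^ j * (\<Sum>ks\<in>idx N p.
       (\<Prod>l<p. of_real (tan_unit N (hat (?y t)) ((take j is @ drop (Suc j) is) ! l) $ (ks ! l))) *
       (of_real (vnorm (?y t) ^ Suc p) *
          dir_deriv (\<lambda>z. radial_pullback \<omega> z (map (unit_vec N) ks)) (?y t) (unit_vec N (is ! j)) +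
        of_real (p * hat (?y t) $ (is ! j) * vnorm (?y t) ^ p) * radial_pullback \<omega> (?y t) (map (unit_vec N) ks))))
      differentiable (at 0)"
  proof (intro differentiable_sum ballI differentiable_add differentiable_mult differentiable_prod
      differentiable_of_real differentiable_const differentiable_power differentiable_vnorm_line[OF xp v]
      differentiable_tan_unit_line[OF xp v] differentiable_hat_line[OF xp v])
    fix j ks assume j: "j \<in> {..p}" and ks: "ks \<in> idx N p"
    show "is ! j < N" using idx_nth[OF i] j by simp
    show "(\<lambda>t. dir_deriv (\<lambda>z. radial_pullback \<omega> z (map (unit_vec N) ks)) (?y t) (unit_vec N (is ! j))) differentiable (at 0)"
      by (rule smooth_lineD(2)[OF sm[OF ks] xp v]) simp
    show "(\<lambda>t. radial_pullback \<omega> (?y t) (map (unit_vec N) ks)) differentiable (at 0)"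
      using smooth_lineD(1)[OF sm[OF ks] xp v] by (rule differentiableI_vector)
    fix l assume "l \<in> {..<p}"
    then show "ks ! l < N" "(take j is @ drop (Suc j) is) ! l < N"
      using idx_nth[OF ks] idx_nth[OF remove_nth_idx[OF i, of j]] j by auto
  qed auto
  then show "(\<lambda>t. ext_deriv N p \<omega> (hat (?y t)) (map (tan_unit N (hat (?y t))) is)) differentiable (at 0)"
    by (rule differentiable_cong_eventually)
      (rule eventually_mono[OF eventually_punctured[OF xp v]], simp only: ext_deriv_tan[OF w _ i])
qed

section \<open>Coordinate involutions acting on forms\<close>

definition perm_mat :: "nat \<Rightarrow> (nat \<Rightarrow> nat) \<Rightarrow> real mat" where
  "perm_mat N \<sigma> = mat N N (\<lambda>(i, j). if j = \<sigma> i then 1 else 0)"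

lemma perm_mat_carrier [simp]: "perm_mat N \<sigma> \<in> carrier_mat N N"
  by (simp add: perm_mat_def)

lemma det_perm_mat:
  assumes "\<sigma> permutes {..<N}"
  shows "det (perm_mat N \<sigma>) = signof \<sigma>"
proof -
  have "mat N N (\<lambda>(i, j). 1\<^sub>m N $$ (\<sigma> i, j)) = perm_mat N \<sigma>"
    using permutes_in_image[OF assms] by (intro eq_matI) (auto simp: perm_mat_def)
  then show ?thesis
    using det_permute_rows[of "1\<^sub>m N :: real mat" N \<sigma>] assms by (simp add: lessThan_atLeast0)
qed

text \<open>Both the reflection \<open>h\<close> and the swap of the two blocks are of this kind.
  Being an involution makes \<open>P\<close> symmetric and its own inverse, so pullback and
  conjugation by \<open>P\<close> are involutions too.\<close>

locale coord_involution =
  fixes N :: nat and \<sigma> :: "nat \<Rightarrow> nat"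
  assumes perm: "\<sigma> permutes {..<N}" and invol: "\<sigma> (\<sigma> i) = i"
begin

lemma \<sigma>_less [simp]: "\<sigma> i < N \<longleftrightarrow> i < N"
  using permutes_in_image[OF perm] by auto

lemma \<sigma>_eq_iff: "\<sigma> i = j \<longleftrightarrow> i = \<sigma> j"
  using invol by metis

abbreviation P :: "real mat" where "P \<equiv> perm_mat N \<sigma>"

lemma P_P: "P * P = 1\<^sub>m N"
proof (rule eq_matI)
  fix i j assume "i < dim_row (1\<^sub>m N)" "j < dim_col (1\<^sub>m N)"
  then have ij: "i < N" "j < N" by auto
  have "(P * P) $$ (i, j) = (\<Sum>k<N. (if k = \<sigma> i then 1 else 0) * (if j = \<sigma> k then 1 else 0))"
    using ij by (simp add: perm_mat_def scalar_prod_def lessThan_atLeast0)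
  also have "\<dots> = (\<Sum>k<N. if k = \<sigma> i then (if j = i then 1 else 0) else 0)"
    by (rule sum.cong) (auto simp: invol)
  finally show "(P * P) $$ (i, j) = 1\<^sub>m N $$ (i, j)"
    using ij by (simp add: sum.delta)
qed (auto simp: perm_mat_def)

lemma transpose_P: "transpose_mat P = P"
  by (intro eq_matI) (auto simp: perm_mat_def invol)

lemma det_P_sq: "det P * det P = 1"
  using det_mult[OF perm_mat_carrier perm_mat_carrier, of N \<sigma> \<sigma>] P_P by simp

text \<open>Multiplication by \<open>P\<close>, continued by the identity to vectors of the wrong
  dimension. It is thereby an involution of the whole type, and pulling back twice returns the same
  function on all inputs.\<close>

definition pv :: "real vec \<Rightarrow> real vec" where
  "pv v = (if dim_vec v = N then vec N (\<lambda>i. v $ \<sigma> i) else v)"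

lemma dim_pv [simp]: "dim_vec (pv v) = dim_vec v"
  by (simp add: pv_def)

lemma pv_carrier [simp]: "pv v \<in> carrier_vec N \<longleftrightarrow> v \<in> carrier_vec N"
  unfolding carrier_vec_def by simp

lemma pv_index [simp]: "v \<in> carrier_vec N \<Longrightarrow> i < N \<Longrightarrow> pv v $ i = v $ \<sigma> i"
  by (simp add: pv_def)

lemma pv_pv [simp]: "pv (pv v) = v"
proof (cases "v \<in> carrier_vec N")
  case True
  then show ?thesis by (intro eq_vecI) (simp_all add: invol)
next
  case False
  then have "dim_vec v \<noteq> N" by auto
  then show ?thesis by (simp add: pv_def)
qed

lemma P_mult_vec: "v \<in> carrier_vec N \<Longrightarrow> P *\<^sub>v v = pv v"
  by (intro eq_vecI) (auto simp: perm_mat_def pv_def scalar_prod_def mult_if_delta)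

lemma pv_scalar: "u \<in> carrier_vec N \<Longrightarrow> v \<in> carrier_vec N \<Longrightarrow> pv u \<bullet> pv v = u \<bullet> v"
  using sum.permute[OF perm, of "\<lambda>i. u $ i * v $ i"]
  by (auto simp: scalar_prod_def lessThan_atLeast0[symmetric] o_def)

lemma pv_add: "u \<in> carrier_vec N \<Longrightarrow> v \<in> carrier_vec N \<Longrightarrow> pv (u + v) = pv u + pv v"
  by (intro eq_vecI) auto

lemma pv_minus: "u \<in> carrier_vec N \<Longrightarrow> v \<in> carrier_vec N \<Longrightarrow> pv (u - v) = pv u - pv v"
  by (intro eq_vecI) auto

lemma pv_smult: "v \<in> carrier_vec N \<Longrightarrow> pv (r \<cdot>\<^sub>v v) = r \<cdot>\<^sub>v pv v"
  by (intro eq_vecI) auto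

lemma pv_unit_vec: "i < N \<Longrightarrow> pv (unit_vec N i) = unit_vec N (\<sigma> i)"
  by (intro eq_vecI) (auto simp: \<sigma>_eq_iff)

lemma pv_unit_sphere [simp]: "pv x \<in> unit_sphere N \<longleftrightarrow> x \<in> unit_sphere N"
  by (auto simp: unit_sphere_def pv_scalar)

lemma pv_tangent [simp]:
  "x \<in> carrier_vec N \<Longrightarrow> pv v \<in> tangent N (pv x) \<longleftrightarrow> v \<in> tangent N x"
  by (auto simp: tangent_def pv_scalar)

lemma pv_tangent_list:
  "x \<in> unit_sphere N \<Longrightarrow> set (map pv vs) \<subseteq> tangent N (pv x) \<longleftrightarrow> set vs \<subseteq> tangent N x"
  by (auto simp: subset_iff unit_sphere_def)

lemma pv_punctured [simp]: "pv x \<in> punctured N \<longleftrightarrow> x \<in> punctured N"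
proof -
  have "pv (0\<^sub>v N) = 0\<^sub>v N" by (intro eq_vecI) auto
  then show ?thesis unfolding punctured_def by (metis DiffE DiffI pv_carrier pv_pv singletonD singletonI)
qed

lemma pv_vnorm: "x \<in> carrier_vec N \<Longrightarrow> vnorm (pv x) = vnorm x"
  by (simp add: vnorm_def pv_scalar)

lemma pv_tan_unit:
  "x \<in> carrier_vec N \<Longrightarrow> i < N \<Longrightarrow> pv (tan_unit N x i) = tan_unit N (pv x) (\<sigma> i)"
  by (simp add: tan_unit_def pv_minus pv_smult pv_unit_vec invol)

lemma pv_rproj:
  "y \<in> carrier_vec N \<Longrightarrow> v \<in> carrier_vec N \<Longrightarrow> pv (rproj y v) = rproj (pv y) (pv v)"
  by (simp add: rproj_def pv_minus pv_smult pv_vnorm pv_scalar)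

text \<open>Pullback of forms along \<open>P\<close>; as \<open>P\<close> is linear, the same map
  acts on the base point and on the tangent vectors.\<close>

definition act :: "sform \<Rightarrow> sform" where
  "act \<omega> = (\<lambda>x vs. \<omega> (pv x) (map pv vs))"

lemma act_act [simp]: "act (act \<omega>) = \<omega>"
  by (simp add: act_def o_def)

lemma act_add: "act (\<omega> + \<eta>) = act \<omega> + act \<eta>"
  by (simp add: act_def fun_eq_iff)

lemma act_scale: "act (sform_scale c \<omega>) = sform_scale c (act \<omega>)"
  by (simp add: act_def sform_scale_def)

lemma radial_pullback_act:
  assumes "y \<in> carrier_vec N" "set vs \<subseteq> carrier_vec N"
  shows "radial_pullback (act \<omega>) y vs = radial_pullback \<omega> (pv y) (map pv vs)"
  using assms by (auto simp: radial_pullback_rproj act_def pv_smult pv_vnorm pv_rproj subset_iff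
      intro!: arg_cong[of _ _ "\<omega> _"])

lemma dir_deriv_pv:
  assumes "\<And>z. z \<in> carrier_vec N \<Longrightarrow> F z = f (pv z)" "y \<in> carrier_vec N" "v \<in> carrier_vec N"
  shows "dir_deriv F y v = dir_deriv f (pv y) (pv v)"
  using assms by (simp add: dir_deriv_def pv_add pv_smult)

lemma iter_deriv_pv:
  assumes "\<And>z. z \<in> carrier_vec N \<Longrightarrow> F z = f (pv z)" "y \<in> carrier_vec N" "set us \<subseteq> carrier_vec N"
  shows "iter_deriv us F y = iter_deriv (map pv us) f (pv y)"
  using assms(2,3)
proof (induction us arbitrary: y)
  case Nil
  then show ?case by (simp add: assms(1))
next
  case (Cons u us)
  then show ?case by (auto intro!: dir_deriv_pv)
qed

lemma smooth_punctured_pv: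
  assumes F: "\<And>z. z \<in> carrier_vec N \<Longrightarrow> F z = f (pv z)" and f: "smooth_punctured N f"
  shows "smooth_punctured N F"
  unfolding smooth_punctured_def
proof (intro allI impI ballI conjI)
  fix us :: "real vec list" and y assume us: "set us \<subseteq> carrier_vec N" and y: "y \<in> punctured N"
  have us': "set (map pv us) \<subseteq> carrier_vec N" using us by auto
  have y': "pv y \<in> punctured N" using y by simp
  have yc: "y \<in> carrier_vec N" using y by (simp add: punctured_def)
  note * = f[unfolded smooth_punctured_def, rule_format, OF us' y']
  have it: "iter_deriv us F z = iter_deriv (map pv us) f (pv z)" if "z \<in> carrier_vec N" for z
    using iter_deriv_pv[of F f z us] F us that by blast
  {
    fix \<epsilon> :: real assume "\<epsilon> > 0"
    then obtain \<delta> where d: "\<delta> > 0" "\<And>z. z \<in> punctured N \<Longrightarrow> vnorm (z - pv y) < \<delta> \<Longrightarrow>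
        cmod (iter_deriv (map pv us) f z - iter_deriv (map pv us) f (pv y)) < \<epsilon>"
      using * by blast
    have "cmod (iter_deriv us F z - iter_deriv us F y) < \<epsilon>" if z: "z \<in> punctured N" "vnorm (z - y) < \<delta>" for z
    proof -
      have zc: "z \<in> carrier_vec N" using z by (simp add: punctured_def)
      have "vnorm (pv z - pv y) < \<delta>" using z(2) zc yc pv_vnorm[of "z - y"] by (simp add: pv_minus)
      then show ?thesis
        using d(2)[of "pv z"] z(1) zc yc by (simp add: it)
    qed
    then show "\<exists>\<delta>>0. \<forall>z\<in>punctured N. vnorm (z - y) < \<delta> \<longrightarrow> cmod (iter_deriv us F z - iter_deriv us F y) < \<epsilon>"
      using d(1) by blast
  next
    fix v :: "real vec" assume v: "v \<in> carrier_vec N"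
    then have "(\<lambda>t. iter_deriv (map pv us) f (pv y + t \<cdot>\<^sub>v pv v)) differentiable (at 0)"
      using * by auto
    then show "(\<lambda>t. iter_deriv us F (y + t \<cdot>\<^sub>v v)) differentiable (at 0)"
      using v yc by (simp add: it pv_add pv_smult)
  }
qed

lemma smooth_act:
  assumes w: "\<omega> \<in> smooth_forms N p"
  shows "act \<omega> \<in> smooth_forms N p"
  unfolding smooth_forms_def
proof (intro CollectI conjI allI ballI impI)
  fix x assume x: "x \<in> unit_sphere N"
  then have xc: "x \<in> carrier_vec N" by (simp add: unit_sphere_def)
  have a: "\<omega> (pv x) \<in> alt_forms (\<cdot>\<^sub>v) (tangent N (pv x)) p"
    using w x by (simp add: smooth_forms_def)
  show "act \<omega> x \<in> alt_forms (\<cdot>\<^sub>v) (tangent N x) p"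
    unfolding alt_forms_def
  proof (rule CollectI, rule conjI; intro allI impI)
    fix vs assume vs: "length vs = p \<and> set vs \<subseteq> tangent N x"
    have vs': "length (map pv vs) = p \<and> set (map pv vs) \<subseteq> tangent N (pv x)"
      using vs xc by auto
    note * = conjunct1[OF a[unfolded alt_forms_def, THEN CollectD], rule_format, OF vs']
    have c: "u \<in> carrier_vec N" if "u \<in> tangent N x" for u using that by (simp add: tangent_def)
    have "\<forall>i<p. \<forall>a\<in>tangent N x. \<forall>b\<in>tangent N x.
        act \<omega> x (vs[i := a + b]) = act \<omega> x (vs[i := a]) + act \<omega> x (vs[i := b])"
      using conjunct1[OF *] xc c by (simp add: act_def map_update pv_add)
    moreover have "\<forall>i<p. \<forall>a\<in>tangent N x. \<forall>r. act \<omega> x (vs[i := r \<cdot>\<^sub>v a]) = of_real r * act \<omega> x (vs[i := a])"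
      using conjunct1[OF conjunct2[OF *]] xc c by (simp add: act_def map_update pv_smult)
    moreover have "\<forall>i<p. \<forall>j<p. i \<noteq> j \<and> vs ! i = vs ! j \<longrightarrow> act \<omega> x vs = 0"
      using conjunct2[OF conjunct2[OF *]] vs by (auto simp: act_def)
    ultimately show "(\<forall>i<p. \<forall>a\<in>tangent N x. \<forall>b\<in>tangent N x.
        act \<omega> x (vs[i := a + b]) = act \<omega> x (vs[i := a]) + act \<omega> x (vs[i := b])) \<and>
      (\<forall>i<p. \<forall>a\<in>tangent N x. \<forall>r. act \<omega> x (vs[i := r \<cdot>\<^sub>v a]) = of_real r * act \<omega> x (vs[i := a])) \<and>
      (\<forall>i<p. \<forall>j<p. i \<noteq> j \<and> vs ! i = vs ! j \<longrightarrow> act \<omega> x vs = 0)"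
      by (intro conjI)
  next
    fix vs assume "\<not> (length vs = p \<and> set vs \<subseteq> tangent N x)"
    then have "\<not> (length (map pv vs) = p \<and> set (map pv vs) \<subseteq> tangent N (pv x))"
      using xc by (auto simp: subset_iff)
    then show "act \<omega> x vs = 0" using a by (simp add: alt_forms_def act_def)
  qed
next
  fix x assume "x \<notin> unit_sphere N"
  then show "act \<omega> x = 0" using w by (simp add: smooth_forms_def act_def fun_eq_iff)
next
  fix vs :: "real vec list" assume vs: "length vs = p \<and> set vs \<subseteq> carrier_vec N"
  then have "length (map pv vs) = p \<and> set (map pv vs) \<subseteq> carrier_vec N" by auto
  then have "smooth_punctured N (\<lambda>y. radial_pullback \<omega> y (map pv vs))"
    using w unfolding smooth_forms_def by blast
  then show "smooth_punctured N (\<lambda>y. radial_pullback (act \<omega>) y vs)"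
    by (rule smooth_punctured_pv[rotated]) (use vs in \<open>simp add: radial_pullback_act\<close>)
qed

text \<open>Both sides differentiate the same function of \<open>t\<close>, so the values of
  \<open>vector_derivative\<close> agree even where no derivative exists.\<close>

lemma ext_deriv_act: "ext_deriv N p (act \<omega>) = act (ext_deriv N p \<omega>)"
proof (intro ext)
  fix x vs
  show "ext_deriv N p (act \<omega>) x vs = act (ext_deriv N p \<omega>) x vs"
  proof (cases "x \<in> unit_sphere N \<and> length vs = Suc p \<and> set vs \<subseteq> tangent N x")
    case True
    then have xc: "x \<in> carrier_vec N" by (simp add: unit_sphere_def)
    have vc: "set vs \<subseteq> carrier_vec N" using True by (auto simp: tangent_def)
    have "dir_deriv (\<lambda>y. radial_pullback (act \<omega>) y (take j vs @ drop (Suc j) vs)) x (vs ! j) =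
        dir_deriv (\<lambda>y. radial_pullback \<omega> y (take j (map pv vs) @ drop (Suc j) (map pv vs))) (pv x) (map pv vs ! j)"
      if "j \<le> p" for j
    proof -
      have s: "set (take j vs @ drop (Suc j) vs) \<subseteq> carrier_vec N" "vs ! j \<in> carrier_vec N"
        using vc that True by (auto dest: in_set_takeD in_set_dropD)
      show ?thesis
        using dir_deriv_pv[of "\<lambda>y. radial_pullback (act \<omega>) y (take j vs @ drop (Suc j) vs)"
            "\<lambda>y. radial_pullback \<omega> y (map pv (take j vs @ drop (Suc j) vs))" x "vs ! j"]
          radial_pullback_act[OF _ s(1)] xc s(2) True that by (simp add: take_map drop_map)
    qed
    moreover have "set (map pv vs) \<subseteq> tangent N (pv x)" using True xc by auto
    ultimately show ?thesis using True by (simp add: ext_deriv_def act_def)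
  next
    case False
    then have "\<not> (pv x \<in> unit_sphere N \<and> length (map pv vs) = Suc p \<and> set (map pv vs) \<subseteq> tangent N (pv x))"
      using pv_tangent_list[of x vs] by auto
    then show ?thesis unfolding ext_deriv_def act_def using False by (simp only: if_False)
  qed
qed

lemma P_mat_of_cols:
  assumes "set vs \<subseteq> carrier_vec N"
  shows "P * mat_of_cols N vs = mat_of_cols N (map pv vs)"
proof (rule eq_matI)
  fix i j assume "i < dim_row (mat_of_cols N (map pv vs))" "j < dim_col (mat_of_cols N (map pv vs))"
  then have ij: "i < N" "j < length vs" by auto
  then have v: "vs ! j \<in> carrier_vec N" using assms by auto
  have "(P * mat_of_cols N vs) $$ (i, j) = (P *\<^sub>v (vs ! j)) $ i"
    using ij v by (simp add: perm_mat_def)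
  then show "(P * mat_of_cols N vs) $$ (i, j) = mat_of_cols N (map pv vs) $$ (i, j)"
    using ij v by (simp add: P_mult_vec mat_of_cols_index)
qed (auto simp: perm_mat_def)

text \<open>\<open>P\<close> permutes the frame \<open>tan_unit\<close> by \<open>\<sigma>\<close>,
  which only reindexes the sum, and the determinant in the volume form contributes
  \<open>det P\<close>.\<close>

lemma hodge_star_act: "hodge_star N p (act \<omega>) = sform_scale (of_real (det P)) (act (hodge_star N p \<omega>))"
proof (intro ext)
  fix x vs
  show "hodge_star N p (act \<omega>) x vs = sform_scale (of_real (det P)) (act (hodge_star N p \<omega>)) x vs"
  proof (cases "x \<in> unit_sphere N \<and> 1 + p + length vs = N \<and> set vs \<subseteq> tangent N x")
    case True
    then have xc: "x \<in> carrier_vec N" by (simp add: unit_sphere_def)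
    have vc: "set vs \<subseteq> carrier_vec N" using True by (auto simp: tangent_def)
    let ?T = "\<lambda>is. \<omega> (pv x) (map (tan_unit N (pv x)) is) *
         of_real (det (mat_of_cols N (pv x # map (tan_unit N (pv x)) is @ map pv vs)))"
    have "act \<omega> x (map (tan_unit N x) is) * of_real (det (mat_of_cols N (x # map (tan_unit N x) is @ vs))) =
        of_real (det P) * ?T (map \<sigma> is)" if i: "is \<in> idx N p" for "is"
    proof -
      have m: "map pv (map (tan_unit N x) is) = map (tan_unit N (pv x)) (map \<sigma> is)"
        using i xc by (auto simp: idx_def subset_iff pv_tan_unit)
      let ?M = "mat_of_cols N (x # map (tan_unit N x) is @ vs)"
      have M: "?M \<in> carrier_mat N N"
        using True i mat_of_cols_carrier(1)[of N "x # map (tan_unit N x) is @ vs"] by (simp add: idx_def)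
      have "set (x # map (tan_unit N x) is @ vs) \<subseteq> carrier_vec N"
        using xc vc by auto
      from P_mat_of_cols[OF this]
      have "P * ?M = mat_of_cols N (pv x # map (tan_unit N (pv x)) (map \<sigma> is) @ map pv vs)"
        using m by (simp only: list.map map_append)
      then have "det P * det ?M = det (mat_of_cols N (pv x # map (tan_unit N (pv x)) (map \<sigma> is) @ map pv vs))"
        using det_mult[OF perm_mat_carrier M, of \<sigma>] by simp
      then have "det ?M = det P * det (mat_of_cols N (pv x # map (tan_unit N (pv x)) (map \<sigma> is) @ map pv vs))"
        using det_P_sq by (metis mult.assoc mult_1)
      then show ?thesis unfolding act_def m by simp
    qed
    then have "(\<Sum>is\<in>idx N p. act \<omega> x (map (tan_unit N x) is) * of_real (det (mat_of_cols N (x # map (tan_unit N x) is @ vs))))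
        = of_real (det P) * (\<Sum>is\<in>idx N p. ?T (map \<sigma> is))"
      by (simp add: sum_distrib_left)
    also have "(\<Sum>is\<in>idx N p. ?T (map \<sigma> is)) = (\<Sum>is\<in>idx N p. ?T is)"
      by (rule sum.reindex_bij_witness[of _ "map \<sigma>" "map \<sigma>"])
        (auto simp: idx_def subset_iff o_def invol)
    finally have "(\<Sum>is\<in>idx N p. act \<omega> x (map (tan_unit N x) is) * of_real (det (mat_of_cols N (x # map (tan_unit N x) is @ vs))))
        = of_real (det P) * (\<Sum>is\<in>idx N p. ?T is)" .
    moreover have "set (map pv vs) \<subseteq> tangent N (pv x)" using True pv_tangent_list[of x vs] by blast
    ultimately show ?thesis using True
      by (simp add: hodge_star_def act_def sform_scale_def idx_def)
  next
    case False
    then have "\<not> (pv x \<in> unit_sphere N \<and> 1 + p + length (map pv vs) = N \<and> set (map pv vs) \<subseteq> tangent N (pv x))"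
      using pv_tangent_list[of x vs] by auto
    then show ?thesis unfolding hodge_star_def act_def sform_scale_def using False
      by (simp only: if_False mult_zero_right)
  qed
qed

end

section \<open>Scalar factors and equivariance of the Laplacian\<close>

lemma radial_pullback_scale:
  "radial_pullback (sform_scale c \<omega>) y vs = c * radial_pullback \<omega> y vs"
  by (simp add: radial_pullback_def sform_scale_def)

lemma sform_scale_scale: "sform_scale c (sform_scale d \<omega>) = sform_scale (c * d) \<omega>"
  by (simp add: sform_scale_def mult.assoc)

lemma hodge_star_scale: "hodge_star N p (sform_scale c \<omega>) = sform_scale c (hodge_star N p \<omega>)"
  by (intro ext) (simp add: hodge_star_def sform_scale_def sum_distrib_left mult.assoc)

text \<open>Without differentiability this fails: \<open>vector_derivative\<close> of a non-differentiable function is an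
  arbitrary constant, which does not scale.\<close>

lemma ext_deriv_star_scale:
  assumes "line_diff N p \<beta>" "p < N"
  shows "ext_deriv N (N - 1 - p) (sform_scale c (hodge_star N p \<beta>)) =
    sform_scale c (ext_deriv N (N - 1 - p) (hodge_star N p \<beta>))"
proof (intro ext)
  fix x vs
  let ?q = "N - 1 - p"
  show "ext_deriv N ?q (sform_scale c (hodge_star N p \<beta>)) x vs = sform_scale c (ext_deriv N ?q (hodge_star N p \<beta>)) x vs"
  proof (cases "x \<in> unit_sphere N \<and> length vs = Suc ?q \<and> set vs \<subseteq> tangent N x")
    case True
    have "dir_deriv (\<lambda>y. radial_pullback (sform_scale c (hodge_star N p \<beta>)) y (take j vs @ drop (Suc j) vs)) x (vs ! j)
       = c * dir_deriv (\<lambda>y. radial_pullback (hodge_star N p \<beta>) y (take j vs @ drop (Suc j) vs)) x (vs ! j)"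
      if j: "j \<le> ?q" for j
    proof -
      have vc: "set vs \<subseteq> carrier_vec N" using True by (auto simp: tangent_def)
      have s: "set (take j vs @ drop (Suc j) vs) \<subseteq> carrier_vec N" "vs ! j \<in> carrier_vec N"
        using vc j True by (auto dest: in_set_takeD in_set_dropD)
      have "(\<lambda>t. radial_pullback (hodge_star N p \<beta>) (x + t \<cdot>\<^sub>v vs ! j) (take j vs @ drop (Suc j) vs)) differentiable (at 0)"
        by (rule differentiable_star_line[OF assms(1) _ s(2,1)]) (use True j assms(2) in auto)
      then have "((\<lambda>t. radial_pullback (hodge_star N p \<beta>) (x + t \<cdot>\<^sub>v vs ! j) (take j vs @ drop (Suc j) vs)) has_vector_derivative
          dir_deriv (\<lambda>y. radial_pullback (hodge_star N p \<beta>) y (take j vs @ drop (Suc j) vs)) x (vs ! j)) (at 0)"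
        unfolding dir_deriv_def using vector_derivative_works by blast
      from has_vector_derivative_mult_right[OF this, of c]
      show ?thesis
        unfolding radial_pullback_scale by (subst dir_deriv_def) (rule vector_derivative_at)
    qed
    then show ?thesis using True
      by (auto simp: ext_deriv_def sform_scale_def[of _ "ext_deriv _ _ _"] sum_distrib_left mult_ac intro!: sum.cong)
  next
    case False
    then show ?thesis by (auto simp: ext_deriv_def sform_scale_def)
  qed
qed

context coord_involution
begin

text \<open>Each of the two stars contributes \<open>det P\<close>, and the square is 1. The factor
  of the inner star has to cross the exterior derivative to meet that of the outer one.\<close>

lemma codiff_act:
  assumes "line_diff N p \<omega>" "p < N"
  shows "codiff N p (act \<omega>) = act (codiff N p \<omega>)"
proof -
  let ?d = "complex_of_real (det P)"
  have dd: "?d * ?d = 1" using det_P_sq by (metis of_real_1 of_real_mult)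
  have "hodge_star N (N - p) (ext_deriv N (N - 1 - p) (hodge_star N p (act \<omega>))) =
      hodge_star N (N - p) (ext_deriv N (N - 1 - p) (act (sform_scale ?d (hodge_star N p \<omega>))))"
    by (simp add: hodge_star_act act_scale)
  also have "\<dots> = hodge_star N (N - p) (act (sform_scale ?d (ext_deriv N (N - 1 - p) (hodge_star N p \<omega>))))"
    by (simp only: ext_deriv_act ext_deriv_star_scale[OF assms])
  also have "\<dots> = sform_scale ?d (act (sform_scale ?d (hodge_star N (N - p) (ext_deriv N (N - 1 - p) (hodge_star N p \<omega>)))))"
    by (simp only: hodge_star_act hodge_star_scale)
  also have "\<dots> = act (hodge_star N (N - p) (ext_deriv N (N - 1 - p) (hodge_star N p \<omega>)))"
    using dd by (simp only: act_scale sform_scale_scale) (simp add: sform_scale_def)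
  finally show ?thesis by (simp add: codiff_def[abs_def] act_def fun_eq_iff)
qed

lemma hodge_laplace_act:
  assumes "\<omega> \<in> smooth_forms N p" "Suc p < N"
  shows "hodge_laplace N p (act \<omega>) = act (hodge_laplace N p \<omega>)"
  using codiff_act[OF line_diff_smooth[OF assms(1)]] codiff_act[OF line_diff_ext_deriv[OF assms(1)]] assms(2)
  by (simp add: hodge_laplace_def ext_deriv_act act_add)

lemma invariant_act:
  assumes w: "\<omega> \<in> invariant_forms N p \<Gamma>'" and G: "\<Gamma> \<subseteq> carrier_mat N N"
    and conj: "\<And>g. g \<in> \<Gamma> \<Longrightarrow> P * g * P \<in> \<Gamma>'"
  shows "act \<omega> \<in> invariant_forms N p \<Gamma>"
  unfolding invariant_forms_def
proof (intro CollectI conjI ballI allI impI)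
  show "act \<omega> \<in> smooth_forms N p" using w by (simp add: invariant_forms_def smooth_act)
  fix g x vs assume g: "g \<in> \<Gamma>" and x: "x \<in> unit_sphere N" and vs: "set vs \<subseteq> tangent N x"
  have gc: "g \<in> carrier_mat N N" using g G by auto
  have xc: "x \<in> carrier_vec N" using x by (simp add: unit_sphere_def)
  have *: "pv (g *\<^sub>v u) = (P * g * P) *\<^sub>v pv u" if u: "u \<in> carrier_vec N" for u
  proof -
    have "(P * g * P) *\<^sub>v pv u = (P * g) *\<^sub>v (P *\<^sub>v pv u)"
      using u gc by (intro assoc_mult_mat_vec[of _ N N _ N]) (auto intro!: mult_carrier_mat)
    also have "P *\<^sub>v pv u = u" using u by (simp add: P_mult_vec)
    also have "(P * g) *\<^sub>v u = P *\<^sub>v (g *\<^sub>v u)"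
      using u gc by (intro assoc_mult_mat_vec[of _ N N _ N]) (auto intro!: mult_carrier_mat)
    also have "\<dots> = pv (g *\<^sub>v u)" using u gc by (intro P_mult_vec) auto
    finally show ?thesis by simp
  qed
  have vc: "set vs \<subseteq> carrier_vec N" using vs by (auto simp: tangent_def)
  then have m: "map pv (map ((*\<^sub>v) g) vs) = map ((*\<^sub>v) (P * g * P)) (map pv vs)"
    using * by auto
  have "\<omega> ((P * g * P) *\<^sub>v pv x) (map ((*\<^sub>v) (P * g * P)) (map pv vs)) = \<omega> (pv x) (map pv vs)"
    using w[unfolded invariant_forms_def, THEN CollectD, THEN conjunct2, rule_format, OF conj[OF g], of "pv x" "map pv vs"]
      x vs pv_tangent_list[OF x] by (simp del: set_map map_map)
  then show "act \<omega> (g *\<^sub>v x) (map ((*\<^sub>v) g) vs) = act \<omega> x vs"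
    unfolding act_def m *[OF xc] .
qed

lemma eigenforms_act:
  assumes w: "\<omega> \<in> eigenforms N p \<Gamma>' c" and G: "\<Gamma> \<subseteq> carrier_mat N N" and p: "Suc p < N"
    and conj: "\<And>g. g \<in> \<Gamma> \<Longrightarrow> P * g * P \<in> \<Gamma>'"
  shows "act \<omega> \<in> eigenforms N p \<Gamma> c"
  using w invariant_act[OF _ G conj, of \<omega>] hodge_laplace_act[OF _ p, of \<omega>]
  by (auto simp: eigenforms_def act_scale invariant_forms_def[of _ _ \<Gamma>'])

lemma linear_act: "Vector_Spaces.linear sform_scale sform_scale act"
proof -
  interpret vector_space sform_scale by (rule vector_space_sform_scale)
  show ?thesis
    by unfold_locales (auto simp: act_add act_scale)
qed

lemma inj_act: "inj_on act S"
  by (rule inj_on_inverseI[of _ act]) simp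

text \<open>An injective linear map carries a basis to a basis; an infinite basis has cardinality 0
  by convention on both sides.\<close>

lemma dim_act: "vector_space.dim sform_scale (act ` S) = vector_space.dim sform_scale S"
proof -
  interpret vector_space_pair sform_scale sform_scale
    by (intro vector_space_pair.intro vector_space_sform_scale)
  interpret a: Vector_Spaces.linear sform_scale sform_scale act by (rule linear_act)
  obtain B where B: "B \<subseteq> S" "vs1.independent B" "S \<subseteq> vs1.span B" "card B = vs1.dim S"
    using vs1.basis_exists by blast
  have "vs1.independent (act ` B)"
    using a.independent_inj_on_image[OF B(2) inj_act] .
  moreover have "act ` S \<subseteq> vs1.span (act ` B)" using B(3) by (auto simp: a.span_image)
  ultimately have "card (act ` B) = vs1.dim (act ` S)"
    using B(1) by (intro vs1.basis_card_eq_dim) auto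
  then show ?thesis using B(4) card_image[OF inj_act] by simp
qed

theorem isospectral_conj:
  assumes G: "\<Gamma> \<subseteq> carrier_mat N N" and p: "Suc p < N"
  shows "isospectral_on_forms N p \<Gamma> ((\<lambda>g. P * g * P) ` \<Gamma>)"
proof -
  let ?\<Gamma> = "(\<lambda>g. P * g * P) ` \<Gamma>"
  have G': "?\<Gamma> \<subseteq> carrier_mat N N" using G by (auto intro!: mult_carrier_mat)
  have conj_back: "P * g * P \<in> \<Gamma>" if "g \<in> ?\<Gamma>" for g
  proof -
    obtain k where k: "k \<in> \<Gamma>" "g = P * k * P" using \<open>g \<in> ?\<Gamma>\<close> by auto
    have kc: "k \<in> carrier_mat N N" using k G by auto
    have "P * (P * k * P) * P = (P * P) * k * (P * P)"
      using kc by (simp add: assoc_mult_mat[of _ N N _ N _ N] mult_carrier_mat[of _ N N _ N])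
    then show ?thesis using k kc by (simp add: P_P)
  qed
  have e: "eigenforms N p ?\<Gamma> c = act ` eigenforms N p \<Gamma> c" for c
  proof
    show "act ` eigenforms N p \<Gamma> c \<subseteq> eigenforms N p ?\<Gamma> c"
      using eigenforms_act[OF _ G' p conj_back] by blast
    show "eigenforms N p ?\<Gamma> c \<subseteq> act ` eigenforms N p \<Gamma> c"
    proof
      fix \<omega> assume "\<omega> \<in> eigenforms N p ?\<Gamma> c"
      then have "act \<omega> \<in> eigenforms N p \<Gamma> c" by (rule eigenforms_act[OF _ G p]) auto
      then show "\<omega> \<in> act ` eigenforms N p \<Gamma> c" by (metis act_act imageI)
    qed
  qed
  have z: "act \<omega> = 0 \<longleftrightarrow> \<omega> = 0" for \<omega>
    by (metis act_act act_def fun_eq_iff zero_fun_def)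
  show ?thesis
    unfolding isospectral_on_forms_def form_spectrum_def e dim_act using z by auto
qed

end

section \<open>Finite-dimensional Hermitian spaces of functions\<close>

definition ipr :: "'i set \<Rightarrow> ('i \<Rightarrow> complex) \<Rightarrow> ('i \<Rightarrow> complex) \<Rightarrow> complex" where
  "ipr X u v = (\<Sum>x\<in>X. u x * cnj (v x))"

lemma ipr_cnj: "cnj (ipr X u v) = ipr X v u"
  by (simp add: ipr_def mult.commute)

lemma ipr_add_left: "ipr X (\<lambda>x. u x + v x) w = ipr X u w + ipr X v w"
  by (simp add: ipr_def algebra_simps sum.distrib)

lemma ipr_scale_left: "ipr X (\<lambda>x. c * u x) w = c * ipr X u w"
  by (simp add: ipr_def sum_distrib_left mult.assoc)

lemma ipr_sum_left: "ipr X (\<lambda>x. \<Sum>i\<in>A. u i x) w = (\<Sum>i\<in>A. ipr X (u i) w)"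
  unfolding ipr_def by (simp add: sum_distrib_right) (rule sum.swap)

lemma ipr_add_right: "ipr X w (\<lambda>x. u x + v x) = ipr X w u + ipr X w v"
  by (simp add: ipr_def algebra_simps sum.distrib)

lemma ipr_scale_right: "ipr X w (\<lambda>x. c * u x) = cnj c * ipr X w u"
  by (simp add: ipr_def sum_distrib_left mult_ac)

lemma ipr_sum_right: "ipr X w (\<lambda>x. \<Sum>i\<in>A. u i x) = (\<Sum>i\<in>A. ipr X w (u i))"
  unfolding ipr_def by (simp add: sum_distrib_left) (rule sum.swap)

lemma ipr_self: "ipr X u u = of_real (\<Sum>x\<in>X. (cmod (u x))\<^sup>2)"
  by (simp add: ipr_def complex_norm_square[symmetric])

lemma ipr_self_eq_0:
  assumes "finite X" "ipr X u u = 0" "x \<in> X"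
  shows "u x = 0"
proof -
  have "(\<Sum>x\<in>X. (cmod (u x))\<^sup>2) = 0" using assms(2) by (simp only: ipr_self of_real_eq_0_iff)
  then show ?thesis using assms(1,3) by (simp add: sum_nonneg_eq_0_iff)
qed

text \<open>Bessel's inequality for the delta function at each point bounds the sum of the
  \<open>(cmod (w i x))\<^sup>2\<close> over \<open>i\<close> by 1. Summing over all points counts
  \<open>m\<close> on one side and gives at most \<open>card X\<close> on the other.\<close>

lemma orthonormal_card_le:
  assumes X: "finite X"
    and on: "\<And>i j. i < m \<Longrightarrow> j < m \<Longrightarrow> ipr X (w i) (w j) = (if i = j then 1 else 0)"
  shows "m \<le> card X"
proof -
  have bessel: "(\<Sum>i<m. (cmod (w i x))\<^sup>2) \<le> 1" if x: "x \<in> X" for x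
  proof -
    define s where "s = (\<Sum>i<m. (cmod (w i x))\<^sup>2)"
    \<comment> \<open>The orthogonal projection of the delta function at \<open>x\<close> to the
      span of the family. Its squared norm and its value at \<open>x\<close> are both
      \<open>s\<close>, whence \<open>s * s \<le> s\<close>.\<close>
    define p where "p y = (\<Sum>i<m. cnj (w i x) * w i y)" for y
    have px: "p x = of_real s"
      by (simp add: p_def s_def complex_norm_square mult.commute del: of_real_power)
    have "ipr X p p = (\<Sum>i<m. \<Sum>j<m. cnj (w i x) * (w j x) * ipr X (w i) (w j))"
      unfolding p_def ipr_sum_left ipr_sum_right ipr_scale_left ipr_scale_right
      by (simp add: sum_distrib_left mult_ac)
    also have "\<dots> = (\<Sum>i<m. \<Sum>j<m. if i = j then cnj (w i x) * w j x else 0)"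
      by (intro sum.cong refl) (auto simp: on)
    also have "\<dots> = of_real s"
      by (simp add: s_def complex_norm_square mult.commute del: of_real_power)
    finally have "(\<Sum>y\<in>X. (cmod (p y))\<^sup>2) = s" unfolding ipr_self by (simp only: of_real_eq_iff)
    moreover have "(cmod (p x))\<^sup>2 \<le> (\<Sum>y\<in>X. (cmod (p y))\<^sup>2)"
      using X x by (intro member_le_sum) auto
    moreover have "(cmod (p x))\<^sup>2 = s * s" by (simp add: px power2_eq_square)
    ultimately have "s * s \<le> s" by simp
    have "s \<le> 1"
    proof (rule ccontr)
      assume "\<not> s \<le> 1"
      then have "1 * s < s * s" by (intro mult_strict_right_mono) auto
      then show False using \<open>s * s \<le> s\<close> by simp
    qed
    then show ?thesis by (simp add: s_def)
  qed
  have "real m = (\<Sum>i<m. \<Sum>x\<in>X. (cmod (w i x))\<^sup>2)"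
  proof -
    have "(\<Sum>x\<in>X. (cmod (w i x))\<^sup>2) = 1" if "i < m" for i
      using on[OF that that] unfolding ipr_self by (simp only: of_real_eq_1_iff simp_thms if_True)
    then show ?thesis by simp
  qed
  also have "\<dots> = (\<Sum>x\<in>X. \<Sum>i<m. (cmod (w i x))\<^sup>2)" by (rule sum.swap)
  also have "\<dots> \<le> (\<Sum>x\<in>X. 1)" by (rule sum_mono) (rule bessel)
  finally show ?thesis by simp
qed

text \<open>The cardinality bound yields a longest orthonormal family in \<open>W\<close>. If it
  failed to expand some \<open>u\<close>, the normalised residual of \<open>u\<close> would extend
  it.\<close>

lemma orthonormal_basis_exists:
  assumes X: "finite X" and supp: "\<And>u x. u \<in> W \<Longrightarrow> x \<notin> X \<Longrightarrow> u x = 0"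
    and zero: "(\<lambda>x. 0) \<in> W"
    and add: "\<And>u v. u \<in> W \<Longrightarrow> v \<in> W \<Longrightarrow> (\<lambda>x. u x + v x) \<in> W"
    and scale: "\<And>c u. u \<in> W \<Longrightarrow> (\<lambda>x. c * u x) \<in> W"
  obtains m :: nat and w where "\<And>i. i < m \<Longrightarrow> w i \<in> W"
    "\<And>i j. i < m \<Longrightarrow> j < m \<Longrightarrow> ipr X (w i) (w j) = (if i = j then 1 else 0)"
    "\<And>u. u \<in> W \<Longrightarrow> u = (\<lambda>x. \<Sum>i<m. ipr X u (w i) * w i x)"
proof -
  define ON where "ON m \<longleftrightarrow> (\<exists>w. (\<forall>i<m. w i \<in> W) \<and>
     (\<forall>i<m. \<forall>j<m. ipr X (w i) (w j) = (if i = j then 1 else 0)))" for m :: nat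
  have "ON 0" by (simp add: ON_def)
  moreover have "m \<le> card X" if "ON m" for m
    using that orthonormal_card_le[OF X] unfolding ON_def by blast
  ultimately obtain m where m: "ON m" "\<And>k. ON k \<Longrightarrow> k \<le> m"
    using Nat.ex_has_greatest_nat[of ON 0 "card X"] by blast
  then obtain w where w: "\<And>i. i < m \<Longrightarrow> w i \<in> W"
      "\<And>i j. i < m \<Longrightarrow> j < m \<Longrightarrow> ipr X (w i) (w j) = (if i = j then 1 else 0)"
    unfolding ON_def by blast
  have "u = (\<lambda>x. \<Sum>i<m. ipr X u (w i) * w i x)" if u: "u \<in> W" for u
  proof (rule ccontr)
    assume ne: "u \<noteq> (\<lambda>x. \<Sum>i<m. ipr X u (w i) * w i x)"
    define p where "p = (\<lambda>x. \<Sum>i<m. ipr X u (w i) * w i x)"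
    define r where "r = (\<lambda>x. u x + (-1) * p x)"
    have "(\<lambda>x. \<Sum>i<k. ipr X u (w i) * w i x) \<in> W" if "k \<le> m" for k
      using that by (induction k) (use zero add scale w(1) in \<open>auto simp: Suc_le_eq\<close>)
    then have "p \<in> W" by (simp add: p_def)
    then have rW: "r \<in> W" unfolding r_def using u add scale by blast
    have pj: "ipr X p (w j) = ipr X u (w j)" if "j < m" for j
    proof -
      have "ipr X p (w j) = (\<Sum>i<m. if i = j then ipr X u (w i) else 0)"
        unfolding p_def ipr_sum_left ipr_scale_left by (intro sum.cong refl) (auto simp: w(2) that)
      then show ?thesis using that by simp
    qed
    have orth: "ipr X r (w j) = 0" if "j < m" for j
      unfolding r_def ipr_add_left ipr_scale_left by (simp add: pj[OF that])
    obtain x where x: "r x \<noteq> 0" using ne by (auto simp: r_def p_def fun_eq_iff)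
    then have xX: "x \<in> X" using supp[OF rW] by blast
    define s where "s = (\<Sum>x\<in>X. (cmod (r x))\<^sup>2)"
    have "s > 0" unfolding s_def by (rule sum_pos2[OF X xX]) (use x in auto)
    have rr: "ipr X r r = of_real s" by (simp only: ipr_self s_def)
    define w' where "w' i = (if i < m then w i else (\<lambda>x. of_real (1 / sqrt s) * r x))" for i
    have "ON (Suc m)"
      unfolding ON_def
    proof (intro exI[of _ w'] conjI allI impI)
      show "w' i \<in> W" for i using w(1) scale[OF rW] by (auto simp: w'_def simp del: of_real_divide)
      have sq: "complex_of_real (1 / sqrt s) * (complex_of_real (1 / sqrt s) * of_real s) = 1"
        using \<open>s > 0\<close> by (simp only: of_real_mult[symmetric]) simp
      show "ipr X (w' i) (w' j) = (if i = j then 1 else 0)" if ij: "i < Suc m" "j < Suc m" for i j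
      proof -
        consider "i < m" "j < m" | "i < m" "j = m" | "i = m" "j < m" | "i = m" "j = m"
          using ij by fastforce
        then show ?thesis
        proof cases
          case 1
          then show ?thesis by (simp add: w'_def w(2))
        next
          case 2
          then have "ipr X (w i) r = 0" using orth[of i] ipr_cnj[of X r "w i"] by simp
          then show ?thesis using 2 by (simp add: w'_def ipr_scale_right del: of_real_divide)
        next
          case 3
          then show ?thesis using orth[of j] by (simp add: w'_def ipr_scale_left del: of_real_divide)
        next
          case 4
          then show ?thesis using sq by (simp add: w'_def ipr_scale_left ipr_scale_right rr del: of_real_divide)
        qed
      qed
    qed
    then show False using m(2)[of "Suc m"] by simp
  qed
  with w show ?thesis by (intro that[of m w])
qed

section \<open>Tensor powers of the standard representation\<close>

text \<open>An order \<open>n\<close> tensor over \<open>\<complex>\<^sup>N\<close> is its coefficient function on \<open>idx N n\<close>, extended by zero.\<close>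

definition tens :: "nat \<Rightarrow> nat \<Rightarrow> (nat list \<Rightarrow> complex) set" where
  "tens N n = {t. \<forall>I. I \<notin> idx N n \<longrightarrow> t I = 0}"

text \<open>The tensor power of the standard representation in coordinates. Exterior powers appear
  inside it as the alternating tensors.\<close>

definition rho :: "nat \<Rightarrow> nat \<Rightarrow> real mat \<Rightarrow> (nat list \<Rightarrow> complex) \<Rightarrow> nat list \<Rightarrow> complex" where
  "rho N n g t = (\<lambda>I. if I \<in> idx N n
     then \<Sum>K\<in>idx N n. (\<Prod>l<n. of_real (g $$ (I ! l, K ! l))) * t K else 0)"

lemma prod_sum_idx:
  fixes f :: "nat \<Rightarrow> nat \<Rightarrow> 'a::comm_semiring_1"
  shows "(\<Prod>l<n. \<Sum>k<N. f l k) = (\<Sum>K\<in>idx N n. \<Prod>l<n. f l (K ! l))"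
proof (induction n arbitrary: f)
  case 0
  then show ?case by simp
next
  case (Suc n)
  have "(\<Prod>l<Suc n. \<Sum>k<N. f l k) = (\<Sum>k<N. f 0 k) * (\<Sum>K\<in>idx N n. \<Prod>l<n. f (Suc l) (K ! l))"
    using Suc.IH[of "\<lambda>l. f (Suc l)"] by (simp add: prod.lessThan_Suc_shift del: prod.lessThan_Suc)
  also have "\<dots> = (\<Sum>k<N. \<Sum>K\<in>idx N n. \<Prod>l<Suc n. f l ((k # K) ! l))"
    by (simp add: sum_product prod.lessThan_Suc_shift del: prod.lessThan_Suc)
  finally show ?case by (simp only: sum_idx_Suc)
qed

lemma rho_tens [simp]: "rho N n g t \<in> tens N n"
  by (simp add: rho_def tens_def)

lemma tens_eqI:
  assumes "s \<in> tens N n" "t \<in> tens N n" "\<And>I. I \<in> idx N n \<Longrightarrow> s I = t I"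
  shows "s = t"
proof
  fix I show "s I = t I" using assms by (cases "I \<in> idx N n") (auto simp: tens_def)
qed

lemma rho_add: "rho N n g (\<lambda>I. s I + t I) = (\<lambda>I. rho N n g s I + rho N n g t I)"
  by (simp add: rho_def fun_eq_iff algebra_simps sum.distrib)

lemma rho_scale: "rho N n g (\<lambda>I. c * t I) = (\<lambda>I. c * rho N n g t I)"
  by (simp add: rho_def fun_eq_iff sum_distrib_left mult_ac)

lemma rho_sum: "rho N n g (\<lambda>I. \<Sum>a\<in>A. t a I) = (\<lambda>I. \<Sum>a\<in>A. rho N n g (t a) I)"
proof
  fix I
  show "rho N n g (\<lambda>I. \<Sum>a\<in>A. t a I) I = (\<Sum>a\<in>A. rho N n g (t a) I)"
  proof (cases "I \<in> idx N n")
    case True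
    then show ?thesis by (simp add: rho_def sum_distrib_left) (rule sum.swap)
  qed (simp add: rho_def)
qed

lemma rho_mult:
  assumes g: "g \<in> carrier_mat N N" and h: "h \<in> carrier_mat N N"
  shows "rho N n (g * h) t = rho N n g (rho N n h t)"
proof (rule tens_eqI[OF rho_tens rho_tens])
  fix I assume I: "I \<in> idx N n"
  have e: "(\<Prod>l<n. complex_of_real ((g * h) $$ (I ! l, K ! l))) =
      (\<Sum>J\<in>idx N n. (\<Prod>l<n. of_real (g $$ (I ! l, J ! l))) * (\<Prod>l<n. of_real (h $$ (J ! l, K ! l))))"
    if K: "K \<in> idx N n" for K
  proof -
    have "(\<Prod>l<n. complex_of_real ((g * h) $$ (I ! l, K ! l))) =
        (\<Prod>l<n. \<Sum>j<N. of_real (g $$ (I ! l, j)) * of_real (h $$ (j, K ! l)))"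
    proof (rule prod.cong[OF refl])
      fix l assume "l \<in> {..<n}"
      then have "I ! l < N" "K ! l < N" using idx_nth[OF I] idx_nth[OF K] by auto
      then show "complex_of_real ((g * h) $$ (I ! l, K ! l)) =
          (\<Sum>j<N. of_real (g $$ (I ! l, j)) * of_real (h $$ (j, K ! l)))"
        using g h by (simp add: scalar_prod_def lessThan_atLeast0)
    qed
    then show ?thesis by (simp add: prod_sum_idx prod.distrib)
  qed
  have "rho N n (g * h) t I = (\<Sum>K\<in>idx N n. \<Sum>J\<in>idx N n.
      (\<Prod>l<n. of_real (g $$ (I ! l, J ! l))) * ((\<Prod>l<n. of_real (h $$ (J ! l, K ! l))) * t K))"
    using I by (simp add: rho_def e sum_distrib_right mult.assoc)
  also have "\<dots> = (\<Sum>J\<in>idx N n. \<Sum>K\<in>idx N n.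
      (\<Prod>l<n. of_real (g $$ (I ! l, J ! l))) * ((\<Prod>l<n. of_real (h $$ (J ! l, K ! l))) * t K))"
    by (rule sum.swap)
  also have "\<dots> = rho N n g (rho N n h t) I"
    using I by (simp add: rho_def sum_distrib_left)
  finally show "rho N n (g * h) t I = rho N n g (rho N n h t) I" .
qed

lemma idx_map: "(\<And>i. i < N \<Longrightarrow> \<sigma> i < N) \<Longrightarrow> I \<in> idx N n \<Longrightarrow> map \<sigma> I \<in> idx N n"
  by (auto simp: idx_def subset_iff)

text \<open>With one nonzero entry per row, only one index list survives in the sum. This serves the
  identity, permutation matrices and sign changes.\<close>

lemma rho_monomial:
  assumes g: "\<And>i j. i < N \<Longrightarrow> j < N \<Longrightarrow> g $$ (i, j) = (if j = \<sigma> i then d i else 0)"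
    and s: "\<And>i. i < N \<Longrightarrow> \<sigma> i < N" and I: "I \<in> idx N n"
  shows "rho N n g t I = (\<Prod>l<n. of_real (d (I ! l))) * t (map \<sigma> I)"
proof -
  have "(\<Prod>l<n. complex_of_real (g $$ (I ! l, K ! l))) * t K =
      (if K = map \<sigma> I then (\<Prod>l<n. of_real (d (I ! l))) * t K else 0)" if K: "K \<in> idx N n" for K
  proof (cases "K = map \<sigma> I")
    case True
    have "g $$ (I ! l, K ! l) = d (I ! l)" if "l < n" for l
      using idx_nth[OF I that] s I that True by (simp add: g idx_def)
    then show ?thesis using True by simp
  next
    case False
    then obtain l where "l < n" "K ! l \<noteq> \<sigma> (I ! l)"
      using I K by (auto simp: idx_def list_eq_iff_nth_eq)
    then have "g $$ (I ! l, K ! l) = 0" using idx_nth[OF I] idx_nth[OF K] by (simp add: g)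
    then have "(\<Prod>l<n. complex_of_real (g $$ (I ! l, K ! l))) = 0"
      using \<open>l < n\<close> by (intro prod_zero) auto
    then show ?thesis using False by simp
  qed
  then have "rho N n g t I = (\<Sum>K\<in>idx N n. if K = map \<sigma> I then (\<Prod>l<n. of_real (d (I ! l))) * t K else 0)"
    using I unfolding rho_def by simp
  then show ?thesis using idx_map[OF s I] by (simp add: sum.delta')
qed

lemma rho_one: "t \<in> tens N n \<Longrightarrow> rho N n (1\<^sub>m N) t = t"
  using rho_monomial[of N "1\<^sub>m N" "\<lambda>i. i" "\<lambda>_. 1"] by (intro tens_eqI[OF rho_tens]) auto

lemma rho_perm_mat:
  assumes "\<And>i. i < N \<Longrightarrow> \<sigma> i < N" "I \<in> idx N n"
  shows "rho N n (perm_mat N \<sigma>) t I = t (map \<sigma> I)"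
  using rho_monomial[of N "perm_mat N \<sigma>" \<sigma> "\<lambda>_. 1"] assms by (simp add: perm_mat_def)

text \<open>Bilinear rather than Hermitian, because it is compared with the volume pairing, which is
  bilinear. Since \<open>g\<close> is real, the Hermitian version follows by conjugating
  \<open>v\<close>.\<close>

lemma rho_dot_adj:
  assumes g: "g \<in> carrier_mat N N"
  shows "(\<Sum>I\<in>idx N n. rho N n g u I * v I) = (\<Sum>I\<in>idx N n. u I * rho N n (transpose_mat g) v I)"
proof -
  have "(\<Sum>I\<in>idx N n. rho N n g u I * v I) =
      (\<Sum>I\<in>idx N n. \<Sum>K\<in>idx N n. (\<Prod>l<n. of_real (g $$ (I ! l, K ! l))) * u K * v I)"
    by (simp add: rho_def sum_distrib_right)
  also have "\<dots> = (\<Sum>K\<in>idx N n. \<Sum>I\<in>idx N n. (\<Prod>l<n. of_real (g $$ (I ! l, K ! l))) * u K * v I)"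
    by (rule sum.swap)
  also have "\<dots> = (\<Sum>K\<in>idx N n. u K * rho N n (transpose_mat g) v K)"
  proof (rule sum.cong[OF refl])
    fix K assume K: "K \<in> idx N n"
    have "transpose_mat g $$ (K ! l, I ! l) = g $$ (I ! l, K ! l)" if "I \<in> idx N n" "l < n" for I l
      using idx_nth[OF K] idx_nth[OF that(1)] that g by simp
    then show "(\<Sum>I\<in>idx N n. (\<Prod>l<n. of_real (g $$ (I ! l, K ! l))) * u K * v I) =
        u K * rho N n (transpose_mat g) v K"
      using K by (simp add: rho_def sum_distrib_left mult_ac)
  qed
  finally show ?thesis .
qed

lemma rho_cnj: "cnj (rho N n g t I) = rho N n g (\<lambda>I. cnj (t I)) I"
  by (simp add: rho_def)

lemma ipr_rho_adj:
  assumes g: "g \<in> carrier_mat N N"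
  shows "ipr (idx N n) (rho N n g u) v = ipr (idx N n) u (rho N n (transpose_mat g) v)"
  unfolding ipr_def rho_cnj by (rule rho_dot_adj[OF g])

section \<open>Alternating tensors\<close>

text \<open>The exterior power as antisymmetric tensors. The condition concerns all lists of length
  \<open>n\<close>, whatever their entries, so it does not depend on the dimension of the
  space.\<close>

definition alt :: "nat \<Rightarrow> (nat list \<Rightarrow> complex) \<Rightarrow> bool" where
  "alt n t \<longleftrightarrow> (\<forall>p I. p permutes {..<n} \<longrightarrow> length I = n \<longrightarrow>
     t (permute_list p I) = of_int (sign p) * t I)"

lemma permute_list_idx:
  "p permutes {..<n} \<Longrightarrow> permute_list p I \<in> idx N n \<longleftrightarrow> I \<in> idx N n"
  by (auto simp: idx_def)

lemma permute_list_inv: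
  assumes "p permutes {..<n}" "length I = n"
  shows "permute_list p (permute_list (Hilbert_Choice.inv p) I) = I" "permute_list (Hilbert_Choice.inv p) (permute_list p I) = I"
proof -
  note q = permutes_inv[OF assms(1)]
  have "permute_list p (permute_list (Hilbert_Choice.inv p) I) = permute_list (Hilbert_Choice.inv p \<circ> p) I"
    by (rule permute_list_compose[symmetric]) (use assms in simp)
  also have "Hilbert_Choice.inv p \<circ> p = id" by (rule permutes_inv_o(2)[OF assms(1)])
  finally show "permute_list p (permute_list (Hilbert_Choice.inv p) I) = I" by simp
  have "permute_list (Hilbert_Choice.inv p) (permute_list p I) = permute_list (p \<circ> Hilbert_Choice.inv p) I"
    by (rule permute_list_compose[symmetric]) (use q assms in simp)
  also have "p \<circ> Hilbert_Choice.inv p = id" by (rule permutes_inv_o(1)[OF assms(1)])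
  finally show "permute_list (Hilbert_Choice.inv p) (permute_list p I) = I" by simp
qed

lemma idx_length: "I \<in> idx N n \<Longrightarrow> length I = n"
  by (simp add: idx_def)

text \<open>All tensor slots are transformed by the same \<open>g\<close>, so permuting the slots
  commutes with the action.\<close>

lemma rho_alt:
  assumes t: "alt n t"
  shows "alt n (rho N n g t)"
  unfolding alt_def
proof (intro allI impI)
  fix p and I :: "nat list" assume p: "p permutes {..<n}" and l: "length I = n"
  show "rho N n g t (permute_list p I) = of_int (sign p) * rho N n g t I"
  proof (cases "I \<in> idx N n")
    case True
    have "(\<Sum>K\<in>idx N n. (\<Prod>l<n. of_real (g $$ (permute_list p I ! l, K ! l))) * t K) =
        (\<Sum>K\<in>idx N n. (\<Prod>l<n. of_real (g $$ (permute_list p I ! l, permute_list p K ! l))) * t (permute_list p K))"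
      by (rule sum.reindex_bij_witness[of _ "permute_list p" "permute_list (Hilbert_Choice.inv p)"])
        (auto simp: permute_list_idx[OF p] permute_list_idx[OF permutes_inv[OF p]]
          permute_list_inv[OF p idx_length[where N = N]])
    also have "\<dots> = (\<Sum>K\<in>idx N n. of_int (sign p) * ((\<Prod>l<n. of_real (g $$ (I ! l, K ! l))) * t K))"
    proof (rule sum.cong[OF refl])
      fix K assume K: "K \<in> idx N n"
      then have lK: "length K = n" by (simp add: idx_def)
      have "(\<Prod>l<n. complex_of_real (g $$ (permute_list p I ! l, permute_list p K ! l))) =
          (\<Prod>i<n. of_real (g $$ (I ! p i, K ! p i)))"
        using p l lK by (intro prod.cong) (auto simp: permute_list_nth)
      also have "\<dots> = (\<Prod>l<n. of_real (g $$ (I ! l, K ! l)))"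
        using prod.permute[OF p, of "\<lambda>l. complex_of_real (g $$ (I ! l, K ! l))"] by (simp add: o_def)
      finally show "(\<Prod>l<n. complex_of_real (g $$ (permute_list p I ! l, permute_list p K ! l))) * t (permute_list p K) =
          of_int (sign p) * ((\<Prod>l<n. of_real (g $$ (I ! l, K ! l))) * t K)"
        using t p lK by (simp add: alt_def)
    qed
    finally show ?thesis using True permute_list_idx[OF p, of I N]
      by (simp add: rho_def sum_distrib_left)
  next
    case False
    then show ?thesis using permute_list_idx[OF p, of I N] by (simp add: rho_def)
  qed
qed

lemma alt_not_distinct:
  assumes t: "alt n t" and l: "length I = n" and d: "\<not> distinct I"
  shows "t I = 0"
proof -
  obtain i j where ij: "i < n" "j < n" "i \<noteq> j" "I ! i = I ! j"
    using d l by (auto simp: distinct_conv_nth)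
  let ?p = "Transposition.transpose i j"
  have p: "?p permutes {..<n}" using ij by (simp add: permutes_swap_id)
  have "permute_list ?p I = I"
    using p l ij by (intro nth_equalityI) (auto simp: permute_list_nth Transposition.transpose_def)
  moreover have "sign ?p = -1" using ij by (simp add: sign_swap_id)
  ultimately have "t I = - t I" using t p l unfolding alt_def by (metis mult_minus1 of_int_1 of_int_minus)
  then show ?thesis by simp
qed

lemma permute_list_upt:
  assumes p: "p permutes {..<n}"
  shows "permute_list p [0..<n] = map p [0..<n]"
proof (rule nth_equalityI)
  fix i assume "i < length (permute_list p [0..<n])"
  then have "i < n" "p i < n" using permutes_in_image[OF p, of i] by auto
  then show "permute_list p [0..<n] ! i = map p [0..<n] ! i"
    using p by (simp add: permute_list_nth)
qed simp

lemma distinct_perm_upt: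
  assumes "distinct I" "set I = {..<n}"
  obtains q where "q permutes {..<n}" "I = map q [0..<n]"
proof -
  have "mset I = mset [0..<n]"
    using set_eq_iff_mset_eq_distinct[of I "[0..<n]"] assms by (simp add: lessThan_atLeast0)
  then obtain q where "q permutes {..<length [0..<n]}" "permute_list q [0..<n] = I"
    by (rule mset_eq_permutation)
  then show ?thesis using permute_list_upt[of q n] by (intro that[of q]) simp_all
qed

lemma alt_perm_upt: "alt n t \<Longrightarrow> q permutes {..<n} \<Longrightarrow> t (map q [0..<n]) = of_int (sign q) * t [0..<n]"
  using permute_list_upt[of q n] unfolding alt_def by (metis length_upt diff_zero)

section \<open>The group \<open>SO(N)\<close>\<close>

lemma SO_iff: "g \<in> carrier (SO_group N) \<longleftrightarrow>
    g \<in> carrier_mat N N \<and> g * transpose_mat g = 1\<^sub>m N \<and> det g = 1"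
  by (auto simp: SO_group_def)

lemma SO_simps [simp]: "mult (SO_group N) = (*)" "one (SO_group N) = 1\<^sub>m N"
  by (simp_all add: SO_group_def)

lemma SO_carrier: "g \<in> carrier (SO_group N) \<Longrightarrow> g \<in> carrier_mat N N"
  by (simp add: SO_iff)

lemma orthogonal_transpose_mult:
  fixes g :: "real mat"
  assumes "g \<in> carrier_mat N N" "g * transpose_mat g = 1\<^sub>m N"
  shows "transpose_mat g * g = 1\<^sub>m N"
  using mat_mult_left_right_inverse[OF assms(1) _ assms(2)] assms(1) by simp

lemma SO_transpose_mult: "g \<in> carrier (SO_group N) \<Longrightarrow> transpose_mat g * g = 1\<^sub>m N"
  by (simp add: SO_iff orthogonal_transpose_mult)

lemma SO_transpose: "g \<in> carrier (SO_group N) \<Longrightarrow> transpose_mat g \<in> carrier (SO_group N)"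
  by (auto simp: SO_iff orthogonal_transpose_mult det_transpose)

lemma orthogonal_mult:
  fixes g h :: "real mat"
  assumes g: "g \<in> carrier_mat N N" "g * transpose_mat g = 1\<^sub>m N"
    and h: "h \<in> carrier_mat N N" "h * transpose_mat h = 1\<^sub>m N"
  shows "(g * h) * transpose_mat (g * h) = 1\<^sub>m N"
proof -
  have "(g * h) * transpose_mat (g * h) = (g * h) * (transpose_mat h * transpose_mat g)"
    using transpose_mult[OF g(1) h(1)] by simp
  also have "\<dots> = g * (h * (transpose_mat h * transpose_mat g))"
    using g h by (intro assoc_mult_mat[of _ N N _ N _ N]) auto
  also have "h * (transpose_mat h * transpose_mat g) = (h * transpose_mat h) * transpose_mat g"
    using g h by (intro assoc_mult_mat[of _ N N _ N _ N, symmetric]) auto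
  also have "g * ((h * transpose_mat h) * transpose_mat g) = 1\<^sub>m N"
    using g h by simp
  finally show ?thesis .
qed

lemma SO_mult: "g \<in> carrier (SO_group N) \<Longrightarrow> h \<in> carrier (SO_group N) \<Longrightarrow> g * h \<in> carrier (SO_group N)"
  using orthogonal_mult[of g N h] det_mult[of g N h] by (auto simp: SO_iff)

lemma SO_one: "1\<^sub>m N \<in> carrier (SO_group N)"
  by (simp add: SO_iff)

lemma group_SO: "group (SO_group N)"
proof (rule groupI)
  fix g assume g: "g \<in> carrier (SO_group N)"
  show "\<exists>y\<in>carrier (SO_group N). y \<otimes>\<^bsub>SO_group N\<^esub> g = \<one>\<^bsub>SO_group N\<^esub>"
    using SO_transpose[OF g] g by (auto simp: SO_iff orthogonal_transpose_mult intro!: bexI[of _ "transpose_mat g"])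
qed (auto simp: SO_mult SO_one intro: assoc_mult_mat[of _ N N _ N _ N] left_mult_one_mat dest!: SO_carrier)

lemma SO_inv: "g \<in> carrier (SO_group N) \<Longrightarrow> inv\<^bsub>SO_group N\<^esub> g = transpose_mat g"
  using group.inv_equality[OF group_SO, of N "transpose_mat g" g] SO_transpose[of g N]
  by (simp add: SO_iff orthogonal_transpose_mult)

text \<open>The case \<open>\<alpha> = 0\<^sub>v m\<close> is included, so that a fixed line and a
  trivial fixed space are treated alike.\<close>

lemma n_mult_line:
  assumes a: "\<alpha> \<in> carrier_vec m" and f: "fixed_vectors m \<pi> \<Gamma> = range (\<lambda>c. c \<cdot>\<^sub>v \<alpha>)"
  shows "n_mult m \<pi> \<Gamma> = (if \<alpha> = 0\<^sub>v m then 0 else 1)"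
proof -
  interpret vec_space "TYPE(complex)" m .
  let ?U = "range (\<lambda>c. c \<cdot>\<^sub>v \<alpha>)"
  have sm: "submodule class_ring ?U V"
  proof -
    have "?U \<subseteq> carrier_vec m" using a by auto
    moreover have "0\<^sub>v m \<in> ?U" using a by (intro image_eqI[of _ _ 0]) auto
    moreover have "c \<cdot>\<^sub>v \<alpha> + d \<cdot>\<^sub>v \<alpha> \<in> ?U" for c d
      by (rule image_eqI[of _ _ "c + d"]) (simp_all add: add_smult_distrib_vec)
    moreover have "c \<cdot>\<^sub>v (d \<cdot>\<^sub>v \<alpha>) \<in> ?U" for c d
      by (rule image_eqI[of _ _ "c * d"]) (simp_all add: smult_smult_assoc)
    ultimately show ?thesis
      unfolding LinearCombinations.submodule_def using module_axioms
      by (auto simp: module_vec_simps class_ring_simps)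
  qed
  then have "VectorSpace.subspace class_ring ?U V"
    by (simp add: VectorSpace.subspace_def vectorspace_axioms)
  from subspace_is_vs[OF this] interpret u: vectorspace class_ring "vs ?U" .
  have aU: "\<alpha> \<in> ?U" by (rule image_eqI[of _ _ 1]) simp_all
  have gen: "u.gen_set {\<alpha>}"
  proof
    show "u.span {\<alpha>} \<subseteq> carrier (vs ?U)" using aU by (intro u.span_is_subset2) simp
    have sp: "submodule class_ring (u.span {\<alpha>}) (vs ?U)" using aU by (intro u.span_is_submodule) simp
    have "\<alpha> \<in> u.span {\<alpha>}" using aU u.in_own_span[of "{\<alpha>}"] by auto
    then show "carrier (vs ?U) \<subseteq> u.span {\<alpha>}"
      using submodule.smult_closed[OF sp] by (auto simp: module_vec_simps)
  qed
  have z: "\<zero>\<^bsub>vs ?U\<^esub> = 0\<^sub>v m" by (simp add: module_vec_simps)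
  show ?thesis
  proof (cases "\<alpha> = 0\<^sub>v m")
    case True
    then show ?thesis using u.dim0I gen z by (simp add: n_mult_def f)
  next
    case False
    then show ?thesis using u.dim1I[OF gen] aU z by (simp add: n_mult_def f)
  qed
qed

section \<open>Unitary matrix representations on invariant subspaces of tensors\<close>

text \<open>An invariant space of tensors with an orthonormal basis \<open>w\<close>. Coordinates in
  this basis turn the action into unitary matrices, the form in which the unitary dual is
  described.\<close>

locale orth_rep =
  fixes N n :: nat and W :: "(nat list \<Rightarrow> complex) set" and m :: nat and w :: "nat \<Rightarrow> nat list \<Rightarrow> complex"
  assumes W_tens: "W \<subseteq> tens N n"
    and W_zero: "(\<lambda>_. 0) \<in> W"
    and W_add: "u \<in> W \<Longrightarrow> v \<in> W \<Longrightarrow> (\<lambda>x. u x + v x) \<in> W"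
    and W_scale: "u \<in> W \<Longrightarrow> (\<lambda>x. c * u x) \<in> W"
    and W_inv: "g \<in> carrier (SO_group N) \<Longrightarrow> u \<in> W \<Longrightarrow> rho N n g u \<in> W"
    and w_W: "i < m \<Longrightarrow> w i \<in> W"
    and w_on: "i < m \<Longrightarrow> j < m \<Longrightarrow> ipr (idx N n) (w i) (w j) = (if i = j then 1 else 0)"
    and w_expand: "u \<in> W \<Longrightarrow> u = (\<lambda>x. \<Sum>i<m. ipr (idx N n) u (w i) * w i x)"
begin

abbreviation ip where "ip \<equiv> ipr (idx N n)"
abbreviation R where "R \<equiv> rho N n"
abbreviation G where "G \<equiv> carrier (SO_group N)"

definition pi :: "real mat \<Rightarrow> complex mat" where
  "pi g = mat m m (\<lambda>(i, j). ip (R g (w j)) (w i))"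

text \<open>For a tensor outside \<open>W\<close> these are the coordinates of its orthogonal
  projection to \<open>W\<close>; the K-map into the representation is built on this.\<close>

definition co :: "(nat list \<Rightarrow> complex) \<Rightarrow> complex vec" where
  "co u = vec m (\<lambda>i. ip u (w i))"

definition re :: "complex vec \<Rightarrow> nat list \<Rightarrow> complex" where
  "re v = (\<lambda>x. \<Sum>i<m. v $ i * w i x)"

lemma co_carrier [simp]: "co u \<in> carrier_vec m"
  by (simp add: co_def)

lemma pi_carrier [simp]: "pi g \<in> carrier_mat m m"
  by (simp add: pi_def)

lemma W_sum: "finite A \<Longrightarrow> (\<And>a. a \<in> A \<Longrightarrow> f a \<in> W) \<Longrightarrow> (\<lambda>x. \<Sum>a\<in>A. f a x) \<in> W"
  by (induction A rule: finite_induct) (simp_all add: W_zero W_add)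

lemma re_W [simp]: "re v \<in> W"
  unfolding re_def by (rule W_sum) (auto intro: W_scale w_W)

lemma re_co: "u \<in> W \<Longrightarrow> re (co u) = u"
  using w_expand[of u] by (simp add: re_def co_def)

lemma co_re: "v \<in> carrier_vec m \<Longrightarrow> co (re v) = v"
proof (rule eq_vecI)
  fix i assume v: "v \<in> carrier_vec m" and "i < dim_vec v"
  then have i: "i < m" by simp
  have "ip (re v) (w i) = (\<Sum>j<m. if j = i then v $ j else 0)"
    unfolding re_def ipr_sum_left ipr_scale_left by (intro sum.cong refl) (auto simp: w_on i)
  then show "co (re v) $ i = v $ i" using i by (simp add: co_def)
qed (simp add: co_def)

lemma co_add: "co (\<lambda>x. u x + v x) = co u + co v"
  by (rule eq_vecI) (simp_all add: co_def ipr_add_left)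

lemma co_scale: "co (\<lambda>x. c * u x) = c \<cdot>\<^sub>v co u"
  by (rule eq_vecI) (simp_all add: co_def ipr_scale_left)

text \<open>Holds for every tensor \<open>t\<close>: \<open>W\<close> is stable under the transpose
  of \<open>g\<close>, so the orthogonal projection to \<open>W\<close> commutes with
  \<open>g\<close>.\<close>

lemma pi_co:
  assumes g: "g \<in> G"
  shows "pi g *\<^sub>v co t = co (R g t)"
proof (rule eq_vecI)
  fix i assume "i < dim_vec (co (R g t))"
  then have i: "i < m" by (simp add: co_def)
  have gc: "g \<in> carrier_mat N N" using SO_carrier[OF g] .
  let ?u = "R (transpose_mat g) (w i)"
  have "?u \<in> W" using W_inv[OF SO_transpose[OF g] w_W[OF i]] .
  from w_expand[OF this] have e: "?u = (\<lambda>x. \<Sum>j<m. ip ?u (w j) * w j x)" .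
  have "co (R g t) $ i = ip t ?u" using i by (simp add: co_def ipr_rho_adj[OF gc])
  also have "\<dots> = (\<Sum>j<m. cnj (ip ?u (w j)) * ip t (w j))"
    by (subst e) (simp only: ipr_sum_right ipr_scale_right)
  also have "\<dots> = (\<Sum>j<m. ip (R g (w j)) (w i) * ip t (w j))"
    by (simp add: ipr_cnj ipr_rho_adj[OF gc])
  also have "\<dots> = (pi g *\<^sub>v co t) $ i"
    using i by (simp add: pi_def co_def scalar_prod_def lessThan_atLeast0)
  finally show "(pi g *\<^sub>v co t) $ i = co (R g t) $ i" by simp
qed (simp add: pi_def co_def)

lemma col_pi: "j < m \<Longrightarrow> col (pi g) j = co (R g (w j))"
  by (rule eq_vecI) (simp_all add: pi_def co_def)

lemma pi_mult:
  assumes g: "g \<in> G" and h: "h \<in> G"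
  shows "pi (g * h) = pi g * pi h"
proof (rule eq_matI)
  fix i j assume "i < dim_row (pi g * pi h)" "j < dim_col (pi g * pi h)"
  then have ij: "i < m" "j < m" by (auto simp: pi_def)
  have "(pi g * pi h) $$ (i, j) = (pi g *\<^sub>v col (pi h) j) $ i"
    using ij pi_carrier[of g] pi_carrier[of h] by (simp del: pi_carrier)
  also have "\<dots> = co (R g (R h (w j))) $ i" using ij by (simp add: col_pi pi_co[OF g])
  also have "\<dots> = pi (g * h) $$ (i, j)"
    using ij rho_mult[OF SO_carrier[OF g] SO_carrier[OF h], of n "w j"] by (simp add: co_def pi_def)
  finally show "pi (g * h) $$ (i, j) = (pi g * pi h) $$ (i, j)" by simp
qed (simp_all add: pi_def)

lemma pi_one: "pi (1\<^sub>m N) = 1\<^sub>m m"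
proof (rule eq_matI)
  fix i j assume "i < dim_row (1\<^sub>m m)" "j < dim_col (1\<^sub>m m)"
  then have ij: "i < m" "j < m" by auto
  have "R (1\<^sub>m N) (w j) = w j" using rho_one w_W[OF ij(2)] W_tens by blast
  then show "pi (1\<^sub>m N) $$ (i, j) = 1\<^sub>m m $$ (i, j)" using ij by (simp add: pi_def w_on)
qed (simp_all add: pi_def)

lemma pi_adjoint:
  assumes g: "g \<in> G"
  shows "mat_adjoint (pi g) = pi (transpose_mat g)"
proof (rule eq_matI)
  fix i j assume "i < dim_row (pi (transpose_mat g))" "j < dim_col (pi (transpose_mat g))"
  then have ij: "i < m" "j < m" by (auto simp: pi_def)
  have "mat_adjoint (pi g) $$ (i, j) = cnj (pi g $$ (j, i))"
    using ij by (simp add: mat_adjoint_def mat_of_rows_index pi_def)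
  also have "\<dots> = pi (transpose_mat g) $$ (i, j)"
    using ij by (simp add: pi_def ipr_rho_adj[OF SO_carrier[OF g]] ipr_cnj)
  finally show "mat_adjoint (pi g) $$ (i, j) = pi (transpose_mat g) $$ (i, j)" .
qed (simp_all add: mat_adjoint_def pi_def)

lemma pi_hom: "pi \<in> hom (SO_group N) (U_group m)"
proof (rule homI)
  fix g assume g: "g \<in> G"
  have "pi g * mat_adjoint (pi g) = pi (g * transpose_mat g)"
    using pi_mult[OF g SO_transpose[OF g]] pi_adjoint[OF g] by simp
  also have "\<dots> = 1\<^sub>m m" using g by (simp add: SO_iff pi_one)
  finally show "pi g \<in> carrier (U_group m)" by (simp add: U_group_def)
qed (simp add: U_group_def pi_mult)

lemma pi_continuous:
  assumes A: "A \<in> G" and e: "\<epsilon> > 0"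
  shows "\<exists>\<delta>>0. \<forall>B\<in>G. (\<forall>i<N. \<forall>j<N. \<bar>B $$ (i, j) - A $$ (i, j)\<bar> < \<delta>) \<longrightarrow>
    (\<forall>i<m. \<forall>j<m. cmod (pi B $$ (i, j) - pi A $$ (i, j)) < \<epsilon>)"
proof -
  define S where "S \<delta> = {B. \<forall>i<N. \<forall>j<N. \<bar>B $$ (i, j) - A $$ (i, j)\<bar> < (\<delta>::real)}" for \<delta>
  \<comment> \<open>The filter of entrywise neighbourhoods of \<open>A\<close>. The matrix entries
    of \<open>pi\<close> are polynomial in those of the argument, so the limit rules for sums and
    products give continuity.\<close>
  define F where "F = (INF \<delta>\<in>{0<..}. principal (S \<delta>))"
  have ev: "eventually Q F \<longleftrightarrow> (\<exists>\<delta>>0. \<forall>B\<in>S \<delta>. Q B)" for Q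
  proof -
    have "eventually Q F \<longleftrightarrow> (\<exists>\<delta>\<in>{0<..}. eventually Q (principal (S \<delta>)))"
      unfolding F_def
    proof (rule eventually_INF_base)
      fix a b :: real assume "a \<in> {0<..}" "b \<in> {0<..}"
      then show "\<exists>x\<in>{0<..}. principal (S x) \<le> inf (principal (S a)) (principal (S b))"
        by (intro bexI[of _ "min a b"]) (auto simp: S_def)
    qed (auto intro: exI[of _ 1])
    then show ?thesis by (auto simp: eventually_principal)
  qed
  have entry: "((\<lambda>B. complex_of_real (B $$ (i, j))) \<longlongrightarrow> of_real (A $$ (i, j))) F" if "i < N" "j < N" for i j
    by (rule tendsto_of_real, rule tendstoI) (use that in \<open>auto simp: ev S_def dist_real_def\<close>)
  have "((\<lambda>B. pi B $$ (i, j)) \<longlongrightarrow> pi A $$ (i, j)) F" if ij: "i < m" "j < m" for i j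
  proof -
    have "((\<lambda>B. ip (R B (w j)) (w i)) \<longlongrightarrow> ip (R A (w j)) (w i)) F"
      unfolding ipr_def
    proof (intro tendsto_sum tendsto_mult tendsto_const)
      fix I assume I: "I \<in> idx N n"
      have "((\<lambda>B. \<Sum>K\<in>idx N n. (\<Prod>l<n. complex_of_real (B $$ (I ! l, K ! l))) * w j K) \<longlongrightarrow>
          (\<Sum>K\<in>idx N n. (\<Prod>l<n. of_real (A $$ (I ! l, K ! l))) * w j K)) F"
        by (intro tendsto_sum tendsto_mult tendsto_const tendsto_prod entry) (use I idx_nth in auto)
      then show "((\<lambda>B. R B (w j) I) \<longlongrightarrow> R A (w j) I) F" using I by (simp add: rho_def)
    qed
    then show ?thesis using ij by (simp add: pi_def)
  qed
  then have "\<forall>ij\<in>{..<m} \<times> {..<m}. \<forall>\<^sub>F B in F. cmod (pi B $$ ij - pi A $$ ij) < \<epsilon>"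
    using tendstoD[OF _ e] by (fastforce simp: dist_norm)
  then have "\<forall>\<^sub>F B in F. \<forall>ij\<in>{..<m} \<times> {..<m}. cmod (pi B $$ ij - pi A $$ ij) < \<epsilon>"
    by (intro eventually_ball_finite) auto
  then obtain \<delta> where "\<delta> > 0" "\<forall>B\<in>S \<delta>. \<forall>ij\<in>{..<m} \<times> {..<m}. cmod (pi B $$ ij - pi A $$ ij) < \<epsilon>"
    using ev by blast
  then show ?thesis by (intro exI[of _ \<delta>]) (auto simp: S_def)
qed

lemma fixed_vectors_pi:
  assumes \<Gamma>: "\<Gamma> \<subseteq> G" and v: "v \<in> fixed_vectors m pi \<Gamma>" and g: "g \<in> \<Gamma>"
  shows "R g (re v) = re v"
proof -
  have vc: "v \<in> carrier_vec m" and "pi g *\<^sub>v v = v" using v g by (auto simp: fixed_vectors_def)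
  then have "co (R g (re v)) = v" using pi_co[of g "re v"] g \<Gamma> by (simp add: co_re subset_iff)
  then have "re (co (R g (re v))) = re v" by simp
  moreover have "R g (re v) \<in> W" using W_inv[of g "re v"] g \<Gamma> by auto
  ultimately show ?thesis by (simp add: re_co)
qed

lemma re_eq_0: "v \<in> carrier_vec m \<Longrightarrow> re v = (\<lambda>_. 0) \<Longrightarrow> v = 0\<^sub>v m"
  using co_re[of v] by (simp add: co_def ipr_def) (simp add: zero_vec_def)

text \<open>An irreducibility criterion: the space is spanned by the orbit of a vector \<open>a\<close>, and \<open>a\<close> spans the
  fixed vectors of a finite subgroup. Averaging over the subgroup shows that a nonzero invariant
  subspace contains \<open>a\<close> unless it is orthogonal to the orbit of \<open>a\<close>.\<close>

lemma irreducible_criterion: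
  assumes span: "\<And>Z. (\<And>g. g \<in> G \<Longrightarrow> R g a \<in> Z) \<Longrightarrow> (\<And>u v. u \<in> Z \<Longrightarrow> v \<in> Z \<Longrightarrow> (\<lambda>x. u x + v x) \<in> Z) \<Longrightarrow>
      (\<And>c u. u \<in> Z \<Longrightarrow> (\<lambda>x. c * u x) \<in> Z) \<Longrightarrow> W \<subseteq> Z"
    and a: "a \<in> W" "a \<noteq> (\<lambda>_. 0)"
    and sub: "subgroup \<Gamma> (SO_group N)" and fin: "finite \<Gamma>"
    and fixa: "\<And>g. g \<in> \<Gamma> \<Longrightarrow> R g a = a"
    and uniq: "\<And>u. u \<in> W \<Longrightarrow> (\<And>g. g \<in> \<Gamma> \<Longrightarrow> R g u = u) \<Longrightarrow> \<exists>c. u = (\<lambda>x. c * a x)"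
  shows "irreducible_unitary_rep N m pi"
proof -
  have \<Gamma>G: "\<Gamma> \<subseteq> G" using sub by (rule subgroup.subset)
  have "m > 0"
  proof (rule ccontr)
    assume "\<not> m > 0"
    then have "a = (\<lambda>_. 0)" using w_expand[OF a(1)] by simp
    then show False using a(2) by simp
  qed
  moreover have "U = {0\<^sub>v m} \<or> U = carrier_vec m"
    if U: "VectorSpace.subspace class_ring U (module_vec TYPE(complex) m)"
      and Uinv: "\<forall>A\<in>G. \<forall>v\<in>U. pi A *\<^sub>v v \<in> U" for U
  proof -
    have sm: "LinearCombinations.submodule class_ring U (module_vec TYPE(complex) m)"
      using U by (simp add: VectorSpace.subspace_def)
    have Uc: "U \<subseteq> carrier_vec m" and U0: "0\<^sub>v m \<in> U"
      and Uadd: "\<And>u v. u \<in> U \<Longrightarrow> v \<in> U \<Longrightarrow> u + v \<in> U"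
      and Usc: "\<And>c v. v \<in> U \<Longrightarrow> c \<cdot>\<^sub>v v \<in> U"
      using sm unfolding LinearCombinations.submodule_def by (auto simp: module_vec_def class_ring_simps)
    \<comment> \<open>The unnormalised average over \<open>\<Gamma>\<close>; it is fixed by
      \<open>\<Gamma>\<close>, hence a multiple of \<open>a\<close>.\<close>
    define av where "av v = (\<lambda>x. \<Sum>g\<in>\<Gamma>. R g (re v) x)" for v
    have coav: "co (av v) \<in> U" if v: "v \<in> U" for v
    proof -
      have "co (\<lambda>x. \<Sum>g\<in>S. R g (re v) x) \<in> U" if "S \<subseteq> \<Gamma>" for S
        using finite_subset[OF that fin] that
      proof (induction S rule: finite_induct)
        case empty
        have "co (\<lambda>x. 0) = 0\<^sub>v m" by (rule eq_vecI) (simp_all add: co_def ipr_def)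
        then show ?case using U0 by simp
      next
        case (insert g S)
        have "co (R g (re v)) = pi g *\<^sub>v v"
          using pi_co[of g "re v"] insert.prems \<Gamma>G v Uc by (auto simp: co_re subset_iff)
        then have "co (R g (re v)) \<in> U" using Uinv insert.prems \<Gamma>G v by auto
        then show ?case using insert Uadd by (simp add: co_add)
      qed
      then show ?thesis unfolding av_def by blast
    qed
    have avW: "av v \<in> W" for v
      unfolding av_def by (rule W_sum[OF fin]) (use W_inv \<Gamma>G in auto)
    have avfix: "R h (av v) = av v" if h: "h \<in> \<Gamma>" for h v
    proof -
      have "R h (av v) = (\<lambda>x. \<Sum>g\<in>\<Gamma>. R (h * g) (re v) x)"
        unfolding av_def rho_sum using rho_mult[of h N _ n "re v"] h \<Gamma>G SO_carrier
        by (intro ext sum.cong refl) (metis subsetD)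
      also have "\<dots> = av v"
        unfolding av_def
      proof (intro ext, rule sum.reindex_bij_witness[of _ "\<lambda>g. transpose_mat h * g" "\<lambda>g. h * g"])
        fix g assume g: "g \<in> \<Gamma>"
        have hG: "h \<in> G" and gG: "g \<in> G" using g h \<Gamma>G by auto
        have tG: "transpose_mat h \<in> \<Gamma>" using subgroup.m_inv_closed[OF sub h] SO_inv[OF hG] by simp
        show "h * g \<in> \<Gamma>" using subgroup.m_closed[OF sub h g] by simp
        show "transpose_mat h * g \<in> \<Gamma>" using subgroup.m_closed[OF sub tG g] by simp
        have c: "h \<in> carrier_mat N N" "g \<in> carrier_mat N N" "transpose_mat h \<in> carrier_mat N N"
          using SO_carrier[OF hG] SO_carrier[OF gG] by auto
        show "transpose_mat h * (h * g) = g"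
          using assoc_mult_mat[OF c(3,1,2)] orthogonal_transpose_mult[OF c(1)] hG c(2) by (simp add: SO_iff)
        show "h * (transpose_mat h * g) = g"
          using assoc_mult_mat[OF c(1,3,2)] hG c(2) by (simp add: SO_iff)
      qed simp
      finally show ?thesis .
    qed
    show ?thesis
    proof (cases "\<exists>v\<in>U. av v \<noteq> (\<lambda>_. 0)")
      case True
      then obtain v where v: "v \<in> U" "av v \<noteq> (\<lambda>_. 0)" by blast
      obtain c where c: "av v = (\<lambda>x. c * a x)" using uniq[OF avW avfix] by blast
      then have c0: "c \<noteq> 0" using v(2) by auto
      have "co (\<lambda>x. inverse c * av v x) \<in> U" unfolding co_scale by (rule Usc[OF coav[OF v(1)]])
      moreover have "(\<lambda>x. inverse c * av v x) = a" using c c0 by (simp add: fun_eq_iff)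
      ultimately have "co a \<in> U" by simp
      then have "W \<subseteq> {u. co u \<in> U}"
        by (intro span) (auto simp: co_add co_scale Uadd Usc Uinv pi_co[symmetric])
      then have "v \<in> U" if "v \<in> carrier_vec m" for v
        using co_re[OF that] re_W[of v] by (metis (mono_tags) mem_Collect_eq subsetD)
      then show ?thesis using Uc by blast
    next
      case False
      \<comment> \<open>Since \<open>\<Gamma>\<close> fixes \<open>a\<close>, pairing the average
        with \<open>a\<close> gives \<open>card \<Gamma>\<close> times the pairing of
        \<open>re v\<close> with \<open>a\<close>. A vanishing average thus means orthogonality to
        \<open>a\<close>.\<close>
      have orth: "ip (re v) a = 0" if v: "v \<in> U" for v
      proof -
        have "0 = ip (av v) a" using False v by (simp add: ipr_def)
        also have "\<dots> = (\<Sum>g\<in>\<Gamma>. ip (re v) (R (transpose_mat g) a))"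
          unfolding av_def ipr_sum_left using \<Gamma>G
          by (intro sum.cong refl ipr_rho_adj SO_carrier) auto
        also have "\<dots> = (\<Sum>g\<in>\<Gamma>. ip (re v) a)"
        proof (intro sum.cong refl)
          fix g assume g: "g \<in> \<Gamma>"
          then have "transpose_mat g \<in> \<Gamma>" using subgroup.m_inv_closed[OF sub g] SO_inv[of g N] \<Gamma>G by auto
          then show "ip (re v) (R (transpose_mat g) a) = ip (re v) a" using fixa by simp
        qed
        finally have "of_nat (card \<Gamma>) * ip (re v) a = 0" by simp
        moreover have "card \<Gamma> \<noteq> 0" using fin subgroup.one_closed[OF sub] by auto
        ultimately show ?thesis by simp
      qed
      have "v = 0\<^sub>v m" if v: "v \<in> U" for v
      proof -
        have vc: "v \<in> carrier_vec m" using v Uc by auto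
        \<comment> \<open>Invariance of \<open>U\<close> carries the orthogonality from
          \<open>a\<close> to its whole orbit.\<close>
        have "ip (re v) (R g a) = 0" if g: "g \<in> G" for g
        proof -
          have tg: "transpose_mat g \<in> G" using SO_transpose[OF g] .
          have "R (transpose_mat g) (re v) = re (co (R (transpose_mat g) (re v)))"
            using W_inv[OF tg re_W] by (simp add: re_co)
          also have "\<dots> = re (pi (transpose_mat g) *\<^sub>v v)" by (simp add: pi_co[OF tg, symmetric] co_re[OF vc])
          finally have "ip (R (transpose_mat g) (re v)) a = 0" using orth Uinv tg v by simp
          then show ?thesis using ipr_rho_adj[OF SO_carrier[OF tg], of n "re v" a] by simp
        qed
        then have "W \<subseteq> {u. ip (re v) u = 0}"
          by (intro span) (auto simp: ipr_add_right ipr_scale_right)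
        then have "ip (re v) (re v) = 0" using re_W by blast
        then have "re v x = 0" if "x \<in> idx N n" for x using ipr_self_eq_0[OF finite_idx _ that] by blast
        then have "re v = (\<lambda>_. 0)" using subsetD[OF W_tens re_W[of v]] by (intro tens_eqI[of _ N n]) (auto simp: tens_def)
        then show ?thesis using re_eq_0[OF vc] by simp
      qed
      then show ?thesis using U0 by blast
    qed
  qed
  ultimately show ?thesis
    unfolding irreducible_unitary_rep_def using pi_hom pi_continuous by blast
qed

end

section \<open>The volume pairing on tensors\<close>

lemma perm_list_idx:
  assumes p: "p permutes {..<N}"
  shows "map p [0..<N] \<in> idx N N"
proof -
  have "set (map p [0..<N]) \<subseteq> {..<N}" using permutes_image[OF p] by (simp add: atLeast0LessThan)
  then show ?thesis by (simp only: idx_def mem_Collect_eq length_map length_upt diff_zero simp_thms)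
qed

text \<open>At most one \<open>p\<close> contributes, so this is the sign of \<open>K\<close> read
  as a permutation, and 0 if \<open>K\<close> is none. It is kept as a sum over \<open>p\<close> so
  that summations can be exchanged.\<close>

lemma det_selection_mat:
  "det (mat N N (\<lambda>(l, k). if k = K ! l then 1 else 0) :: real mat) =
    (\<Sum>p\<in>{p. p permutes {..<N}}. if (\<forall>l<N. p l = K ! l) then of_int (sign p) else 0)"
proof -
  let ?E = "mat N N (\<lambda>(l, k). if k = K ! l then 1 else 0) :: real mat"
  have "signof p * (\<Prod>i = 0..<N. ?E $$ (i, p i)) = (if (\<forall>l<N. p l = K ! l) then of_int (sign p) else 0)"
    if p: "p permutes {..<N}" for p
  proof -
    have e: "(\<Prod>i = 0..<N. ?E $$ (i, p i)) = (\<Prod>i = 0..<N. if p i = K ! i then 1 else 0)"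
      using permutes_in_image[OF p] by (intro prod.cong refl) auto
    show ?thesis
    proof (cases "\<forall>l<N. p l = K ! l")
      case True
      then have "(\<Prod>i = 0..<N. ?E $$ (i, p i)) = 1" unfolding e by (intro prod.neutral) auto
      then show ?thesis using True by simp
    next
      case False
      then have "(\<Prod>i = 0..<N. ?E $$ (i, p i)) = 0" unfolding e by (intro prod_zero) auto
      then show ?thesis using False by (simp only: if_False mult_zero_right)
    qed
  qed
  then show ?thesis
    using det_def'[of ?E N] by (simp add: lessThan_atLeast0)
qed

text \<open>Contraction with the Levi-Civita symbol factors through the top exterior power, on which
  \<open>g\<close> acts by its determinant.\<close>

lemma alternating_sum_rho:
  assumes g: "g \<in> carrier_mat N N"
  shows "(\<Sum>p\<in>{p. p permutes {..<N}}. of_int (sign p) * rho N N g t (map p [0..<N])) =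
    of_real (det g) * (\<Sum>p\<in>{p. p permutes {..<N}}. of_int (sign p) * t (map p [0..<N]))"
proof -
  let ?P = "{p. p permutes {..<N}}"
  let ?E = "\<lambda>K. mat N N (\<lambda>(l, k). if k = K ! l then 1 else 0) :: real mat"
  have d: "(\<Sum>p\<in>?P. of_int (sign p) * (\<Prod>l<N. of_real (g $$ (p l, K ! l)))) =
      complex_of_real (det g * det (?E K))" if K: "K \<in> idx N N" for K
  proof -
    let ?M = "mat N N (\<lambda>(l, j). g $$ (j, K ! l))"
    \<comment> \<open>Row \<open>l\<close> of \<open>?M\<close> is column \<open>K ! l\<close> of
      \<open>g\<close>, so the Leibniz formula for \<open>?M\<close> is the alternating sum in
      question, and the factorisation evaluates it.\<close>
    have "?M = ?E K * transpose_mat g"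
    proof (rule eq_matI)
      fix l j assume "l < dim_row (?E K * transpose_mat g)" "j < dim_col (?E K * transpose_mat g)"
      then have lj: "l < N" "j < N" using g by auto
      have "(?E K * transpose_mat g) $$ (l, j) = (\<Sum>k<N. (if k = K ! l then 1 else 0) * g $$ (j, k))"
        using lj g by (simp add: scalar_prod_def lessThan_atLeast0)
      also have "\<dots> = (\<Sum>k<N. if k = K ! l then g $$ (j, k) else 0)"
        by (intro sum.cong) auto
      also have "\<dots> = g $$ (j, K ! l)" using idx_nth[OF K lj(1)] by simp
      finally show "?M $$ (l, j) = (?E K * transpose_mat g) $$ (l, j)" using lj by simp
    qed (use g in auto)
    then have "det ?M = det g * det (?E K)"
      using det_mult[of "?E K" N "transpose_mat g"] g by (simp add: det_transpose)
    moreover have "det ?M = (\<Sum>p\<in>?P. of_int (sign p) * (\<Prod>l<N. g $$ (p l, K ! l)))"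
    proof -
      have "det ?M = (\<Sum>p\<in>?P. of_int (sign p) * (\<Prod>i = 0..<N. ?M $$ (i, p i)))"
        using det_def'[of ?M N] by (simp add: lessThan_atLeast0)
      also have "\<dots> = (\<Sum>p\<in>?P. of_int (sign p) * (\<Prod>l<N. g $$ (p l, K ! l)))"
      proof (intro sum.cong refl)
        fix p assume "p \<in> ?P"
        then have p: "p permutes {..<N}" by simp
        have "(\<Prod>i = 0..<N. ?M $$ (i, p i)) = (\<Prod>l<N. g $$ (p l, K ! l))"
          unfolding lessThan_atLeast0 using permutes_in_image[OF p] by (intro prod.cong refl) auto
        then show "of_int (sign p) * (\<Prod>i = 0..<N. ?M $$ (i, p i)) = of_int (sign p) * (\<Prod>l<N. g $$ (p l, K ! l))"
          by simp
      qed
      finally show ?thesis .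
    qed
    ultimately have "complex_of_real (det g * det (?E K)) =
        of_real (\<Sum>p\<in>?P. of_int (sign p) * (\<Prod>l<N. g $$ (p l, K ! l)))" by simp
    then show ?thesis by simp
  qed
  have "(\<Sum>p\<in>?P. of_int (sign p) * rho N N g t (map p [0..<N])) =
      (\<Sum>p\<in>?P. \<Sum>K\<in>idx N N. t K * (of_int (sign p) * (\<Prod>l<N. of_real (g $$ (p l, K ! l)))))"
  proof (intro sum.cong refl)
    fix p assume "p \<in> ?P"
    then have "rho N N g t (map p [0..<N]) = (\<Sum>K\<in>idx N N. (\<Prod>l<N. of_real (g $$ (p l, K ! l))) * t K)"
      using perm_list_idx[of p N] by (simp add: rho_def)
    then show "of_int (sign p) * rho N N g t (map p [0..<N]) =
        (\<Sum>K\<in>idx N N. t K * (of_int (sign p) * (\<Prod>l<N. of_real (g $$ (p l, K ! l)))))"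
      by (simp add: sum_distrib_left mult_ac)
  qed
  also have "\<dots> = (\<Sum>K\<in>idx N N. t K * (\<Sum>p\<in>?P. of_int (sign p) * (\<Prod>l<N. of_real (g $$ (p l, K ! l)))))"
    unfolding sum_distrib_left by (rule sum.swap)
  also have "\<dots> = (\<Sum>K\<in>idx N N. of_real (det g) * (\<Sum>p\<in>?P. if K = map p [0..<N] then of_int (sign p) * t K else 0))"
  proof (intro sum.cong refl)
    fix K assume K: "K \<in> idx N N"
    have iff: "(\<forall>l<N. p l = K ! l) \<longleftrightarrow> K = map p [0..<N]" for p
      using idx_length[OF K] by (auto simp: list_eq_iff_nth_eq)
    have "complex_of_real (det (?E K)) = (\<Sum>p\<in>?P. if K = map p [0..<N] then of_int (sign p) else 0)"
      unfolding det_selection_mat iff by (simp add: if_distrib[of complex_of_real] cong: if_cong)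
    then show "t K * (\<Sum>p\<in>?P. of_int (sign p) * (\<Prod>l<N. of_real (g $$ (p l, K ! l)))) =
        of_real (det g) * (\<Sum>p\<in>?P. if K = map p [0..<N] then of_int (sign p) * t K else 0)"
      unfolding d[OF K] of_real_mult
      by (simp add: sum_distrib_left sum_distrib_right if_distrib[of "\<lambda>x. _ * x"] mult_ac cong: if_cong)
  qed
  also have "\<dots> = of_real (det g) * (\<Sum>p\<in>?P. \<Sum>K\<in>idx N N. if K = map p [0..<N] then of_int (sign p) * t K else 0)"
    unfolding sum_distrib_left[symmetric] by (subst sum.swap) (rule refl)
  also have "(\<Sum>p\<in>?P. \<Sum>K\<in>idx N N. if K = map p [0..<N] then of_int (sign p) * t K else 0) =
      (\<Sum>p\<in>?P. of_int (sign p) * t (map p [0..<N]))"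
    by (intro sum.cong refl) (simp add: perm_list_idx)
  finally show ?thesis .
qed

lemma sum_idx_append: "(\<Sum>K\<in>idx N (n + k). f K) = (\<Sum>I\<in>idx N n. \<Sum>J\<in>idx N k. f (I @ J))"
proof (induction n arbitrary: f)
  case (Suc n)
  show ?case unfolding add_Suc sum_idx_Suc Suc.IH by simp
qed simp

lemma prod_lessThan_add:
  fixes f :: "nat \<Rightarrow> 'a::comm_monoid_mult"
  shows "(\<Prod>l<n + k. f l) = (\<Prod>l<n. f l) * (\<Prod>l<k. f (n + l))"
  by (induction k) (simp_all add: mult_ac)

lemma rho_tensor_product:
  assumes I: "I \<in> idx N n" and J: "J \<in> idx N k"
  shows "rho N (n + k) g (\<lambda>K. u (take n K) * v (drop n K)) (I @ J) = rho N n g u I * rho N k g v J"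
proof -
  have IJ: "I @ J \<in> idx N (n + k)" using I J by (auto simp: idx_def)
  have "rho N (n + k) g (\<lambda>K. u (take n K) * v (drop n K)) (I @ J) =
      (\<Sum>K\<in>idx N n. \<Sum>L\<in>idx N k. (\<Prod>l<n + k. of_real (g $$ ((I @ J) ! l, (K @ L) ! l))) *
        (u (take n (K @ L)) * v (drop n (K @ L))))"
    using IJ by (simp add: rho_def sum_idx_append)
  also have "\<dots> = (\<Sum>K\<in>idx N n. \<Sum>L\<in>idx N k. ((\<Prod>l<n. of_real (g $$ (I ! l, K ! l))) * u K) *
      ((\<Prod>l<k. of_real (g $$ (J ! l, L ! l))) * v L))"
  proof (intro sum.cong refl)
    fix K L assume "K \<in> idx N n" "L \<in> idx N k"
    then have len: "length K = n" "length I = n" using I by (auto simp: idx_def)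
    then have "(\<Prod>l<n + k. complex_of_real (g $$ ((I @ J) ! l, (K @ L) ! l))) =
        (\<Prod>l<n. of_real (g $$ (I ! l, K ! l))) * (\<Prod>l<k. of_real (g $$ (J ! l, L ! l)))"
      by (simp add: prod_lessThan_add nth_append)
    then show "(\<Prod>l<n + k. of_real (g $$ ((I @ J) ! l, (K @ L) ! l))) *
        (u (take n (K @ L)) * v (drop n (K @ L))) =
        ((\<Prod>l<n. of_real (g $$ (I ! l, K ! l))) * u K) * ((\<Prod>l<k. of_real (g $$ (J ! l, L ! l))) * v L)"
      using len by (simp add: mult_ac)
  qed
  also have "\<dots> = rho N n g u I * rho N k g v J"
    using I J by (simp add: rho_def sum_product)
  finally show ?thesis .
qed

text \<open>For alternating \<open>u\<close> and \<open>v\<close> this is, up to a constant factor,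
  the coefficient of the volume element in the wedge product of \<open>u\<close> and
  \<open>v\<close>.\<close>

definition volp :: "nat \<Rightarrow> (nat list \<Rightarrow> complex) \<Rightarrow> (nat list \<Rightarrow> complex) \<Rightarrow> complex" where
  "volp n u v = (\<Sum>p\<in>{p. p permutes {..<2 * n}}.
     of_int (sign p) * (u (map p [0..<n]) * v (map p [n..<2 * n])))"

text \<open>The determinant decides everything: it is 1 on SO(2n), which keeps self-duality along an
  orbit, and -1 for a reflection, which turns self-dual into anti-self-dual.\<close>

lemma volp_rho:
  assumes g: "g \<in> carrier_mat (2 * n) (2 * n)"
  shows "volp n (rho (2 * n) n g u) (rho (2 * n) n g v) = of_real (det g) * volp n u v"
proof -
  let ?t = "\<lambda>K. u (take n K) * v (drop n K)"
  have split: "map p [0..<2 * n] = map p [0..<n] @ map p [n..<2 * n]" for p :: "nat \<Rightarrow> nat"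
    using upt_add_eq_append[of 0 n n] by (simp add: mult_2)
  have "rho (2 * n) n g u (map p [0..<n]) * rho (2 * n) n g v (map p [n..<2 * n]) =
      rho (2 * n) (2 * n) g ?t (map p [0..<2 * n])" if p: "p permutes {..<2 * n}" for p
  proof -
    have "p x < 2 * n" if "x < 2 * n" for x
      using permutes_in_image[OF p, of x] that by simp
    then have "map p [0..<n] \<in> idx (2 * n) n" "map p [n..<2 * n] \<in> idx (2 * n) n"
      unfolding idx_def by auto
    from rho_tensor_product[OF this, of g u v] show ?thesis
      unfolding split by (simp add: mult_2[symmetric])
  qed
  then have "volp n (rho (2 * n) n g u) (rho (2 * n) n g v) =
      (\<Sum>p\<in>{p. p permutes {..<2 * n}}. of_int (sign p) * rho (2 * n) (2 * n) g ?t (map p [0..<2 * n]))"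
    by (simp add: volp_def)
  also have "\<dots> = of_real (det g) * volp n u v"
    unfolding alternating_sum_rho[OF g] volp_def by (simp add: split)
  finally show ?thesis .
qed

lemma volp_add: "volp n (\<lambda>x. u x + v x) b = volp n u b + volp n v b"
  by (simp add: volp_def algebra_simps sum.distrib)

lemma volp_scale: "volp n (\<lambda>x. c * u x) b = c * volp n u b"
  by (simp add: volp_def sum_distrib_left mult_ac)

section \<open>The self-dual tensor \<open>e\<^sub>0 \<and> \<dots> \<and> e\<^sub>n\<^sub>-\<^sub>1 + e\<^sub>n \<and> \<dots> \<and> e\<^sub>2\<^sub>n\<^sub>-\<^sub>1\<close>\<close>

text \<open>The wedge of the first \<open>n\<close> basis vectors: its coefficient at
  \<open>I\<close> is the sign of \<open>I\<close> as an ordering of the first block, and 0 for all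
  other lists.\<close>

definition aF :: "nat \<Rightarrow> nat list \<Rightarrow> complex" where
  "aF n I = (\<Sum>q\<in>{q. q permutes {..<n}}. if I = map q [0..<n] then of_int (sign q) else 0)"

lemma permutes_permutation: "p permutes {..<n::nat} \<Longrightarrow> permutation p"
  unfolding permutation_permutes by blast

lemma perm_eq_iff:
  assumes "p permutes {..<n}" "q permutes {..<n}" "map p [0..<n] = map q [0..<n]"
  shows "p = q"
proof
  fix x show "p x = q x"
    using assms by (cases "x < n") (auto simp: permutes_not_in)
qed

lemma aF_map:
  assumes q: "q permutes {..<n}"
  shows "aF n (map q [0..<n]) = of_int (sign q)"
proof -
  have "aF n (map q [0..<n]) = (\<Sum>p\<in>{q. q permutes {..<n}}. if p = q then of_int (sign q) else 0)"
    unfolding aF_def by (intro sum.cong refl) (auto dest: perm_eq_iff[OF q])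
  then show ?thesis using q by (simp add: finite_permutations)
qed

lemma aF_nonzero:
  assumes "aF n I \<noteq> 0"
  obtains q where "q permutes {..<n}" "I = map q [0..<n]"
proof -
  have "\<exists>q. q permutes {..<n} \<and> I = map q [0..<n]"
  proof (rule ccontr)
    assume "\<not> ?thesis"
    then have "aF n I = 0" unfolding aF_def by (intro sum.neutral) auto
    then show False using assms by simp
  qed
  then show ?thesis using that by blast
qed

lemma perm_upt_props:
  assumes q: "q permutes {..<n}"
  shows "distinct (map q [0..<n])" "set (map q [0..<n]) = {..<n}" "length (map q [0..<n]) = n"
  using permutes_inj_on[OF q] permutes_image[OF q] by (auto simp: distinct_map atLeast0LessThan)

lemma permute_map_upt:
  assumes p: "p permutes {..<n}"
  shows "permute_list p (map q [0..<n]) = map (q \<circ> p) [0..<n]"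
proof -
  have "permute_list p (map q [0..<n]) = map q (permute_list p [0..<n])"
    using p by (intro permute_list_map) simp
  then show ?thesis using permute_list_upt[OF p] by simp
qed

lemma aF_alt: "alt n (aF n)"
  unfolding alt_def
proof (intro allI impI)
  fix p and I :: "nat list" assume p: "p permutes {..<n}" and l: "length I = n"
  have *: "aF n (permute_list r J) = of_int (sign r) * aF n J"
    if r: "r permutes {..<n}" and nz: "aF n J \<noteq> 0" for r J
  proof -
    obtain q where q: "q permutes {..<n}" "J = map q [0..<n]" using aF_nonzero[OF nz] .
    have "sign (q \<circ> r) = sign q * sign r"
      by (intro sign_compose permutes_permutation[OF q(1)] permutes_permutation[OF r])
    then show ?thesis
      using q r by (simp add: permute_map_upt aF_map permutes_compose)
  qed
  show "aF n (permute_list p I) = of_int (sign p) * aF n I"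
  proof (cases "aF n I = 0")
    case False
    then show ?thesis using *[OF p] by blast
  next
    case True
    \<comment> \<open>A nonzero value here would, by the nonzero case for the inverse permutation,
      make the value at \<open>I\<close> nonzero.\<close>
    have "aF n (permute_list p I) = 0"
    proof (rule ccontr)
      assume "aF n (permute_list p I) \<noteq> 0"
      from *[OF permutes_inv[OF p] this] this show False
        using True by (simp add: permute_list_inv[OF p l] sign_def split: if_splits)
    qed
    then show ?thesis using True by simp
  qed
qed

lemma aF_tens: "n \<le> N \<Longrightarrow> aF n \<in> tens N n"
proof -
  assume n: "n \<le> N"
  have "aF n I = 0" if "I \<notin> idx N n" for I
  proof (rule ccontr)
    assume "aF n I \<noteq> 0"
    then obtain q where "q permutes {..<n}" "I = map q [0..<n]" by (rule aF_nonzero)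
    then show False using perm_upt_props(2,3)[of q n] that n by (auto simp: idx_def)
  qed
  then show ?thesis by (simp add: tens_def)
qed

lemma sign_sq_mult: "complex_of_int (sign p) * (of_int (sign p) * x) = x"
  by (simp add: sign_def)

text \<open>Each of the \<open>n!\<close> orderings of the first block contributes
  \<open>b [0..<n]\<close>, as the signs of the two factors cancel.\<close>

lemma dot_aF:
  assumes b: "alt n b" and n: "n \<le> N"
  shows "(\<Sum>I\<in>idx N n. aF n I * b I) = fact n * b [0..<n]"
proof -
  let ?Q = "{q. q permutes {..<n}}"
  have "(\<Sum>I\<in>idx N n. aF n I * b I) = (\<Sum>I\<in>idx N n. \<Sum>q\<in>?Q. if I = map q [0..<n] then of_int (sign q) * b I else 0)"
    unfolding aF_def sum_distrib_right by (intro sum.cong refl) simp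
  also have "\<dots> = (\<Sum>q\<in>?Q. \<Sum>I\<in>idx N n. if I = map q [0..<n] then of_int (sign q) * b I else 0)"
    by (rule sum.swap)
  also have "\<dots> = (\<Sum>q\<in>?Q. b [0..<n])"
  proof (intro sum.cong refl)
    fix q assume "q \<in> ?Q"
    then have q: "q permutes {..<n}" by simp
    have "map q [0..<n] \<in> idx N n" using perm_upt_props(2,3)[OF q] n by (auto simp: idx_def)
    then have "(\<Sum>I\<in>idx N n. if I = map q [0..<n] then of_int (sign q) * b I else 0) = of_int (sign q) * b (map q [0..<n])"
      by simp
    also have "\<dots> = b [0..<n]" by (simp add: alt_perm_upt[OF b q] sign_sq_mult)
    finally show "(\<Sum>I\<in>idx N n. if I = map q [0..<n] then of_int (sign q) * b I else 0) = b [0..<n]" .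
  qed
  also have "\<dots> = fact n * b [0..<n]"
    using card_permutations[of "{..<n}" n] by simp
  finally show ?thesis .
qed

section \<open>The block swap and self-duality\<close>

definition bswap :: "nat \<Rightarrow> nat \<Rightarrow> nat" where
  "bswap n i = (if i < n then i + n else if i < 2 * n then i - n else i)"

lemma bswap_bswap [simp]: "bswap n (bswap n i) = i"
  by (auto simp: bswap_def)

lemma bswap_permutes: "bswap n permutes {..<2 * n}"
proof (rule bij_imp_permutes)
  show "bij_betw (bswap n) {..<2 * n} {..<2 * n}"
    by (rule bij_betw_byWitness[of _ "bswap n"]) (auto, auto simp: bswap_def)
qed (auto simp: bswap_def)

interpretation bs: coord_involution "2 * n" "bswap n" for n
  by unfold_locales (simp_all add: bswap_permutes)

text \<open>The blocks commute, so the determinant is that of minus the identity of size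
  \<open>n\<close>. Evenness of \<open>n\<close> enters the proof only here: it puts the swap into
  SO(2n), and through the volume pairing it makes \<open>sd n\<close> self-dual.\<close>

lemma det_bswap: "even n \<Longrightarrow> det (perm_mat (2 * n) (bswap n)) = 1"
proof -
  assume "even n"
  have "perm_mat (2 * n) (bswap n) = four_block_mat (0\<^sub>m n n) (1\<^sub>m n) (1\<^sub>m n) (0\<^sub>m n n)"
    by (rule eq_matI) (auto simp: perm_mat_def bswap_def)
  moreover have "det (four_block_mat (0\<^sub>m n n) (1\<^sub>m n) (1\<^sub>m n) (0\<^sub>m n n) :: real mat) =
      det (0\<^sub>m n n * 0\<^sub>m n n - 1\<^sub>m n * 1\<^sub>m n)"
    by (rule det_four_block_mat) auto
  moreover have "(0\<^sub>m n n * 0\<^sub>m n n - 1\<^sub>m n * 1\<^sub>m n :: real mat) = (-1) \<cdot>\<^sub>m 1\<^sub>m n"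
    by (rule eq_matI) auto
  ultimately show ?thesis using \<open>even n\<close> by simp
qed

lemma bswap_upt: "map (bswap n) [0..<n] = [n..<2 * n]"
  by (rule nth_equalityI) (auto simp: bswap_def)

text \<open>Wedging with the first block retains only the component of \<open>b\<close> on the
  complementary block. The contributing permutations preserve both blocks, which accounts for one
  factor \<open>n!\<close> per block.\<close>

lemma volp_aF:
  assumes b: "alt n b"
  shows "volp n (aF n) b = fact n * (fact n * b [n..<2 * n])"
proof -
  let ?Q = "{q. q permutes {..<n}}" and ?P = "{p. p permutes {..<2 * n}}" and ?P' = "{p. p permutes {n..<2 * n}}"
  have val: "of_int (sign p) * b (map p [n..<2 * n]) = b [n..<2 * n]" if p: "p permutes {n..<2 * n}" for p
  proof -
    \<comment> \<open>Alternation concerns the list positions below \<open>n\<close>, whereas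
      \<open>p\<close> moves the values from \<open>n\<close> to \<open>2 * n - 1\<close>.
      Conjugation by the swap translates one into the other and keeps the sign.\<close>
    let ?r = "bswap n \<circ> p \<circ> bswap n"
    have p2: "p permutes {..<2 * n}" by (rule permutes_subset[OF p]) auto
    have "?r permutes {..<2 * n}" by (intro permutes_compose bswap_permutes p2)
    then have r: "?r permutes {..<n}"
    proof (rule permutes_superset)
      show "?r x = x" if "x \<in> {..<2 * n} - {..<n}" for x
      proof -
        have "bswap n x \<notin> {n..<2 * n}" using that by (auto simp: bswap_def)
        then have "p (bswap n x) = bswap n x" by (rule permutes_not_in[OF p])
        then show ?thesis by simp
      qed
    qed
    have perm: "permutation (bswap n)" "permutation p"
      using permutes_permutation[OF bswap_permutes] permutes_permutation[OF p2] by auto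
    have "sign ?r = sign (bswap n) * sign p * sign (bswap n)"
      using perm by (simp add: sign_compose permutation_compose)
    also have "\<dots> = sign p" by (simp add: sign_def)
    finally have s: "sign ?r = sign p" .
    have "map p [n..<2 * n] = map (bswap n) (map ?r [0..<n])"
      unfolding bswap_upt[symmetric] by simp
    also have "\<dots> = permute_list ?r [n..<2 * n]"
      using permute_map_upt[OF r, of "bswap n"] by (simp add: bswap_upt)
    finally have "b (map p [n..<2 * n]) = of_int (sign p) * b [n..<2 * n]"
      using b r s by (simp add: alt_def)
    then show ?thesis by (simp add: sign_sq_mult)
  qed
  have sub: "?P' \<subseteq> ?P"
  proof
    fix p assume "p \<in> ?P'"
    then have p: "p permutes {n..<2 * n}" by simp
    have "p permutes {..<2 * n}" by (rule permutes_subset[OF p]) auto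
    then show "p \<in> ?P" by simp
  qed
  have mem: "p \<in> ?P' \<longleftrightarrow> (\<forall>k<n. p k = k)" if p: "p \<in> ?P" for p
  proof
    assume "p \<in> ?P'"
    then show "\<forall>k<n. p k = k" by (auto intro: permutes_not_in)
  next
    assume *: "\<forall>k<n. p k = k"
    have "p permutes {..<2 * n}" using p by simp
    then have "p permutes {n..<2 * n}" by (rule permutes_superset) (use * in auto)
    then show "p \<in> ?P'" by simp
  qed
  have T: "(\<Sum>p\<in>?P. if map p [0..<n] = map q [0..<n] then of_int (sign q) * (of_int (sign p) * b (map p [n..<2 * n])) else 0)
      = fact n * b [n..<2 * n]" (is "(\<Sum>p\<in>?P. ?h p) = _") if "q \<in> ?Q" for q
  proof -
    have q: "q permutes {..<n}" using that by simp
    have q2: "q permutes {..<2 * n}" by (rule permutes_subset[OF q]) auto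
    \<comment> \<open>Translating by \<open>q\<close> reduces the condition to \<open>p\<close>
      fixing the first block pointwise, that is, to \<open>p\<close> being a permutation of the
      second block.\<close>
    have "(\<Sum>p\<in>?P. ?h p) = (\<Sum>p\<in>?P. ?h (q \<circ> p))"
      using setum_permutations_compose_left[OF q2, of ?h] by simp
    also have "\<dots> = (\<Sum>p\<in>?P. if p \<in> ?P' then b [n..<2 * n] else 0)"
    proof (intro sum.cong refl)
      fix p assume p: "p \<in> ?P"
      have inj: "q x = q y \<longleftrightarrow> x = y" for x y using permutes_inj[OF q] by (auto dest: injD)
      have c: "map (q \<circ> p) [0..<n] = map q [0..<n] \<longleftrightarrow> p \<in> ?P'"
        unfolding mem[OF p] by (auto simp: inj)
      show "?h (q \<circ> p) = (if p \<in> ?P' then b [n..<2 * n] else 0)"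
      proof (cases "p \<in> ?P'")
        case True
        then have p': "p permutes {n..<2 * n}" by simp
        have sqp: "sign (q \<circ> p) = sign q * sign p"
          using p by (intro sign_compose permutes_permutation[OF q2] permutes_permutation[of p "2 * n"]) simp
        have mqp: "map (q \<circ> p) [n..<2 * n] = map p [n..<2 * n]"
        proof (rule map_cong[OF refl])
          fix x assume "x \<in> set [n..<2 * n]"
          then have "p x \<in> {n..<2 * n}" using permutes_in_image[OF p', of x] by auto
          then show "(q \<circ> p) x = p x" using permutes_not_in[OF q, of "p x"] by auto
        qed
        have "of_int (sign q) * (of_int (sign (q \<circ> p)) * b (map (q \<circ> p) [n..<2 * n])) =
            of_int (sign p) * b (map p [n..<2 * n])"
          unfolding sqp mqp of_int_mult mult.assoc sign_sq_mult ..
        moreover have "map (q \<circ> p) [0..<n] = map q [0..<n]" using c True by blast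
        ultimately show ?thesis using True val[OF p'] by (simp only: if_True simp_thms)
      next
        case False
        then have "map (q \<circ> p) [0..<n] \<noteq> map q [0..<n]" using c by blast
        then show ?thesis using False by (simp only: if_False)
      qed
    qed
    also have "\<dots> = (\<Sum>p\<in>?P'. b [n..<2 * n])"
      using sub finite_permutations[of "{..<2 * n}"] by (simp add: sum.If_cases Int_absorb1)
    also have "\<dots> = fact n * b [n..<2 * n]"
      using card_permutations[of "{n..<2 * n}" n] by simp
    finally show ?thesis .
  qed
  have "volp n (aF n) b = (\<Sum>p\<in>?P. \<Sum>q\<in>?Q. if map p [0..<n] = map q [0..<n] then of_int (sign q) * (of_int (sign p) * b (map p [n..<2 * n])) else 0)"
    unfolding volp_def aF_def by (simp add: sum_distrib_left sum_distrib_right if_distrib[of "\<lambda>x. _ * x"] if_distrib[of "\<lambda>x. x * _"] mult_ac cong: if_cong)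
  also have "\<dots> = (\<Sum>q\<in>?Q. fact n * b [n..<2 * n])"
    by (subst sum.swap) (intro sum.cong refl T)
  also have "\<dots> = fact n * (fact n * b [n..<2 * n])"
    using card_permutations[of "{..<n}" n] by simp
  finally show ?thesis .
qed

text \<open>The tensor called \<open>a\<close> in the overview. The second wedge is written as the
  swapped first one, which makes invariance under the swap immediate.\<close>

definition sd :: "nat \<Rightarrow> nat list \<Rightarrow> complex" where
  "sd n = (\<lambda>I. aF n I + rho (2 * n) n (perm_mat (2 * n) (bswap n)) (aF n) I)"

lemma alt_add: "alt n s \<Longrightarrow> alt n t \<Longrightarrow> alt n (\<lambda>I. s I + t I)"
  by (simp add: alt_def algebra_simps)

lemma alt_scale: "alt n t \<Longrightarrow> alt n (\<lambda>I. c * t I)"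
  by (simp add: alt_def)

lemma tens_add: "s \<in> tens N n \<Longrightarrow> t \<in> tens N n \<Longrightarrow> (\<lambda>I. s I + t I) \<in> tens N n"
  by (simp add: tens_def)

lemma tens_scale: "t \<in> tens N n \<Longrightarrow> (\<lambda>I. c * t I) \<in> tens N n"
  by (simp add: tens_def)

lemma sd_alt: "alt n (sd n)"
  unfolding sd_def by (intro alt_add rho_alt aF_alt)

lemma sd_tens: "sd n \<in> tens (2 * n) n"
  unfolding sd_def by (intro tens_add rho_tens aF_tens) simp

lemma upt_idx: "[0..<n] \<in> idx (2 * n) n"
  by (auto simp: idx_def)

lemma rho_bswap: "I \<in> idx (2 * n) n \<Longrightarrow> rho (2 * n) n (perm_mat (2 * n) (bswap n)) t I = t (map (bswap n) I)"
  by (rule rho_perm_mat) simp_all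

lemma aF_support: "aF n I \<noteq> 0 \<Longrightarrow> distinct I \<and> set I = {..<n}"
  by (metis aF_nonzero perm_upt_props(1,2))

lemma sd_upt:
  assumes "n > 0"
  shows "sd n [0..<n] = 1"
proof -
  have "n \<in> set [n..<2 * n]" "n \<notin> {..<n}" using assms by auto
  then have "aF n [n..<2 * n] = 0" using aF_support[of n "[n..<2 * n]"] by metis
  moreover have "aF n [0..<n] = 1" using aF_map[OF permutes_id, of n] by simp
  ultimately show ?thesis by (simp add: sd_def rho_bswap[OF upt_idx] bswap_upt)
qed

lemma rho_bswap_bswap:
  assumes "t \<in> tens (2 * n) n"
  shows "rho (2 * n) n (perm_mat (2 * n) (bswap n)) (rho (2 * n) n (perm_mat (2 * n) (bswap n)) t) = t"
  unfolding rho_mult[OF perm_mat_carrier perm_mat_carrier, symmetric] bs.P_P by (rule rho_one[OF assms])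

lemma rho_bswap_sd: "rho (2 * n) n (perm_mat (2 * n) (bswap n)) (sd n) = sd n"
proof -
  have "aF n \<in> tens (2 * n) n" by (rule aF_tens) simp
  then show ?thesis unfolding sd_def rho_add rho_bswap_bswap[OF \<open>aF n \<in> tens (2 * n) n\<close>]
    by (simp only: add.commute)
qed

text \<open>Up to the factor \<open>n!\<close>, the volume pairing with \<open>sd n\<close> is the dot product with \<open>sd n\<close>:
  this is self-duality.\<close>

lemma volp_sd:
  assumes "even n" and b: "alt n b" "b \<in> tens (2 * n) n"
  shows "volp n (sd n) b = fact n * (\<Sum>I\<in>idx (2 * n) n. sd n I * b I)"
proof -
  let ?S = "perm_mat (2 * n) (bswap n)" and ?R = "rho (2 * n) n"
  let ?dot = "\<lambda>u v. \<Sum>I\<in>idx (2 * n) n. u I * v I"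
  have adj: "?dot (?R ?S u) v = ?dot u (?R ?S v)" for u v
    using rho_dot_adj[of ?S "2 * n" n u v] by (simp add: bs.transpose_P)
  \<comment> \<open>Pairing with the first wedge reads off the component on the second block, and so
    does the dot product with the swapped wedge.\<close>
  have 1: "volp n (aF n) c = fact n * ?dot (?R ?S (aF n)) c" if c: "alt n c" for c
  proof -
    have "?dot (?R ?S (aF n)) c = ?dot (aF n) (?R ?S c)" by (rule adj)
    also have "\<dots> = fact n * ?R ?S c [0..<n]" by (rule dot_aF[OF rho_alt[OF c]]) simp
    also have "?R ?S c [0..<n] = c [n..<2 * n]" by (simp add: rho_bswap[OF upt_idx] bswap_upt)
    finally show ?thesis using volp_aF[OF c] by simp
  qed
  \<comment> \<open>The second wedge is moved to the first block by the swap, which preserves the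
    volume pairing because its determinant is 1.\<close>
  have "volp n (?R ?S (aF n)) b = volp n (?R ?S (aF n)) (?R ?S (?R ?S b))"
    by (simp add: rho_bswap_bswap[OF b(2)])
  also have "\<dots> = volp n (aF n) (?R ?S b)"
    using volp_rho[of ?S n "aF n" "?R ?S b"] det_bswap[OF assms(1)] by simp
  also have "\<dots> = fact n * ?dot (aF n) b"
    using 1[OF rho_alt[OF b(1)], of "2 * n" ?S] adj[of "aF n" "?R ?S b"] rho_bswap_bswap[OF b(2)] by simp
  finally have 2: "volp n (?R ?S (aF n)) b = fact n * ?dot (aF n) b" .
  show ?thesis
    unfolding sd_def volp_add 1[OF b(1)] 2
    by (simp add: algebra_simps sum.distrib)
qed

section \<open>Sign changes and uniqueness of the invariant tensor\<close>

lemma sd_support: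
  assumes I: "I \<in> idx (2 * n) n" and nz: "sd n I \<noteq> 0"
  shows "distinct I \<and> (set I = {..<n} \<or> set I = {n..<2 * n})"
proof -
  have "aF n I \<noteq> 0 \<or> aF n (map (bswap n) I) \<noteq> 0"
    using nz by (auto simp: sd_def rho_bswap[OF I])
  then show ?thesis
  proof
    assume "aF n I \<noteq> 0"
    then show ?thesis using aF_support by blast
  next
    assume "aF n (map (bswap n) I) \<noteq> 0"
    then have d: "distinct (map (bswap n) I)" "set (map (bswap n) I) = {..<n}" using aF_support by blast+
    have "set I = bswap n ` set (map (bswap n) I)" by (simp add: image_image)
    also have "\<dots> = set (map (bswap n) [0..<n])" using d(2) by (simp add: atLeast0LessThan)
    also have "\<dots> = {n..<2 * n}" unfolding bswap_upt by simp
    finally show ?thesis using d(1) by (auto simp: distinct_map)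
  qed
qed

text \<open>Signs are changed in pairs to keep the determinant equal to 1.\<close>

definition flip_mat :: "nat \<Rightarrow> nat \<Rightarrow> nat \<Rightarrow> real mat" where
  "flip_mat N i j = mat N N (\<lambda>(x, y). if x = y then (if x = i \<or> x = j then -1 else 1) else 0)"

lemma prod_flip:
  assumes "finite A" "i \<noteq> j"
  shows "(\<Prod>x\<in>A. if x = i \<or> x = j then -1 else 1 :: 'a::comm_ring_1) =
    (if (i \<in> A) = (j \<in> A) then 1 else -1)"
proof -
  have "(\<Prod>x\<in>A. if x = i \<or> x = j then -1 else 1 :: 'a) =
      (\<Prod>x\<in>A. (if x = i then -1 else 1) * (if x = j then -1 else 1))"
    using assms(2) by (intro prod.cong) auto
  also have "\<dots> = (if i \<in> A then -1 else 1) * (if j \<in> A then -1 else 1)"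
    unfolding prod.distrib using assms(1) by simp
  finally show ?thesis by auto
qed

lemma flip_mat_SO:
  assumes "i < N" "j < N" "i \<noteq> j"
  shows "flip_mat N i j \<in> carrier (SO_group N)"
proof -
  have "flip_mat N i j * transpose_mat (flip_mat N i j) = 1\<^sub>m N"
  proof (rule eq_matI)
    fix x y assume "x < dim_row (1\<^sub>m N)" "y < dim_col (1\<^sub>m N)"
    then have xy: "x < N" "y < N" by auto
    let ?d = "\<lambda>x. if x = i \<or> x = j then -1 else 1 :: real"
    have "(flip_mat N i j * transpose_mat (flip_mat N i j)) $$ (x, y) =
        (\<Sum>z<N. (if x = z then ?d x else 0) * (if y = z then ?d y else 0))"
      using xy by (simp add: flip_mat_def scalar_prod_def lessThan_atLeast0)
    also have "\<dots> = (\<Sum>z<N. if z = x then ?d x * (if y = x then ?d y else 0) else 0)"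
      by (intro sum.cong) auto
    also have "\<dots> = ?d x * (if y = x then ?d y else 0)" using xy by simp
    also have "\<dots> = 1\<^sub>m N $$ (x, y)" using xy by auto
    finally show "(flip_mat N i j * transpose_mat (flip_mat N i j)) $$ (x, y) = 1\<^sub>m N $$ (x, y)" .
  qed (simp_all add: flip_mat_def)
  moreover have "det (flip_mat N i j) = 1"
  proof -
    have "det (flip_mat N i j) = prod_list (diag_mat (flip_mat N i j))"
      by (rule det_upper_triangular[of _ N]) (auto simp: flip_mat_def)
    also have "\<dots> = (\<Prod>x = 0..<N. flip_mat N i j $$ (x, x))"
      by (simp add: prod_list_diag_prod flip_mat_def)
    also have "\<dots> = (\<Prod>x = 0..<N. if x = i \<or> x = j then -1 else 1)"
      by (intro prod.cong) (auto simp: flip_mat_def)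
    also have "\<dots> = 1" using assms by (subst prod_flip) auto
    finally show ?thesis .
  qed
  ultimately show ?thesis by (simp add: SO_iff flip_mat_def)
qed

lemma rho_flip:
  assumes I: "I \<in> idx N n" and d: "distinct I" and ij: "i \<noteq> j"
  shows "rho N n (flip_mat N i j) t I = (if (i \<in> set I) = (j \<in> set I) then t I else - t I)"
proof -
  let ?d = "\<lambda>x. if x = i \<or> x = j then -1 else 1"
  have "rho N n (flip_mat N i j) t I = (\<Prod>l<n. of_real (?d (I ! l))) * t (map (\<lambda>x. x) I)"
    by (rule rho_monomial[OF _ _ I]) (auto simp: flip_mat_def)
  also have "(\<Prod>l<n. complex_of_real (?d (I ! l))) = (\<Prod>x\<in>set I. of_real (?d x))"
    using prod.reindex_bij_betw[OF bij_betw_nth[OF d refl refl], of "\<lambda>x. complex_of_real (?d x)"] idx_length[OF I]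
    by simp
  also have "\<dots> = (\<Prod>x\<in>set I. ?d x)" by (intro prod.cong) auto
  also have "\<dots> = (if (i \<in> set I) = (j \<in> set I) then 1 else -1)" by (rule prod_flip[OF _ ij]) simp
  finally show ?thesis by simp
qed

lemma rho_flip_sd:
  assumes ij: "i < 2 * n" "j < 2 * n" "i \<noteq> j" "(i < n) = (j < n)"
  shows "rho (2 * n) n (flip_mat (2 * n) i j) (sd n) = sd n"
proof (rule tens_eqI[OF rho_tens sd_tens])
  fix I assume I: "I \<in> idx (2 * n) n"
  show "rho (2 * n) n (flip_mat (2 * n) i j) (sd n) I = sd n I"
  proof (cases "distinct I")
    case True
    have "sd n I = 0 \<or> (i \<in> set I) = (j \<in> set I)"
    proof (cases "sd n I = 0")
      case False
      then have "set I = {..<n} \<or> set I = {n..<2 * n}" using sd_support[OF I] by blast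
      then show ?thesis using ij by (metis lessThan_iff atLeastLessThan_iff not_less)
    qed simp
    then show ?thesis using rho_flip[OF I True ij(3), of "sd n"] by auto
  next
    case False
    then show ?thesis
      using alt_not_distinct[OF rho_alt[OF sd_alt] idx_length[OF I] False] alt_not_distinct[OF sd_alt idx_length[OF I] False]
      by simp
  qed
qed

text \<open>An index set of size \<open>n\<close> that is not a block contains some \<open>i\<close>
  and misses some \<open>j\<close> of the same block; changing both signs negates that coefficient,
  which is therefore 0. Alternation fixes the coefficients within a block, and the swap identifies
  the two blocks.\<close>

lemma sd_unique:
  assumes n: "n > 0" and b: "b \<in> tens (2 * n) n" "alt n b"
    and swap: "rho (2 * n) n (perm_mat (2 * n) (bswap n)) b = b"
    and flip: "\<And>i j. i < 2 * n \<Longrightarrow> j < 2 * n \<Longrightarrow> i \<noteq> j \<Longrightarrow> (i < n) = (j < n) \<Longrightarrow>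
       rho (2 * n) n (flip_mat (2 * n) i j) b = b"
  shows "b = (\<lambda>I. b [0..<n] * sd n I)"
proof (rule tens_eqI[OF b(1) tens_scale[OF sd_tens]])
  fix I assume I: "I \<in> idx (2 * n) n"
  have len: "length I = n" using idx_length[OF I] .
  have first: "b J = b [0..<n] * sd n J" if J: "distinct J" "set J = {..<n}" for J
  proof -
    obtain q where q: "q permutes {..<n}" "J = map q [0..<n]" using distinct_perm_upt[OF J] .
    show ?thesis using alt_perm_upt[OF b(2) q(1)] alt_perm_upt[OF sd_alt q(1)] q(2) sd_upt[OF n] by simp
  qed
  show "b I = b [0..<n] * sd n I"
  proof (cases "distinct I")
    case False
    then show ?thesis using alt_not_distinct[OF b(2) len] alt_not_distinct[OF sd_alt len] by simp
  next
    case d: True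
    then have card: "card (set I) = n" using len distinct_card by metis
    consider "set I = {..<n}" | "set I = {n..<2 * n}" | "set I \<noteq> {..<n}" "set I \<noteq> {n..<2 * n}" by blast
    then show ?thesis
    proof cases
      case 1
      then show ?thesis using first[OF d] by simp
    next
      case 2
      have "inj (bswap n)" by (metis bswap_bswap injI)
      then have "distinct (map (bswap n) I)" using d by (simp add: distinct_map inj_on_def inj_def)
      moreover have "set (map (bswap n) I) = {..<n}"
      proof -
        have "set (map (bswap n) I) = bswap n ` set (map (bswap n) [0..<n])"
          using 2 by (simp only: set_map bswap_upt) simp
        also have "\<dots> = {..<n}" by (simp add: image_image atLeast0LessThan)
        finally show ?thesis .
      qed
      ultimately have "b (map (bswap n) I) = b [0..<n] * sd n (map (bswap n) I)" by (rule first)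
      moreover have "b (map (bswap n) I) = b I" using swap rho_bswap[OF I, of b] by simp
      moreover have "sd n (map (bswap n) I) = sd n I" using rho_bswap_sd[of n] rho_bswap[OF I, of "sd n"] by simp
      ultimately show ?thesis by simp
    next
      case 3
      have I2: "set I \<subseteq> {..<2 * n}" using I by (simp add: idx_def)
      obtain i where i: "i \<in> set I" using n len by (cases I) auto
      \<comment> \<open>Otherwise the whole block of \<open>i\<close> lies in \<open>set I\<close>,
        and equality of the cardinalities makes the two sets equal.\<close>
      have "\<exists>j<2 * n. j \<notin> set I \<and> (i < n) = (j < n)"
      proof (rule ccontr)
        assume c: "\<not> ?thesis"
        show False
        proof (cases "i < n")
          case True
          have "x \<in> set I" if "x < n" for x
          proof -
            have "x < 2 * n" using that by linarith
            then show ?thesis using c True that by blast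
          qed
          then have "{..<n} \<subseteq> set I" by auto
          then have "{..<n} = set I" using card by (intro card_subset_eq) auto
          then show False using 3 by simp
        next
          case False
          have "x \<in> set I" if "x \<in> {n..<2 * n}" for x
          proof -
            have "x < 2 * n" "\<not> x < n" using that by auto
            then show ?thesis using c False by blast
          qed
          then have "{n..<2 * n} \<subseteq> set I" by auto
          then have "{n..<2 * n} = set I" using card by (intro card_subset_eq) auto
          then show False using 3 by simp
        qed
      qed
      then obtain j where j: "j < 2 * n" "j \<notin> set I" "(i < n) = (j < n)" by blast
      have ij: "i \<noteq> j" "i < 2 * n" using i j I2 by auto
      have "b I = - b I"
        using flip[OF ij(2) j(1) ij(1) j(3)] rho_flip[OF I d ij(1), of b] i j(2) by simp
      then have "b I = 0" by simp
      moreover have "sd n I = 0" using sd_support[OF I] 3 by blast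
      ultimately show ?thesis by simp
    qed
  qed
qed

section \<open>Intertwining operators from \<open>\<tau>\<^sub>p\<close>\<close>

text \<open>Coordinates on p: the last column is \<open>v\<close> and the last row its negative,
  with 0 in the corner. Values of \<open>v\<close> from \<open>N - 1\<close> on are ignored.\<close>

definition pm :: "nat \<Rightarrow> (nat \<Rightarrow> real) \<Rightarrow> real mat" where
  "pm N v = mat N N (\<lambda>(r, c). if c = N - 1 \<and> r < N - 1 then v r
     else if r = N - 1 \<and> c < N - 1 then - v c else 0)"

text \<open>Indexed by all numbers below \<open>N\<close> to match \<open>idx N\<close>;
  \<open>pe N (N - 1)\<close> is the zero matrix.\<close>

definition pe :: "nat \<Rightarrow> nat \<Rightarrow> real mat" where
  "pe N j = pm N (\<lambda>i. if i = j then 1 else 0)"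

lemma pm_carrier [simp]: "pm N v \<in> carrier_mat N N"
  by (simp add: pm_def)

lemma pm_add: "pm N u + pm N v = pm N (\<lambda>i. u i + v i)"
  by (rule eq_matI) (auto simp: pm_def)

lemma pm_smult: "r \<cdot>\<^sub>m pm N v = pm N (\<lambda>i. r * v i)"
  by (rule eq_matI) (auto simp: pm_def)

lemma trace_form:
  assumes "X \<in> carrier_mat N N" "Y \<in> carrier_mat N N"
  shows "(\<Sum>i<N. (transpose_mat X * Y) $$ (i, i)) = (\<Sum>i<N. \<Sum>r<N. X $$ (r, i) * Y $$ (r, i))"
  using assms by (intro sum.cong refl) (auto simp: scalar_prod_def lessThan_atLeast0)

lemma k_alg_carrier:
  assumes "N > 0" "Y \<in> k_alg N"
  shows "Y \<in> carrier_mat N N"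
proof -
  obtain Z where Z: "Y = four_block_mat Z (0\<^sub>m (N - 1) 1) (0\<^sub>m 1 (N - 1)) (0\<^sub>m 1 1)"
      "Z \<in> carrier_mat (N - 1) (N - 1)"
    using assms(2) by (auto simp: k_alg_def so_alg_def)
  then show ?thesis using assms(1) four_block_carrier_mat[OF Z(2), of "0\<^sub>m 1 1" 1 1] by simp
qed

lemma pm_p_space:
  assumes N: "N > 0"
  shows "pm N v \<in> p_space N"
proof -
  have "transpose_mat (pm N v) = - pm N v"
    by (rule eq_matI) (auto simp: pm_def)
  moreover have "(\<Sum>i<N. (transpose_mat (pm N v) * Y) $$ (i, i)) = 0" if "Y \<in> k_alg N" for Y
  proof -
    obtain Z where Z: "Y = four_block_mat Z (0\<^sub>m (N - 1) 1) (0\<^sub>m 1 (N - 1)) (0\<^sub>m 1 1)"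
        "Z \<in> carrier_mat (N - 1) (N - 1)"
      using \<open>Y \<in> k_alg N\<close> by (auto simp: k_alg_def so_alg_def)
    have Y: "Y \<in> carrier_mat N N" by (rule k_alg_carrier[OF N that])
    have "pm N v $$ (r, i) * Y $$ (r, i) = 0" if "r < N" "i < N" for r i
      using that Z N by (auto simp: pm_def)
    then show ?thesis unfolding trace_form[OF pm_carrier Y] by (intro sum.neutral ballI) auto
  qed
  ultimately show ?thesis by (simp add: p_space_def so_alg_def)
qed

lemma p_space_carrier: "X \<in> p_space N \<Longrightarrow> X \<in> carrier_mat N N"
  by (simp add: p_space_def so_alg_def)

lemma p_space_add:
  assumes N: "N > 0" and X: "X \<in> p_space N" and Z: "Z \<in> p_space N"
  shows "X + Z \<in> p_space N"
proof -
  have c: "X \<in> carrier_mat N N" "Z \<in> carrier_mat N N" using X Z p_space_carrier by auto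
  have t: "transpose_mat X = - X" "transpose_mat Z = - Z" using X Z by (auto simp: p_space_def so_alg_def)
  have "transpose_mat (X + Z) = transpose_mat X + transpose_mat Z" using c by (intro eq_matI) auto
  also have "\<dots> = - (X + Z)" unfolding t using c by (intro eq_matI) auto
  finally have "transpose_mat (X + Z) = - (X + Z)" .
  moreover have "(\<Sum>i<N. (transpose_mat (X + Z) * Y) $$ (i, i)) = 0" if Y: "Y \<in> k_alg N" for Y
  proof -
    have Yc: "Y \<in> carrier_mat N N" by (rule k_alg_carrier[OF N Y])
    have "(\<Sum>i<N. (transpose_mat (X + Z) * Y) $$ (i, i)) =
        (\<Sum>i<N. \<Sum>r<N. X $$ (r, i) * Y $$ (r, i)) + (\<Sum>i<N. \<Sum>r<N. Z $$ (r, i) * Y $$ (r, i))"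
      using c by (simp add: trace_form[OF _ Yc] algebra_simps sum.distrib)
    then show ?thesis using X Z Y by (simp add: trace_form[OF _ Yc, symmetric] c p_space_def)
  qed
  ultimately show ?thesis using c by (simp add: p_space_def so_alg_def)
qed

lemma p_space_smult:
  assumes N: "N > 0" and X: "X \<in> p_space N"
  shows "s \<cdot>\<^sub>m X \<in> p_space N"
proof -
  have c: "X \<in> carrier_mat N N" using X p_space_carrier by auto
  have t: "transpose_mat X = - X" using X by (auto simp: p_space_def so_alg_def)
  have "transpose_mat (s \<cdot>\<^sub>m X) = s \<cdot>\<^sub>m transpose_mat X" using c by (intro eq_matI) auto
  also have "\<dots> = - (s \<cdot>\<^sub>m X)" unfolding t using c by (intro eq_matI) auto
  finally have "transpose_mat (s \<cdot>\<^sub>m X) = - (s \<cdot>\<^sub>m X)" .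
  moreover have "(\<Sum>i<N. (transpose_mat (s \<cdot>\<^sub>m X) * Y) $$ (i, i)) = 0" if Y: "Y \<in> k_alg N" for Y
  proof -
    have Yc: "Y \<in> carrier_mat N N" by (rule k_alg_carrier[OF N Y])
    have "(\<Sum>i<N. (transpose_mat (s \<cdot>\<^sub>m X) * Y) $$ (i, i)) =
        s * (\<Sum>i<N. \<Sum>r<N. X $$ (r, i) * Y $$ (r, i))"
      using c by (simp add: trace_form[OF _ Yc] sum_distrib_left mult.assoc)
    then show ?thesis using X Y by (simp add: trace_form[OF _ Yc, symmetric] c p_space_def)
  qed
  ultimately show ?thesis using c by (simp add: p_space_def so_alg_def)
qed

lemma pm_cong: "(\<And>i. i < N - 1 \<Longrightarrow> u i = v i) \<Longrightarrow> pm N u = pm N v"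
  by (rule eq_matI) (auto simp: pm_def)

lemma linear_expand_pm:
  assumes N: "N > 0"
    and add: "\<forall>a\<in>range (pm N). \<forall>b\<in>range (pm N). \<phi> (a + b) = \<phi> a + \<phi> b"
    and sc: "\<forall>a\<in>range (pm N). \<forall>r. \<phi> (r \<cdot>\<^sub>m a) = of_real r * \<phi> a"
    and X: "X \<in> range (pm N)"
  shows "\<phi> X = (\<Sum>k<N. of_real (X $$ (k, N - 1)) * \<phi> (pe N k) :: complex)"
proof -
  obtain v where v: "X = pm N v" using X by auto
  have z: "\<phi> (pm N (\<lambda>_. 0)) = 0"
    using bspec[OF sc, of "pm N (\<lambda>_. 0)"] pm_smult[of 0 N "\<lambda>_. 0"] by (metis mult_zero_left of_real_0 rangeI)
  have "\<phi> (pm N (\<lambda>i. if i < M then v i else 0)) = (\<Sum>k<M. of_real (v k) * \<phi> (pe N k))" for M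
  proof (induction M)
    case 0
    then show ?case using z by simp
  next
    case (Suc M)
    have "pm N (\<lambda>i. if i < Suc M then v i else 0) = pm N (\<lambda>i. if i < M then v i else 0) + v M \<cdot>\<^sub>m pe N M"
      unfolding pe_def pm_smult pm_add by (rule pm_cong) (auto simp: less_Suc_eq)
    moreover have "v M \<cdot>\<^sub>m pe N M \<in> range (pm N)" unfolding pe_def pm_smult by blast
    note add[rule_format, OF rangeI this, of "\<lambda>i. if i < M then v i else 0"]
    ultimately have "\<phi> (pm N (\<lambda>i. if i < Suc M then v i else 0)) =
        \<phi> (pm N (\<lambda>i. if i < M then v i else 0)) + \<phi> (v M \<cdot>\<^sub>m pe N M)" by (simp only:)
    also have "\<phi> (v M \<cdot>\<^sub>m pe N M) = of_real (v M) * \<phi> (pe N M)" using sc by (simp add: pe_def)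
    finally show ?case using Suc by simp
  qed
  from this[of "N - 1"] have "\<phi> (pm N (\<lambda>i. if i < N - 1 then v i else 0)) =
      (\<Sum>k<N - 1. of_real (v k) * \<phi> (pe N k))" .
  moreover have "pm N (\<lambda>i. if i < N - 1 then v i else 0) = X" unfolding v by (rule pm_cong) simp
  moreover have "(\<Sum>k<N. of_real (X $$ (k, N - 1)) * \<phi> (pe N k)) = (\<Sum>k<N - 1. of_real (v k) * \<phi> (pe N k))"
  proof -
    obtain M where M: "N = Suc M" using N by (cases N) auto
    have "X $$ (M, M) = 0" "\<And>k. k < M \<Longrightarrow> X $$ (k, M) = v k" unfolding v M by (auto simp: pm_def)
    then show ?thesis by (simp add: M)
  qed
  ultimately show ?thesis by simp
qed

lemma multilin_subset: "multilin sc V p F \<Longrightarrow> V' \<subseteq> V \<Longrightarrow> multilin sc V' p F"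
  unfolding multilin_def
proof (intro allI impI)
  fix vs
  assume a: "\<forall>vs. length vs = p \<and> set vs \<subseteq> V \<longrightarrow>
      (\<forall>i<p. \<forall>a\<in>V. \<forall>b\<in>V. F (vs[i := a + b]) = F (vs[i := a]) + F (vs[i := b])) \<and>
      (\<forall>i<p. \<forall>a\<in>V. \<forall>r. F (vs[i := sc r a]) = of_real r * F (vs[i := a]))"
    and V: "V' \<subseteq> V" and vs: "length vs = p \<and> set vs \<subseteq> V'"
  have "length vs = p \<and> set vs \<subseteq> V" using vs V by blast
  from a[rule_format, OF this] V
  show "(\<forall>i<p. \<forall>a\<in>V'. \<forall>b\<in>V'. F (vs[i := a + b]) = F (vs[i := a]) + F (vs[i := b])) \<and>
      (\<forall>i<p. \<forall>a\<in>V'. \<forall>r. F (vs[i := sc r a]) = of_real r * F (vs[i := a]))"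
    by blast
qed

lemma K_sub_props:
  assumes N: "N > 0" and k: "k \<in> K_sub N"
  shows "k \<in> carrier (SO_group N)"
    and "\<And>i. i < N \<Longrightarrow> k $$ (i, N - 1) = (if i = N - 1 then 1 else 0)"
    and "\<And>i. i < N \<Longrightarrow> k $$ (N - 1, i) = (if i = N - 1 then 1 else 0)"
proof -
  obtain M where M: "N = Suc M" using N by (cases N) auto
  obtain B where B: "B \<in> carrier (SO_group M)" "k = four_block_mat B (0\<^sub>m M 1) (0\<^sub>m 1 M) (1\<^sub>m 1)"
    using k by (auto simp: K_sub_def M)
  have Bc: "B \<in> carrier_mat M M" using SO_carrier[OF B(1)] .
  have kc: "k \<in> carrier_mat N N" using four_block_carrier_mat[OF Bc, of "1\<^sub>m 1" 1 1] B(2) by (simp add: M)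
  have "det k = det B * det (1\<^sub>m 1)"
    unfolding B(2) by (rule det_four_block_mat_upper_right_zero[OF Bc]) auto
  then have "det k = 1" using B(1) by (simp add: SO_iff)
  moreover have "k * transpose_mat k = 1\<^sub>m N"
  proof -
    have "transpose_mat k = four_block_mat (transpose_mat B) (0\<^sub>m M 1) (0\<^sub>m 1 M) (1\<^sub>m 1)"
      unfolding B(2) using transpose_four_block_mat[OF Bc, of "0\<^sub>m M 1" 1 "0\<^sub>m 1 M" 1 "1\<^sub>m 1"] by simp
    then have "k * transpose_mat k = four_block_mat (B * transpose_mat B + 0\<^sub>m M 1 * 0\<^sub>m 1 M)
        (B * 0\<^sub>m M 1 + 0\<^sub>m M 1 * 1\<^sub>m 1) (0\<^sub>m 1 M * transpose_mat B + 1\<^sub>m 1 * 0\<^sub>m 1 M)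
        (0\<^sub>m 1 M * 0\<^sub>m M 1 + 1\<^sub>m 1 * 1\<^sub>m 1)"
      using mult_four_block_mat[OF Bc, of "0\<^sub>m M 1" 1 "0\<^sub>m 1 M" 1 "1\<^sub>m 1" "transpose_mat B" M "0\<^sub>m M 1" 1 "0\<^sub>m 1 M" "1\<^sub>m 1"]
        Bc B(2) by simp
    also have "\<dots> = 1\<^sub>m N"
      using Bc B(1) by (intro eq_matI) (auto simp: M SO_iff)
    finally show ?thesis .
  qed
  ultimately show "k \<in> carrier (SO_group N)" using kc by (simp add: SO_iff)
  show "\<And>i. i < N \<Longrightarrow> k $$ (i, N - 1) = (if i = N - 1 then 1 else 0)"
    using Bc unfolding B(2) M by auto
  show "\<And>i. i < N \<Longrightarrow> k $$ (N - 1, i) = (if i = N - 1 then 1 else 0)"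
    using Bc unfolding B(2) M by auto
qed

lemma index_mult_mat_sum:
  assumes "A \<in> carrier_mat N N" "B \<in> carrier_mat N N" "i < N" "j < N"
  shows "(A * B) $$ (i, j) = (\<Sum>k<N. A $$ (i, k) * B $$ (k, j))"
  using assms by (simp add: scalar_prod_def lessThan_atLeast0)

text \<open>The adjoint action of \<open>transpose_mat k\<close> on p is the standard
  representation: basis matrix \<open>i\<close> goes to row \<open>i\<close> of \<open>k\<close>.
  For \<open>i = N - 1\<close> both sides are zero.\<close>

lemma pe_Ad:
  assumes N: "N > 0" and k: "k \<in> K_sub N" and i: "i < N"
  shows "transpose_mat k * pe N i * k = pm N (\<lambda>r. k $$ (i, r))"
proof -
  note kp = K_sub_props[OF N k]
  have kc: "k \<in> carrier_mat N N" using SO_carrier[OF kp(1)] .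
  show ?thesis
  proof (rule eq_matI)
    fix r c assume "r < dim_row (pm N (\<lambda>r. k $$ (i, r)))" "c < dim_col (pm N (\<lambda>r. k $$ (i, r)))"
    then have rc: "r < N" "c < N" by (auto simp: pm_def)
    have pc: "pe N i \<in> carrier_mat N N" by (simp add: pe_def)
    have ent: "pe N i $$ (a, b) = (if a = i then (if b = N - 1 \<and> i < N - 1 then 1 else 0) else 0) -
        (if a = N - 1 then (if b = i \<and> i < N - 1 then 1 else 0) else 0)" if "a < N" "b < N" for a b
      using that by (auto simp: pe_def pm_def)
    have one: "(transpose_mat k * pe N i) $$ (r, b) =
        (if b = N - 1 \<and> i < N - 1 then k $$ (i, r) else 0) - (if b = i \<and> i < N - 1 then k $$ (N - 1, r) else 0)"
      if b: "b < N" for b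
    proof -
      have "(transpose_mat k * pe N i) $$ (r, b) = (\<Sum>a<N. k $$ (a, r) * pe N i $$ (a, b))"
        using rc b kc pc by (simp add: scalar_prod_def lessThan_atLeast0)
      also have "\<dots> = (\<Sum>a<N. (if a = i then (if b = N - 1 \<and> i < N - 1 then k $$ (a, r) else 0) else 0) -
          (if a = N - 1 then (if b = i \<and> i < N - 1 then k $$ (a, r) else 0) else 0))"
        using b by (intro sum.cong refl) (simp add: ent)
      finally show ?thesis using i N by (simp add: sum_subtractf)
    qed
    have "(transpose_mat k * pe N i * k) $$ (r, c) = (\<Sum>b<N. (transpose_mat k * pe N i) $$ (r, b) * k $$ (b, c))"
      by (rule index_mult_mat_sum[OF mult_carrier_mat[OF _ pc] kc rc]) (use kc in simp)
    also have "\<dots> = (\<Sum>b<N. (if b = N - 1 then (if i < N - 1 then k $$ (i, r) * k $$ (b, c) else 0) else 0) -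
        (if b = i then (if i < N - 1 then k $$ (N - 1, r) * k $$ (b, c) else 0) else 0))"
      by (intro sum.cong refl) (simp add: one algebra_simps)
    also have "\<dots> = (if i < N - 1 then k $$ (i, r) * k $$ (N - 1, c) - k $$ (N - 1, r) * k $$ (i, c) else 0)"
      using i N by (simp add: sum_subtractf)
    also have "\<dots> = pm N (\<lambda>r. k $$ (i, r)) $$ (r, c)"
    proof -
      have "i < N - 1 \<or> i = N - 1" using i by linarith
      then show ?thesis
        using rc kp(2)[OF i] kp(3)[OF rc(1)] kp(3)[OF rc(2)] by (auto simp: pm_def)
    qed
    finally show "(transpose_mat k * pe N i * k) $$ (r, c) = pm N (\<lambda>r. k $$ (i, r)) $$ (r, c)" .
  qed (use kc in \<open>auto simp: pm_def\<close>)
qed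

text \<open>The tensor product of the last basis vector, which K fixes, with \<open>f\<close>. It is
  not antisymmetrised; the projection to a space of alternating tensors takes care of that.\<close>

definition tf :: "nat \<Rightarrow> nat \<Rightarrow> (real mat list \<Rightarrow> complex) \<Rightarrow> nat list \<Rightarrow> complex" where
  "tf N p f = (\<lambda>I. if I \<in> idx N (Suc p) \<and> hd I = N - 1 then f (map (pe N) (tl I)) else 0)"

lemma tf_tau_act:
  assumes N: "N > 0" and k: "k \<in> K_sub N" and f: "f \<in> tau_space N p"
  shows "tf N p (tau_act N k f) = rho N (Suc p) k (tf N p f)"
proof (rule tens_eqI[of _ N "Suc p"])
  show "tf N p (tau_act N k f) \<in> tens N (Suc p)" by (simp add: tf_def tens_def)
  note kp = K_sub_props[OF N k]
  have fm: "multilin (\<cdot>\<^sub>m) (p_space N) p f" using f by (simp add: tau_space_def alt_forms_multilin)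
  then have fm': "multilin (\<cdot>\<^sub>m) (range (pm N)) p f"
    by (rule multilin_subset) (use pm_p_space[OF N] in auto)
  \<comment> \<open>An index \<open>N - 1\<close> in a slot of \<open>f\<close> contributes nothing,
    as \<open>pe N (N - 1)\<close> is zero. This bridges the mismatch in the corner, where
    \<open>k\<close> has entry 1 and \<open>pm\<close> has 0.\<close>
  have zero: "f (map (pe N) ys) = 0" if ys: "ys \<in> idx N p" "l < p" "ys ! l = N - 1" for ys l
  proof -
    let ?vs = "map (pe N) ys"
    have vs: "length ?vs = p \<and> set ?vs \<subseteq> p_space N"
      using ys pm_p_space[OF N] by (auto simp: idx_def pe_def)
    have "pe N (N - 1) = 0 \<cdot>\<^sub>m pe N (N - 1)" unfolding pe_def pm_smult by (rule pm_cong) simp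
    then have "?vs = ?vs[l := 0 \<cdot>\<^sub>m pe N (N - 1)]"
      using ys by (metis list_update_id nth_map idx_length)
    moreover have "f (?vs[l := 0 \<cdot>\<^sub>m pe N (N - 1)]) = of_real 0 * f (?vs[l := pe N (N - 1)])"
      using fm[unfolded multilin_def, rule_format, OF vs] ys(2) pm_p_space[OF N] by (simp add: pe_def)
    ultimately show ?thesis by simp
  qed
  fix I assume I: "I \<in> idx N (Suc p)"
  then obtain x xs where x: "I = x # xs" "x < N" "xs \<in> idx N p" by (auto simp: idx_Suc)
  have pexs: "set (map (pe N) xs) \<subseteq> p_space N" using pm_p_space[OF N] by (auto simp: pe_def)
  have "rho N (Suc p) k (tf N p f) I = (\<Sum>y<N. \<Sum>ys\<in>idx N p.
      (\<Prod>l<Suc p. of_real (k $$ ((x # xs) ! l, (y # ys) ! l))) * tf N p f (y # ys))"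
    using I by (simp add: rho_def x(1) sum_idx_Suc del: prod.lessThan_Suc)
  also have "\<dots> = (\<Sum>y<N. if y = N - 1 then of_real (k $$ (x, y)) *
      (\<Sum>ys\<in>idx N p. (\<Prod>l<p. of_real (k $$ (xs ! l, ys ! l))) * f (map (pe N) ys)) else 0)"
  proof (intro sum.cong refl)
    fix y assume y: "y \<in> {..<N}"
    have "tf N p f (y # ys) = (if y = N - 1 then f (map (pe N) ys) else 0)" if "ys \<in> idx N p" for ys
      using y that by (auto simp: tf_def idx_Suc)
    then show "(\<Sum>ys\<in>idx N p. (\<Prod>l<Suc p. of_real (k $$ ((x # xs) ! l, (y # ys) ! l))) * tf N p f (y # ys)) =
        (if y = N - 1 then of_real (k $$ (x, y)) *
        (\<Sum>ys\<in>idx N p. (\<Prod>l<p. of_real (k $$ (xs ! l, ys ! l))) * f (map (pe N) ys)) else 0)"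
      by (simp add: prod.lessThan_Suc_shift sum_distrib_left mult.assoc del: prod.lessThan_Suc)
  qed
  also have "\<dots> = (if x = N - 1 then \<Sum>ys\<in>idx N p. (\<Prod>l<p. of_real (k $$ (xs ! l, ys ! l))) * f (map (pe N) ys) else 0)"
    using N x(2) kp(2)[OF x(2)] by simp
  also have "(\<Sum>ys\<in>idx N p. (\<Prod>l<p. of_real (k $$ (xs ! l, ys ! l))) * f (map (pe N) ys)) =
      f (map (\<lambda>i. pm N (\<lambda>r. k $$ (i, r))) xs)"
  proof -
    let ?vs = "map (\<lambda>i. pm N (\<lambda>r. k $$ (i, r))) xs"
    have lx: "length xs = p" using x(3) by (simp add: idx_def)
    have "f ?vs = (\<Sum>ys\<in>idx N p. (\<Prod>l<p. of_real ((?vs ! l) $$ (ys ! l, N - 1))) * f (map (pe N) ys))"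
      by (rule multilin_expand[where c = "\<lambda>X k. X $$ (k, N - 1)", OF _ _ fm'])
        (use linear_expand_pm[OF N] lx in \<open>auto simp: pe_def\<close>)
    also have "\<dots> = (\<Sum>ys\<in>idx N p. (\<Prod>l<p. of_real (k $$ (xs ! l, ys ! l))) * f (map (pe N) ys))"
    proof (intro sum.cong refl)
      fix ys assume ys: "ys \<in> idx N p"
      show "(\<Prod>l<p. of_real ((?vs ! l) $$ (ys ! l, N - 1))) * f (map (pe N) ys) =
          (\<Prod>l<p. of_real (k $$ (xs ! l, ys ! l))) * f (map (pe N) ys)"
      proof (cases "\<exists>l<p. ys ! l = N - 1")
        case True
        then show ?thesis using zero[OF ys] by auto
      next
        case False
        have "(?vs ! l) $$ (ys ! l, N - 1) = k $$ (xs ! l, ys ! l)" if "l < p" for l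
        proof -
          have "ys ! l < N - 1" using idx_nth[OF ys that] False that by fastforce
          then show ?thesis using that lx by (simp add: pm_def)
        qed
        then show ?thesis by simp
      qed
    qed
    finally show ?thesis by simp
  qed
  also have "map (\<lambda>i. pm N (\<lambda>r. k $$ (i, r))) xs = map (\<lambda>X. transpose_mat k * X * k) (map (pe N) xs)"
    using x(3) pe_Ad[OF N k] by (auto simp: idx_def)
  finally show "tf N p (tau_act N k f) I = rho N (Suc p) k (tf N p f) I"
    using I x(1) pexs by (simp add: tf_def tau_act_def)
qed simp

text \<open>The interior product of \<open>a\<close> with the last basis vector, read as a form on p
  by replacing each matrix with its last column. It is the test form on which the K-map does not
  vanish.\<close>

definition contraction :: "nat \<Rightarrow> nat \<Rightarrow> (nat list \<Rightarrow> complex) \<Rightarrow> real mat list \<Rightarrow> complex" where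
  "contraction N p a Xs = (if length Xs = p \<and> set Xs \<subseteq> p_space N
     then \<Sum>I\<in>idx N p. a ((N - 1) # I) * (\<Prod>l<p. of_real (Xs ! l $$ (I ! l, N - 1))) else 0)"

lemma permutes_Suc_Cons:
  assumes ij: "i < p" "j < p" "i \<noteq> j" and l: "length I = p"
  shows "permute_list (Transposition.transpose (Suc i) (Suc j)) (x # I) =
    x # permute_list (Transposition.transpose i j) I"
proof (rule nth_equalityI)
  have 1: "Transposition.transpose (Suc i) (Suc j) permutes {..<length (x # I)}"
    "Transposition.transpose i j permutes {..<length I}"
    using ij l by (auto intro!: permutes_swap_id)
  fix k assume "k < length (permute_list (Transposition.transpose (Suc i) (Suc j)) (x # I))"
  then show "permute_list (Transposition.transpose (Suc i) (Suc j)) (x # I) ! k =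
      (x # permute_list (Transposition.transpose i j) I) ! k"
    using 1 by (cases k) (auto simp: permute_list_nth Transposition.transpose_def)
qed simp

lemma contraction_tau_space:
  assumes N: "N > 0" and a: "alt (Suc p) a"
  shows "contraction N p a \<in> tau_space N p"
  unfolding tau_space_def alt_forms_def
proof (rule CollectI, rule conjI; intro allI impI)
  fix Xs :: "real mat list" assume Xs: "length Xs = p \<and> set Xs \<subseteq> p_space N"
  have upd: "contraction N p a (Xs[i := Z]) = (\<Sum>I\<in>idx N p. of_real (Z $$ (I ! i, N - 1)) *
      (a ((N - 1) # I) * (\<Prod>l\<in>{..<p} - {i}. of_real (Xs ! l $$ (I ! l, N - 1)))))"
    if i: "i < p" and Z: "Z \<in> p_space N" for i Z
  proof -
    have "length (Xs[i := Z]) = p \<and> set (Xs[i := Z]) \<subseteq> p_space N"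
      using Xs Z set_update_subset_insert[of Xs i Z] by auto
    then have "contraction N p a (Xs[i := Z]) =
        (\<Sum>I\<in>idx N p. a ((N - 1) # I) * (\<Prod>l<p. of_real (Xs[i := Z] ! l $$ (I ! l, N - 1))))"
      by (simp only: contraction_def if_True simp_thms)
    also have "\<dots> = (\<Sum>I\<in>idx N p. of_real (Z $$ (I ! i, N - 1)) *
      (a ((N - 1) # I) * (\<Prod>l\<in>{..<p} - {i}. of_real (Xs ! l $$ (I ! l, N - 1)))))"
    proof (intro sum.cong refl)
      fix I
      have "(\<Prod>l<p. complex_of_real (Xs[i := Z] ! l $$ (I ! l, N - 1))) =
          of_real (Z $$ (I ! i, N - 1)) * (\<Prod>l\<in>{..<p} - {i}. of_real (Xs[i := Z] ! l $$ (I ! l, N - 1)))"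
        using i Xs by (subst prod.remove[of _ i]) auto
      also have "(\<Prod>l\<in>{..<p} - {i}. complex_of_real (Xs[i := Z] ! l $$ (I ! l, N - 1))) =
          (\<Prod>l\<in>{..<p} - {i}. of_real (Xs ! l $$ (I ! l, N - 1)))"
        by (intro prod.cong) auto
      finally show "a ((N - 1) # I) * (\<Prod>l<p. of_real (Xs[i := Z] ! l $$ (I ! l, N - 1))) =
          of_real (Z $$ (I ! i, N - 1)) * (a ((N - 1) # I) * (\<Prod>l\<in>{..<p} - {i}. of_real (Xs ! l $$ (I ! l, N - 1))))"
        by (simp add: mult_ac)
    qed
    finally show ?thesis .
  qed
  have 1: "\<forall>i<p. \<forall>A\<in>p_space N. \<forall>B\<in>p_space N. contraction N p a (Xs[i := A + B]) =
      contraction N p a (Xs[i := A]) + contraction N p a (Xs[i := B])"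
  proof (intro allI impI ballI)
    fix i A B assume i: "i < p" and A: "A \<in> p_space N" and B: "B \<in> p_space N"
    have "(A + B) $$ (I ! i, N - 1) = A $$ (I ! i, N - 1) + B $$ (I ! i, N - 1)" if "I \<in> idx N p" for I
      using p_space_carrier[OF A] p_space_carrier[OF B] idx_nth[OF that i] N by simp
    then show "contraction N p a (Xs[i := A + B]) = contraction N p a (Xs[i := A]) + contraction N p a (Xs[i := B])"
      unfolding upd[OF i A] upd[OF i B] upd[OF i p_space_add[OF N A B]]
      by (simp add: algebra_simps sum.distrib)
  qed
  have 2: "\<forall>i<p. \<forall>A\<in>p_space N. \<forall>r. contraction N p a (Xs[i := r \<cdot>\<^sub>m A]) = of_real r * contraction N p a (Xs[i := A])"
  proof (intro allI impI ballI)
    fix i A r assume i: "i < p" and A: "A \<in> p_space N"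
    have "(r \<cdot>\<^sub>m A) $$ (I ! i, N - 1) = r * A $$ (I ! i, N - 1)" if "I \<in> idx N p" for I
      using p_space_carrier[OF A] idx_nth[OF that i] N by simp
    then show "contraction N p a (Xs[i := r \<cdot>\<^sub>m A]) = of_real r * contraction N p a (Xs[i := A])"
      unfolding upd[OF i A] upd[OF i p_space_smult[OF N A]]
      by (simp add: sum_distrib_left mult.assoc)
  qed
  have 3: "\<forall>i<p. \<forall>j<p. i \<noteq> j \<and> Xs ! i = Xs ! j \<longrightarrow> contraction N p a Xs = 0"
  proof (intro allI impI)
    fix i j assume ij: "i < p" "j < p" "i \<noteq> j \<and> Xs ! i = Xs ! j"
    let ?t = "Transposition.transpose i j"
    have t: "?t permutes {..<p}" using ij by (intro permutes_swap_id) auto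
    have ts: "Transposition.transpose (Suc i) (Suc j) permutes {..<Suc p}" using ij by (intro permutes_swap_id) auto
    let ?h = "\<lambda>I. a ((N - 1) # I) * (\<Prod>l<p. of_real (Xs ! l $$ (I ! l, N - 1)))"
    \<comment> \<open>Exchanging two index slots negates \<open>a\<close> and leaves the product
      alone, because the arguments in these slots coincide; so the sum equals its own
      negative.\<close>
    have neg: "?h (permute_list ?t I) = - ?h I" if I: "I \<in> idx N p" for I
    proof -
      have l: "length I = p" using idx_length[OF I] .
      have "a ((N - 1) # permute_list ?t I) = - a ((N - 1) # I)"
        using a[unfolded alt_def, rule_format, OF ts, of "(N - 1) # I"] l ij
        by (simp add: permutes_Suc_Cons sign_swap_id)
      moreover have "(\<Prod>l<p. complex_of_real (Xs ! l $$ (permute_list ?t I ! l, N - 1))) =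
          (\<Prod>l<p. of_real (Xs ! ?t l $$ (I ! ?t l, N - 1)))"
        using t l ij by (intro prod.cong) (auto simp: permute_list_nth Transposition.transpose_def)
      moreover have "\<dots> = (\<Prod>l<p. of_real (Xs ! l $$ (I ! l, N - 1)))"
        using prod.permute[OF t, of "\<lambda>l. complex_of_real (Xs ! l $$ (I ! l, N - 1))"] by (simp add: o_def)
      ultimately show ?thesis by simp
    qed
    have tt: "permute_list ?t (permute_list ?t I) = I" if "I \<in> idx N p" for I
      using permute_list_compose[of ?t I ?t] t idx_length[OF that] by simp
    have "(\<Sum>I\<in>idx N p. ?h I) = (\<Sum>I\<in>idx N p. ?h (permute_list ?t I))"
      by (rule sum.reindex_bij_witness[of _ "permute_list ?t" "permute_list ?t"])
        (auto simp: permute_list_idx[OF t] tt)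
    also have "\<dots> = - (\<Sum>I\<in>idx N p. ?h I)" unfolding sum_negf[symmetric] by (rule sum.cong[OF refl neg])
    finally have "(\<Sum>I\<in>idx N p. ?h I) = 0" by simp
    then show "contraction N p a Xs = 0" by (simp add: contraction_def)
  qed
  from 1 2 3 show "(\<forall>i<p. \<forall>A\<in>p_space N. \<forall>B\<in>p_space N. contraction N p a (Xs[i := A + B]) =
      contraction N p a (Xs[i := A]) + contraction N p a (Xs[i := B])) \<and>
    (\<forall>i<p. \<forall>A\<in>p_space N. \<forall>r. contraction N p a (Xs[i := r \<cdot>\<^sub>m A]) = of_real r * contraction N p a (Xs[i := A])) \<and>
    (\<forall>i<p. \<forall>j<p. i \<noteq> j \<and> Xs ! i = Xs ! j \<longrightarrow> contraction N p a Xs = 0)"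
    by (intro conjI)
next
  fix Xs :: "real mat list" assume "\<not> (length Xs = p \<and> set Xs \<subseteq> p_space N)"
  then show "contraction N p a Xs = 0" by (simp only: contraction_def if_False)
qed

lemma tf_contraction:
  assumes N: "N > 0" and a: "alt (Suc p) a" and J: "J \<in> idx N p"
  shows "tf N p (contraction N p a) ((N - 1) # J) = a ((N - 1) # J)"
proof -
  have lJ: "length J = p" using idx_length[OF J] .
  have "set (map (pe N) J) \<subseteq> p_space N" using pm_p_space[OF N] by (auto simp: pe_def)
  moreover have "(N - 1) # J \<in> idx N (Suc p)" using N J by (auto simp: idx_Suc)
  ultimately have "tf N p (contraction N p a) ((N - 1) # J) =
      (\<Sum>I\<in>idx N p. a ((N - 1) # I) * (\<Prod>l<p. of_real (map (pe N) J ! l $$ (I ! l, N - 1))))"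
    using lJ by (simp add: tf_def contraction_def)
  also have "\<dots> = (\<Sum>I\<in>idx N p. if I = J then a ((N - 1) # I) else 0)"
  proof (intro sum.cong refl)
    fix I assume I: "I \<in> idx N p"
    have ent: "map (pe N) J ! l $$ (I ! l, N - 1) = (if I ! l = J ! l \<and> J ! l < N - 1 then 1 else 0)" if "l < p" for l
      using that lJ idx_nth[OF I that] idx_nth[OF J that] by (auto simp: pe_def pm_def)
    show "a ((N - 1) # I) * (\<Prod>l<p. of_real (map (pe N) J ! l $$ (I ! l, N - 1))) =
        (if I = J then a ((N - 1) # I) else 0)"
    proof (cases "I = J")
      case True
      show ?thesis
      \<comment> \<open>If \<open>J\<close> contains \<open>N - 1\<close>, the product vanishes
        because a \<open>pe\<close> factor is zero; \<open>a\<close> vanishes as well, having a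
        repeated index.\<close>
      proof (cases "\<exists>l<p. J ! l = N - 1")
        case True
        then have "N - 1 \<in> set J" using lJ by (metis nth_mem)
        then have "\<not> distinct ((N - 1) # J)" by simp
        then have "a ((N - 1) # J) = 0" using alt_not_distinct[OF a] lJ by simp
        then show ?thesis using \<open>I = J\<close> by simp
      next
        case False
        have "(\<Prod>l<p. complex_of_real (map (pe N) J ! l $$ (I ! l, N - 1))) = 1"
        proof (intro prod.neutral ballI)
          fix l assume "l \<in> {..<p}"
          then have l: "l < p" by simp
          have "J ! l < N - 1" using idx_nth[OF J l] False l by fastforce
          then show "complex_of_real (map (pe N) J ! l $$ (I ! l, N - 1)) = 1"
            unfolding ent[OF l] using True by simp
        qed
        then show ?thesis using True by simp
      qed
    next
      case False
      then obtain l where l: "l < p" "I ! l \<noteq> J ! l"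
        using lJ idx_length[OF I] by (auto simp: list_eq_iff_nth_eq)
      then have "complex_of_real (map (pe N) J ! l $$ (I ! l, N - 1)) = 0"
        unfolding ent[OF l(1)] by simp
      then have "(\<Prod>l<p. complex_of_real (map (pe N) J ! l $$ (I ! l, N - 1))) = 0"
        using l(1) by (intro prod_zero) (rule finite_lessThan, rule bexI[of _ l], simp_all)
      then show ?thesis using False by simp
    qed
  qed
  also have "\<dots> = a ((N - 1) # J)" using J by simp
  finally show ?thesis .
qed

text \<open>The test tensor is the part of \<open>a\<close> whose first index is
  \<open>N - 1\<close>, so its product with \<open>a\<close> is its own squared norm. That is
  nonzero by the choice of \<open>J\<close>, whereas a tensor projecting to 0 in \<open>W\<close>
  would be orthogonal to \<open>a\<close>.\<close>

lemma (in orth_rep) Hom_K_nonzero: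
  assumes n: "n = Suc p" and N: "N > 0" and a: "a \<in> W" "alt n a"
    and J: "J \<in> idx N p" "a ((N - 1) # J) \<noteq> 0"
  shows "\<exists>T\<in>Hom_K N p m pi. \<exists>f\<in>tau_space N p. T f \<noteq> 0\<^sub>v m"
proof -
  let ?T = "\<lambda>f. co (tf N p f)"
  have "?T \<in> Hom_K N p m pi"
    unfolding Hom_K_def
  proof (intro CollectI conjI ballI allI)
    fix f g :: "real mat list \<Rightarrow> complex" and c
    show "?T f \<in> carrier_vec m" by simp
    have "tf N p (f + g) = (\<lambda>x. tf N p f x + tf N p g x)" by (auto simp: tf_def fun_eq_iff)
    then show "?T (f + g) = ?T f + ?T g" by (simp add: co_add)
    have "tf N p (\<lambda>Xs. c * f Xs) = (\<lambda>x. c * tf N p f x)" by (auto simp: tf_def fun_eq_iff)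
    then show "?T (\<lambda>Xs. c * f Xs) = c \<cdot>\<^sub>v ?T f" by (simp add: co_scale)
  next
    fix k f assume k: "k \<in> K_sub N" and f: "f \<in> tau_space N p"
    show "?T (tau_act N k f) = pi k *\<^sub>v ?T f"
      using pi_co[OF K_sub_props(1)[OF N k]] tf_tau_act[OF N k f] n by simp
  qed
  moreover have "contraction N p a \<in> tau_space N p" using contraction_tau_space[OF N] a(2) n by simp
  moreover have "?T (contraction N p a) \<noteq> 0\<^sub>v m"
  proof
    let ?t = "tf N p (contraction N p a)"
    assume 0: "co ?t = 0\<^sub>v m"
    have z: "ip ?t (w i) = 0" if "i < m" for i
      using arg_cong[OF 0, of "\<lambda>v. v $ i"] that by (simp add: co_def)
    have e: "a = (\<lambda>x. \<Sum>i<m. ip a (w i) * w i x)" by (rule w_expand[OF a(1)])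
    have "ip ?t a = (\<Sum>i<m. cnj (ip a (w i)) * ip ?t (w i))"
      by (subst e) (simp only: ipr_sum_right ipr_scale_right)
    then have "ip ?t a = 0" by (simp add: z)
    moreover have "?t I * cnj (a I) = ?t I * cnj (?t I)" if I: "I \<in> idx N n" for I
    proof (cases "hd I = N - 1")
      case True
      then obtain K where "I = (N - 1) # K" "K \<in> idx N p" using I n by (auto simp: idx_Suc)
      then show ?thesis using tf_contraction[OF N, of p a] a(2) n by simp
    next
      case False
      then show ?thesis by (simp add: tf_def)
    qed
    ultimately have "ip ?t ?t = 0" by (simp add: ipr_def)
    moreover have "(N - 1) # J \<in> idx N n" using N J n by (auto simp: idx_Suc)
    ultimately have "?t ((N - 1) # J) = 0" using ipr_self_eq_0[OF finite_idx] by blast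
    then show False using tf_contraction[OF N, of p a J] a(2) n J by simp
  qed
  ultimately show ?thesis by (intro bexI[of _ ?T] bexI[of _ "contraction N p a"])
qed

section \<open>The two groups\<close>

definition stab :: "nat \<Rightarrow> real mat set" where
  "stab n = {g \<in> carrier (SO_group (2 * n)). (\<forall>i<2 * n. \<forall>j<2 * n. g $$ (i, j) \<in> \<int>) \<and>
     rho (2 * n) n g (sd n) = sd n}"

lemma stab_SO: "g \<in> stab n \<Longrightarrow> g \<in> carrier (SO_group (2 * n))"
  by (simp add: stab_def)

lemma subgroup_stab: "subgroup (stab n) (SO_group (2 * n))"
proof (rule group.subgroupI[OF group_SO])
  show "stab n \<subseteq> carrier (SO_group (2 * n))" using stab_SO by auto
  have "1\<^sub>m (2 * n) \<in> stab n" using rho_one[OF sd_tens] by (simp add: stab_def SO_one)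
  then show "stab n \<noteq> {}" by auto
  fix g assume g: "g \<in> stab n"
  have gS: "g \<in> carrier (SO_group (2 * n))" and gc: "g \<in> carrier_mat (2 * n) (2 * n)"
    using stab_SO[OF g] SO_carrier by auto
  have "rho (2 * n) n (transpose_mat g) (sd n) = rho (2 * n) n (transpose_mat g) (rho (2 * n) n g (sd n))"
    using g by (simp add: stab_def)
  also have "\<dots> = rho (2 * n) n (transpose_mat g * g) (sd n)"
    using gc by (intro rho_mult[symmetric]) auto
  also have "\<dots> = sd n" using SO_transpose_mult[OF gS] rho_one[OF sd_tens[of n]] by simp
  finally show "inv\<^bsub>SO_group (2 * n)\<^esub> g \<in> stab n"
    using g gc SO_transpose[OF gS] by (simp add: SO_inv[OF gS] stab_def)
  fix h assume h: "h \<in> stab n"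
  have hc: "h \<in> carrier_mat (2 * n) (2 * n)" using stab_SO[OF h] SO_carrier by auto
  have "(g * h) $$ (i, j) \<in> \<int>" if "i < 2 * n" "j < 2 * n" for i j
    unfolding index_mult_mat_sum[OF gc hc that]
    using g h that by (intro Ints_sum Ints_mult) (auto simp: stab_def)
  then show "g \<otimes>\<^bsub>SO_group (2 * n)\<^esub> h \<in> stab n"
    using g h SO_mult[OF gS stab_SO[OF h]] rho_mult[OF gc hc, of n "sd n"] by (simp add: stab_def)
qed

text \<open>Rows of an orthogonal matrix are unit vectors, so integral entries can only be -1, 0 or
  1.\<close>

lemma finite_stab: "finite (stab n)"
proof (rule finite_subset)
  let ?N = "2 * n"
  show "stab n \<subseteq> mat ?N ?N ` (({..<?N} \<times> {..<?N}) \<rightarrow>\<^sub>E {-1, 0, 1})"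
  proof
    fix g assume g: "g \<in> stab n"
    have gS: "g \<in> carrier (SO_group ?N)" and gc: "g \<in> carrier_mat ?N ?N"
      using stab_SO[OF g] SO_carrier by auto
    have e: "g $$ (i, j) \<in> {-1, 0, 1}" if ij: "i < ?N" "j < ?N" for i j
    proof -
      have "(g * transpose_mat g) $$ (i, i) = 1" using gS ij by (simp add: SO_iff)
      then have "(\<Sum>k<?N. g $$ (i, k) * g $$ (i, k)) = 1"
        using index_mult_mat_sum[OF gc _ ij(1) ij(1), of "transpose_mat g"] gc ij by simp
      moreover have "g $$ (i, j) * g $$ (i, j) \<le> (\<Sum>k<?N. g $$ (i, k) * g $$ (i, k))"
        using ij by (intro member_le_sum[of j "{..<?N}" "\<lambda>k. g $$ (i, k) * g $$ (i, k)"]) auto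
      ultimately have le: "g $$ (i, j) * g $$ (i, j) \<le> 1" by simp
      obtain z :: int where z: "g $$ (i, j) = of_int z" using g ij by (auto simp: stab_def elim!: Ints_cases)
      have "z * z \<le> 1" using le unfolding z by (metis of_int_le_1_iff of_int_mult)
      then have "\<bar>z\<bar> \<le> 1" using abs_square_le_1[of z] by (simp add: power2_eq_square)
      then have "z = -1 \<or> z = 0 \<or> z = 1" by linarith
      then show ?thesis using z by auto
    qed
    have "g = mat ?N ?N (restrict (\<lambda>ij. g $$ ij) ({..<?N} \<times> {..<?N}))"
      using gc by (intro eq_matI) auto
    moreover have "restrict (\<lambda>ij. g $$ ij) ({..<?N} \<times> {..<?N}) \<in> ({..<?N} \<times> {..<?N}) \<rightarrow>\<^sub>E {-1, 0, 1}"
    proof (rule restrict_PiE_iff[THEN iffD2], intro ballI)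
      fix ij assume "ij \<in> {..<?N} \<times> {..<?N}"
      then show "g $$ ij \<in> {-1, 0, 1}" using e[of "fst ij" "snd ij"] by auto
    qed
    ultimately show "g \<in> mat ?N ?N ` (({..<?N} \<times> {..<?N}) \<rightarrow>\<^sub>E {-1, 0, 1})" by (rule image_eqI)
  qed
qed (auto intro!: finite_PiE)

lemma stab_fixed:
  assumes n: "even n" "n > 0" and b: "b \<in> tens (2 * n) n" "alt n b"
    and fixb: "\<And>g. g \<in> stab n \<Longrightarrow> rho (2 * n) n g b = b"
  shows "\<exists>c. b = (\<lambda>I. c * sd n I)"
proof -
  have "perm_mat (2 * n) (bswap n) \<in> carrier (SO_group (2 * n))"
    using bs.P_P det_bswap[OF n(1)] by (simp add: SO_iff bs.transpose_P)
  then have "perm_mat (2 * n) (bswap n) \<in> stab n"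
    using rho_bswap_sd by (auto simp: stab_def perm_mat_def)
  moreover have "flip_mat (2 * n) i j \<in> stab n"
    if "i < 2 * n" "j < 2 * n" "i \<noteq> j" "(i < n) = (j < n)" for i j
    using flip_mat_SO[OF that(1-3)] rho_flip_sd[OF that] by (auto simp: stab_def flip_mat_def)
  ultimately have "b = (\<lambda>I. b [0..<n] * sd n I)"
    using sd_unique[OF n(2) b] fixb by blast
  then show ?thesis by blast
qed

text \<open>The space \<open>W\<close> of the overview. Generating it inductively makes its
  induction rule the spanning hypothesis of \<open>irreducible_criterion\<close>.\<close>

inductive_set orbit_span :: "nat \<Rightarrow> (nat list \<Rightarrow> complex) set" for n where
  orbit: "g \<in> carrier (SO_group (2 * n)) \<Longrightarrow> rho (2 * n) n g (sd n) \<in> orbit_span n"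
| add: "u \<in> orbit_span n \<Longrightarrow> v \<in> orbit_span n \<Longrightarrow> (\<lambda>x. u x + v x) \<in> orbit_span n"
| scale: "u \<in> orbit_span n \<Longrightarrow> (\<lambda>x. c * u x) \<in> orbit_span n"

lemma orbit_span_tens: "u \<in> orbit_span n \<Longrightarrow> u \<in> tens (2 * n) n"
  by (induction rule: orbit_span.induct) (simp_all add: tens_add tens_scale)

lemma orbit_span_alt: "u \<in> orbit_span n \<Longrightarrow> alt n u"
  by (induction rule: orbit_span.induct) (simp_all add: alt_add alt_scale rho_alt sd_alt)

lemma orbit_span_rho:
  assumes g: "g \<in> carrier (SO_group (2 * n))" and u: "u \<in> orbit_span n"
  shows "rho (2 * n) n g u \<in> orbit_span n"
  using u
proof (induction rule: orbit_span.induct)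
  case (orbit h)
  then show ?case
    using orbit_span.orbit[OF SO_mult[OF g orbit]] rho_mult[OF SO_carrier[OF g] SO_carrier[OF orbit]] by simp
next
  case (add u v)
  then show ?case unfolding rho_add by (intro orbit_span.add)
next
  case (scale u c)
  then show ?case unfolding rho_scale by (intro orbit_span.scale)
qed

lemma sd_orbit_span: "sd n \<in> orbit_span n"
  using orbit_span.orbit[OF SO_one] rho_one[OF sd_tens] by metis

lemma zero_orbit_span: "(\<lambda>_. 0) \<in> orbit_span n"
  using orbit_span.scale[OF sd_orbit_span, of 0] by simp

text \<open>Move \<open>g\<close> to the other argument as \<open>transpose_mat g\<close>: the
  volume pairing allows this since \<open>det g = 1\<close>, the dot product since the transpose is
  the adjoint. This reduces the claim to \<open>sd n\<close>.\<close>

lemma volp_orbit_span: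
  assumes n: "even n" and u: "u \<in> orbit_span n" and b: "alt n b" "b \<in> tens (2 * n) n"
  shows "volp n u b = fact n * (\<Sum>I\<in>idx (2 * n) n. u I * b I)"
  using u
proof (induction rule: orbit_span.induct)
  case (orbit g)
  have gc: "g \<in> carrier_mat (2 * n) (2 * n)" using SO_carrier[OF orbit] .
  let ?b = "rho (2 * n) n (transpose_mat g) b"
  have "rho (2 * n) n g ?b = rho (2 * n) n (g * transpose_mat g) b" using gc by (intro rho_mult[symmetric]) auto
  also have "\<dots> = b" using orbit rho_one[OF b(2)] by (simp add: SO_iff)
  finally have "volp n (rho (2 * n) n g (sd n)) b = volp n (rho (2 * n) n g (sd n)) (rho (2 * n) n g ?b)" by simp
  also have "\<dots> = volp n (sd n) ?b" using volp_rho[OF gc] orbit by (simp add: SO_iff)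
  also have "\<dots> = fact n * (\<Sum>I\<in>idx (2 * n) n. sd n I * ?b I)" by (rule volp_sd[OF n rho_alt[OF b(1)] rho_tens])
  also have "\<dots> = fact n * (\<Sum>I\<in>idx (2 * n) n. rho (2 * n) n g (sd n) I * b I)"
    using rho_dot_adj[OF gc, of n "sd n" b] by simp
  finally show ?case .
next
  case (add u v)
  then show ?case by (simp add: volp_add algebra_simps sum.distrib)
next
  case (scale u c)
  then show ?case by (simp add: volp_scale sum_distrib_left mult_ac)
qed

section \<open>The reflection and the conjugate group\<close>

abbreviation refl :: "nat \<Rightarrow> real mat" where
  "refl n \<equiv> perm_mat (2 * n) (Transposition.transpose 0 1)"

lemma coord_involution_transpose: "n > 0 \<Longrightarrow> coord_involution (2 * n) (Transposition.transpose 0 1)"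
  by unfold_locales (simp_all add: permutes_swap_id)

lemma det_refl: "n > 0 \<Longrightarrow> det (refl n) = -1"
  using det_perm_mat[of "Transposition.transpose 0 1" "2 * n"] by (simp add: permutes_swap_id sign_swap_id)

text \<open>The reflected tensor is anti-self-dual, so it is not in the span of the orbit of \<open>sd n\<close>.\<close>

lemma orbit_span_refl:
  assumes n: "even n" "n > 0" and t: "t \<in> orbit_span n" "t = (\<lambda>I. c * rho (2 * n) n (refl n) (sd n) I)"
  shows "t = (\<lambda>_. 0)"
proof -
  interpret h: coord_involution "2 * n" "Transposition.transpose 0 1" by (rule coord_involution_transpose[OF n(2)])
  let ?R = "rho (2 * n) n" and ?dot = "\<lambda>u v. \<Sum>I\<in>idx (2 * n) n. u I * v I"
  \<comment> \<open>With the conjugate of \<open>t\<close> as second argument, the bilinear dot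
    product becomes the squared norm of \<open>t\<close>.\<close>
  define b where "b = (\<lambda>I. cnj (t I))"
  have b: "alt n b" "b \<in> tens (2 * n) n"
    using orbit_span_alt[OF t(1)] orbit_span_tens[OF t(1)] by (auto simp: b_def alt_def tens_def)
  have bb: "?R (refl n) (?R (refl n) b) = b"
    unfolding rho_mult[OF perm_mat_carrier perm_mat_carrier, symmetric] h.P_P by (rule rho_one[OF b(2)])
  have "volp n (?R (refl n) (sd n)) b = volp n (?R (refl n) (sd n)) (?R (refl n) (?R (refl n) b))" by (simp only: bb)
  also have "\<dots> = - volp n (sd n) (?R (refl n) b)"
    unfolding volp_rho[OF perm_mat_carrier] det_refl[OF n(2)] by simp
  also have "\<dots> = - (fact n * ?dot (sd n) (?R (refl n) b))"
    unfolding volp_sd[OF n(1) rho_alt[OF b(1)] rho_tens] by simp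
  also have "?dot (sd n) (?R (refl n) b) = ?dot (?R (refl n) (sd n)) b"
    by (rule rho_dot_adj[OF perm_mat_carrier[of "2 * n" "Transposition.transpose 0 1"], of n "sd n" b,
        unfolded h.transpose_P, symmetric])
  finally have "volp n (?R (refl n) (sd n)) b = - (fact n * ?dot (?R (refl n) (sd n)) b)" .
  then have "volp n t b = - (fact n * ?dot t b)"
    unfolding t(2) volp_scale by (simp add: sum_distrib_left mult_ac)
  moreover have "volp n t b = fact n * ?dot t b" by (rule volp_orbit_span[OF n(1) t(1) b])
  ultimately have "?dot t b = 0" by simp
  then have "ipr (idx (2 * n) n) t t = 0" by (simp add: ipr_def b_def)
  then have "t I = 0" if "I \<in> idx (2 * n) n" for I using ipr_self_eq_0[OF finite_idx _ that] by blast
  then show ?thesis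
    using orbit_span_tens[OF t(1)] by (intro tens_eqI[of _ "2 * n" n]) (auto simp: tens_def)
qed

lemma subgroup_conj_refl:
  assumes n: "n > 0" and H: "subgroup H (SO_group (2 * n))"
  shows "subgroup ((\<lambda>g. refl n * g * refl n) ` H) (SO_group (2 * n))"
proof -
  interpret h: coord_involution "2 * n" "Transposition.transpose 0 1" by (rule coord_involution_transpose[OF n])
  let ?N = "2 * n" and ?P = "refl n"
  let ?c = "\<lambda>g. ?P * g * ?P"
  have Pc: "?P \<in> carrier_mat ?N ?N" by simp
  have HG: "H \<subseteq> carrier (SO_group ?N)" using H by (rule subgroup.subset)
  have cG: "?c g \<in> carrier (SO_group ?N)" if g: "g \<in> carrier (SO_group ?N)" for g
  proof -
    have gc: "g \<in> carrier_mat ?N ?N" using SO_carrier[OF g] .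
    have Pg: "?P * g \<in> carrier_mat ?N ?N" using gc by (intro mult_carrier_mat[OF Pc])
    have "?P * transpose_mat ?P = 1\<^sub>m ?N" by (simp only: h.transpose_P h.P_P)
    then have "?c g * transpose_mat (?c g) = 1\<^sub>m ?N"
      using g gc Pg by (intro orthogonal_mult) (simp_all add: SO_iff)
    moreover have "det (?c g) = 1"
      using g det_mult[OF Pg Pc] det_mult[OF Pc gc] det_refl[OF n] by (simp add: SO_iff)
    ultimately show ?thesis using mult_carrier_mat[OF Pg Pc] by (simp add: SO_iff)
  qed
  have cm: "?c g * ?c k = ?c (g * k)" if "g \<in> carrier_mat ?N ?N" "k \<in> carrier_mat ?N ?N" for g k
  proof -
    have "?c g * ?c k = ?P * (g * ((?P * ?P) * (k * ?P)))"
      using that by (simp add: assoc_mult_mat[of _ ?N ?N _ ?N _ ?N] mult_carrier_mat[of _ ?N ?N _ ?N])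
    also have "(?P * ?P) * (k * ?P) = k * ?P"
      unfolding h.P_P by (rule left_mult_one_mat[OF mult_carrier_mat[OF that(2) Pc]])
    also have "?P * (g * (k * ?P)) = ?c (g * k)"
      using that by (simp add: assoc_mult_mat[of _ ?N ?N _ ?N _ ?N] mult_carrier_mat[of _ ?N ?N _ ?N])
    finally show ?thesis .
  qed
  show ?thesis
  proof (rule group.subgroupI[OF group_SO])
    show "?c ` H \<subseteq> carrier (SO_group ?N)" using cG HG by blast
    show "?c ` H \<noteq> {}" using subgroup.one_closed[OF H] by blast
    fix x assume "x \<in> ?c ` H"
    then obtain g where g: "g \<in> H" "x = ?c g" by blast
    have gS: "g \<in> carrier (SO_group ?N)" and gc: "g \<in> carrier_mat ?N ?N" using g HG SO_carrier by auto
    have "transpose_mat x = transpose_mat ?P * transpose_mat (?P * g)"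
      unfolding g(2) by (rule transpose_mult[OF mult_carrier_mat[OF Pc gc] Pc])
    also have "\<dots> = ?P * (transpose_mat g * ?P)"
      by (simp only: transpose_mult[OF Pc gc] h.transpose_P)
    also have "\<dots> = ?c (transpose_mat g)"
      using gc by (intro assoc_mult_mat[of _ ?N ?N _ ?N _ ?N, symmetric]) auto
    finally have "transpose_mat x = ?c (transpose_mat g)" .
    moreover have "transpose_mat g \<in> H" using subgroup.m_inv_closed[OF H g(1)] SO_inv[OF gS] by simp
    ultimately show "inv\<^bsub>SO_group ?N\<^esub> x \<in> ?c ` H" using SO_inv[of x ?N] cG[OF gS] g(2) by auto
    fix y assume "y \<in> ?c ` H"
    then obtain k where k: "k \<in> H" "y = ?c k" by blast
    have kc: "k \<in> carrier_mat ?N ?N" using k HG SO_carrier by auto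
    have "g * k \<in> H" using subgroup.m_closed[OF H g(1) k(1)] by simp
    then show "x \<otimes>\<^bsub>SO_group ?N\<^esub> y \<in> ?c ` H" using cm[OF gc kc] g(2) k(2) by auto
  qed
qed

lemma not_tau_rep_equivalent:
  assumes n: "even n" "n \<ge> 2"
  shows "\<not> tau_rep_equivalent (2 * n) (n - 1) (stab n) ((\<lambda>g. refl n * g * refl n) ` stab n)"
proof -
  let ?N = "2 * n" and ?\<Gamma>' = "(\<lambda>g. refl n * g * refl n) ` stab n"
  have n0: "n > 0" using n by simp
  interpret h: coord_involution ?N "Transposition.transpose 0 1" by (rule coord_involution_transpose[OF n0])
  have supp: "u x = 0" if "u \<in> orbit_span n" "x \<notin> idx ?N n" for u x
    using orbit_span_tens[OF that(1)] that(2) by (simp add: tens_def)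
  obtain m w where mw: "orth_rep ?N n (orbit_span n) m w"
  proof (rule orthonormal_basis_exists[of "idx ?N n" "orbit_span n"])
    fix m :: nat and w :: "nat \<Rightarrow> nat list \<Rightarrow> complex"
    assume "\<And>i. i < m \<Longrightarrow> w i \<in> orbit_span n"
      "\<And>i j. i < m \<Longrightarrow> j < m \<Longrightarrow> ipr (idx ?N n) (w i) (w j) = (if i = j then 1 else 0)"
      "\<And>u. u \<in> orbit_span n \<Longrightarrow> u = (\<lambda>x. \<Sum>i<m. ipr (idx ?N n) u (w i) * w i x)"
    then have "orth_rep ?N n (orbit_span n) m w"
      by unfold_locales (use orbit_span_tens in \<open>auto intro: zero_orbit_span orbit_span.add orbit_span.scale orbit_span_rho\<close>)
    then show thesis by (rule that)
  qed (auto intro: supp zero_orbit_span orbit_span.add orbit_span.scale)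
  interpret orth_rep ?N n "orbit_span n" m w by (rule mw)
  have sd0: "sd n \<noteq> (\<lambda>_. 0)" using sd_upt[OF n0] by (metis zero_neq_one)
  have stabG: "stab n \<subseteq> G" using stab_SO by auto
  have uniq: "\<exists>c. u = (\<lambda>x. c * sd n x)" if "u \<in> orbit_span n" "\<And>g. g \<in> stab n \<Longrightarrow> R g u = u" for u
    by (rule stab_fixed[OF n(1) n0 orbit_span_tens[OF that(1)] orbit_span_alt[OF that(1)] that(2)])
  have irr: "irreducible_unitary_rep ?N m pi"
  proof (rule irreducible_criterion[of "sd n" "stab n"])
    fix Z assume Z: "\<And>g. g \<in> G \<Longrightarrow> R g (sd n) \<in> Z" "\<And>u v. u \<in> Z \<Longrightarrow> v \<in> Z \<Longrightarrow> (\<lambda>x. u x + v x) \<in> Z"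
      "\<And>c u. u \<in> Z \<Longrightarrow> (\<lambda>x. c * u x) \<in> Z"
    show "orbit_span n \<subseteq> Z"
    proof
      fix u assume "u \<in> orbit_span n"
      then show "u \<in> Z" by (induction rule: orbit_span.induct) (use Z in auto)
    qed
  qed (use sd_orbit_span sd0 subgroup_stab finite_stab uniq in \<open>auto simp: stab_def\<close>)
  have hom: "\<exists>T\<in>Hom_K ?N (n - 1) m pi. \<exists>f\<in>tau_space ?N (n - 1). T f \<noteq> 0\<^sub>v m"
  proof -
    \<comment> \<open>Brings the last index \<open>2 * n - 1\<close> to the front of the second
      block, since nonvanishing of the K-map is tested on a coefficient whose first index is
      \<open>N - 1\<close>.\<close>
    let ?q = "Transposition.transpose 0 (n - 1)"
    have q: "?q permutes {..<n}" using n0 by (intro permutes_swap_id) auto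
    let ?I = "permute_list ?q [n..<2 * n]"
    have up: "[n..<2 * n] \<in> idx ?N n" by (auto simp: idx_def)
    have "sd n [n..<2 * n] = sd n (map (bswap n) [0..<n])" by (simp only: bswap_upt)
    also have "\<dots> = 1" using rho_bswap_sd[of n] rho_bswap[OF upt_idx, of n "sd n"] sd_upt[OF n0] by simp
    finally have "sd n ?I = of_int (sign ?q)"
      using sd_alt[of n] q by (simp add: alt_def)
    then have nz: "sd n ?I \<noteq> 0" by (simp add: sign_def)
    have I: "?I \<in> idx ?N n" using permute_list_idx[OF q] up by blast
    have "?I ! 0 = [n..<2 * n] ! ?q 0" using q n0 by (intro permute_list_nth) auto
    then have "?I ! 0 = ?N - 1" using n0 by simp
    moreover have "?I \<in> idx ?N (Suc (n - 1))" using I n0 by simp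
    ultimately obtain J where J: "?I = (?N - 1) # J" "J \<in> idx ?N (n - 1)"
      by (auto simp: idx_Suc)
    show ?thesis
      by (rule Hom_K_nonzero[OF _ _ sd_orbit_span sd_alt J(2)]) (use n0 nz J(1) in auto)
  qed
  have "fixed_vectors m pi (stab n) = range (\<lambda>c. c \<cdot>\<^sub>v co (sd n))"
  proof
    show "fixed_vectors m pi (stab n) \<subseteq> range (\<lambda>c. c \<cdot>\<^sub>v co (sd n))"
    proof
      fix v assume v: "v \<in> fixed_vectors m pi (stab n)"
      obtain c where "re v = (\<lambda>x. c * sd n x)" using uniq[OF re_W fixed_vectors_pi[OF stabG v]] by blast
      then have "co (re v) = c \<cdot>\<^sub>v co (sd n)" by (simp add: co_scale)
      then show "v \<in> range (\<lambda>c. c \<cdot>\<^sub>v co (sd n))" using co_re[of v] v by (auto simp: fixed_vectors_def)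
    qed
    show "range (\<lambda>c. c \<cdot>\<^sub>v co (sd n)) \<subseteq> fixed_vectors m pi (stab n)"
    proof
      fix v assume "v \<in> range (\<lambda>c. c \<cdot>\<^sub>v co (sd n))"
      then obtain c where v: "v = co (\<lambda>x. c * sd n x)" by (auto simp: co_scale)
      have "pi g *\<^sub>v v = v" if "g \<in> stab n" for g
        using pi_co[of g] stabG that unfolding v by (auto simp: rho_scale stab_def)
      then show "v \<in> fixed_vectors m pi (stab n)" using v by (simp add: fixed_vectors_def)
    qed
  qed
  moreover have "co (sd n) \<noteq> 0\<^sub>v m"
  proof
    assume "co (sd n) = 0\<^sub>v m"
    then have "re (0\<^sub>v m) = sd n" using re_co[OF sd_orbit_span] by simp
    moreover have "re (0\<^sub>v m) = (\<lambda>_. 0)" by (simp add: re_def)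
    ultimately show False using sd0 by simp
  qed
  ultimately have n1: "n_mult m pi (stab n) = 1" using n_mult_line[of "co (sd n)" m pi "stab n"] by simp
  have sub': "?\<Gamma>' \<subseteq> G" using subgroup.subset[OF subgroup_conj_refl[OF n0 subgroup_stab]] .
  have "fixed_vectors m pi ?\<Gamma>' = {0\<^sub>v m}"
  proof
    show "fixed_vectors m pi ?\<Gamma>' \<subseteq> {0\<^sub>v m}"
    proof
      fix v assume v: "v \<in> fixed_vectors m pi ?\<Gamma>'"
      \<comment> \<open>The reflected tensor need not lie in \<open>W\<close>, but it is alternating
        and fixed by \<open>stab n\<close>, so it is a multiple of \<open>sd n\<close>. Reflecting
        back exhibits \<open>re v\<close> as an anti-self-dual element of \<open>W\<close>.\<close>
      define u where "u = R (refl n) (re v)"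
      have tt: "re v \<in> tens ?N n" using orbit_span_tens[OF re_W] .
      have uu: "R (refl n) u = re v"
        unfolding u_def rho_mult[OF perm_mat_carrier perm_mat_carrier, symmetric] h.P_P by (rule rho_one[OF tt])
      have "R g u = u" if g: "g \<in> stab n" for g
      proof -
        have gc: "g \<in> carrier_mat ?N ?N" using SO_carrier[OF stab_SO[OF g]] .
        have Pc: "refl n \<in> carrier_mat ?N ?N" by simp
        have Pg: "refl n * g \<in> carrier_mat ?N ?N" by (rule mult_carrier_mat[OF Pc gc])
        have "re v = R (refl n * g * refl n) (re v)" using fixed_vectors_pi[OF sub' v] g by simp
        also have "\<dots> = R (refl n) (R g u)"
          unfolding u_def using rho_mult[OF Pg Pc] rho_mult[OF Pc gc] by simp
        finally have "u = R (refl n) (R (refl n) (R g u))" unfolding u_def by simp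
        also have "\<dots> = R g u"
          unfolding rho_mult[OF perm_mat_carrier perm_mat_carrier, symmetric] h.P_P by (rule rho_one[OF rho_tens])
        finally show ?thesis by simp
      qed
      then obtain c where "u = (\<lambda>x. c * sd n x)"
        using stab_fixed[OF n(1) n0, of u] rho_alt[OF orbit_span_alt[OF re_W]] unfolding u_def by auto
      then have "re v = (\<lambda>x. c * R (refl n) (sd n) x)" using uu by (simp add: rho_scale)
      then have "re v = (\<lambda>_. 0)" by (rule orbit_span_refl[OF n(1) n0 re_W])
      then show "v \<in> {0\<^sub>v m}" using re_eq_0[of v] v by (simp add: fixed_vectors_def)
    qed
    show "{0\<^sub>v m} \<subseteq> fixed_vectors m pi ?\<Gamma>'"
    proof -
      have "pi g *\<^sub>v 0\<^sub>v m = 0\<^sub>v m" for g by (rule eq_vecI) (simp_all add: pi_def)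
      then show ?thesis by (simp add: fixed_vectors_def)
    qed
  qed
  \<comment> \<open>Presents the trivial fixed space as the line through the zero vector, so that
    \<open>n_mult_line\<close> returns 0.\<close>
  moreover have "range (\<lambda>c :: complex. c \<cdot>\<^sub>v 0\<^sub>v m) = {0\<^sub>v m}"
  proof -
    have "c \<cdot>\<^sub>v 0\<^sub>v m = 0\<^sub>v m" for c :: complex by (rule eq_vecI) auto
    then show ?thesis by (simp only: image_constant_conv) simp
  qed
  ultimately have n0': "n_mult m pi ?\<Gamma>' = 0" using n_mult_line[of "0\<^sub>v m" m pi ?\<Gamma>'] by simp
  show ?thesis
  proof
    assume "tau_rep_equivalent ?N (n - 1) (stab n) ?\<Gamma>'"
    then have "n_mult m pi (stab n) = n_mult m pi ?\<Gamma>'"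
      using irr hom unfolding tau_rep_equivalent_def by blast
    then show False using n1 n0' by simp
  qed
qed

theorem theorem4p8:
  fixes n :: nat
  assumes "even n" and "n \<ge> 2"
  shows "\<exists>\<Gamma> \<Gamma>'. subgroup \<Gamma> (SO_group (2 * n)) \<and> finite \<Gamma> \<and>
           subgroup \<Gamma>' (SO_group (2 * n)) \<and> finite \<Gamma>' \<and>
           isospectral_on_forms (2 * n) (n - 1) \<Gamma> \<Gamma>' \<and>
           \<not> tau_rep_equivalent (2 * n) (n - 1) \<Gamma> \<Gamma>'"
proof -
  have n0: "n > 0" using assms by simp
  interpret h: coord_involution "2 * n" "Transposition.transpose 0 1" by (rule coord_involution_transpose[OF n0])
  let ?\<Gamma>' = "(\<lambda>g. refl n * g * refl n) ` stab n"
  have "stab n \<subseteq> carrier_mat (2 * n) (2 * n)" using stab_SO SO_carrier by blast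
  then have "isospectral_on_forms (2 * n) (n - 1) (stab n) ?\<Gamma>'"
    by (rule h.isospectral_conj) (use n0 in simp)
  then show ?thesis
    using subgroup_stab finite_stab subgroup_conj_refl[OF n0 subgroup_stab] not_tau_rep_equivalent[OF assms]
    by (intro exI[of _ "stab n"] exI[of _ ?\<Gamma>']) simp
qed

end
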